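(* Let $\mathrm{Sym}_{\mathrm{fin}}(\mathbb Z)$ be the group of finitely supported bijections of $\mathbb Z$, let $\theta\in\mathrm{Aut}(\mathrm{Sym}_{\mathrm{fin}}(\mathbb Z))$ be the automorphism induced by the translation $n\mapsto n+1$, and let $\Gamma:=\mathrm{Sym}_{\mathrm{fin}}(\mathbb Z)\rtimes_\theta\mathbb Z$. Then $\Gamma$ is two-generated, amenable and i.c.c. Moreover, there exists $N\in\mathrm{Sub}(L(\Gamma))$ such that (1) $[L(\Gamma):N]=2$; (2) $N$ is maximal among the proper von Neumann subalgebras of $L(\Gamma)$; (3) $N$ is not isolated in $\overline{\{\lambda_gN\lambda_g^*:g\in\Gamma\}}$ (closure in $\mathrm{Sub}(L(\Gamma))$).
   Context: A group is i.c.c. if it is non-trivial and every non-trivial conjugacy class is infinite. $L(\Gamma)$ is the group von Neumann algebra with canonical unitaries $\lambda_g$ and canonical trace. For a finite von Neumann algebra $(M,\tau)$, $\mathrm{Sub}(M)$ is the set of unital von Neumann subalgebras of $M$ with the Effros–Maréchal topology: the smallest topology for which all maps $N\mapsto E_N(x)\in \mathrm{L}^2(M,\tau)$, $x\in M$, are norm continuous, $E_N$ being the $\tau$-preserving conditional expectation onto $N$. For $N\in\mathrm{Sub}(M)$ the Pimsner–Popa index is $[M:N]=\lambda(N)^{-1}\in[1,\infty]$, where $\lambda(N)=\sup\{c>0:E_N(x)\geq cx\ \forall x\in M^+\}\in[0,1]$ ($\lambda(N)=0$ if there is no such $c$). *)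

theory Defs
  imports "HOL-Analysis.Analysis" "HOL-Algebra.Bij" "HOL-Algebra.Coset"
    "HOL-Algebra.Generated_Groups" "HOL-Combinatorics.Perm"
begin

section \<open>Groups\<close>

definition two_generated :: "('a, 'b) monoid_scheme \<Rightarrow> bool" where
  "two_generated G \<longleftrightarrow> (\<exists>a\<in>carrier G. \<exists>b\<in>carrier G. generate G {a, b} = carrier G)"

text \<open>Amenability in von Neumann's sense: a finitely additive, left invariant probability
  measure defined on all subsets of the (discrete) group.\<close>

definition amenable :: "('a, 'b) monoid_scheme \<Rightarrow> bool" where
  "amenable G \<longleftrightarrow> (\<exists>\<mu> :: 'a set \<Rightarrow> real.
     \<mu> (carrier G) = 1 \<and>
     (\<forall>A. A \<subseteq> carrier G \<longrightarrow> 0 \<le> \<mu> A) \<and>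
     (\<forall>A B. A \<subseteq> carrier G \<longrightarrow> B \<subseteq> carrier G \<longrightarrow> A \<inter> B = {} \<longrightarrow> \<mu> (A \<union> B) = \<mu> A + \<mu> B) \<and>
     (\<forall>g\<in>carrier G. \<forall>A. A \<subseteq> carrier G \<longrightarrow> \<mu> (g <#\<^bsub>G\<^esub> A) = \<mu> A))"

definition conjugacy_class :: "('a, 'b) monoid_scheme \<Rightarrow> 'a \<Rightarrow> 'a set" where
  "conjugacy_class G x = {g \<otimes>\<^bsub>G\<^esub> x \<otimes>\<^bsub>G\<^esub> inv\<^bsub>G\<^esub> g | g. g \<in> carrier G}"

definition icc :: "('a, 'b) monoid_scheme \<Rightarrow> bool" where
  "icc G \<longleftrightarrow> carrier G \<noteq> {\<one>\<^bsub>G\<^esub>} \<and>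
     (\<forall>x\<in>carrier G. x \<noteq> \<one>\<^bsub>G\<^esub> \<longrightarrow> infinite (conjugacy_class G x))"

text \<open>The semidirect product of \<open>G\<close> with the integers acting through the powers of an
  automorphism; \<open>(a, m)\<close> stands for \<open>a t\<^sup>m\<close>, where \<open>t a t\<^sup>-\<^sup>1 = \<theta> a\<close>.\<close>

definition semidirect_int :: "('a, 'b) monoid_scheme \<Rightarrow> ('a \<Rightarrow> 'a) \<Rightarrow> ('a \<times> int) monoid" where
  "semidirect_int G \<theta> =
     \<lparr>carrier = carrier G \<times> UNIV,
      mult = (\<lambda>(a, m) (b, n). (a \<otimes>\<^bsub>G\<^esub> (\<theta> [^]\<^bsub>AutoGroup G\<^esub> m) b, m + n)),
      one = (\<one>\<^bsub>G\<^esub>, 0)\<rparr>"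

lemma AutoGroup_mult_apply:
  assumes "f \<in> carrier (AutoGroup G)" "g \<in> carrier (AutoGroup G)" "x \<in> carrier G"
  shows "(f \<otimes>\<^bsub>AutoGroup G\<^esub> g) x = f (g x)"
  using assms by (simp add: AutoGroup_def BijGroup_def auto_def compose_def)

lemma group_semidirect_int:
  assumes G: "group G" and \<theta>: "\<theta> \<in> carrier (AutoGroup G)"
  shows "group (semidirect_int G \<theta>)"
proof -
  interpret G: group G by fact
  interpret A: group "AutoGroup G" by (rule G.AutoGroup)
  define p where "p m = \<theta> [^]\<^bsub>AutoGroup G\<^esub> m" for m :: int
  have p: "p m \<in> carrier (AutoGroup G)" for m
    unfolding p_def using \<theta> by simp
  then have hom: "p m \<in> hom G G" for m
    by (auto simp: AutoGroup_def auto_def)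
  have cl: "p m x \<in> carrier G" if "x \<in> carrier G" for m x
    using hom_in_carrier[OF hom that] .
  have mult: "p m (x \<otimes>\<^bsub>G\<^esub> y) = p m x \<otimes>\<^bsub>G\<^esub> p m y"
    if "x \<in> carrier G" "y \<in> carrier G" for m x y
    using hom_mult[OF hom that] .
  have add: "p (m + n) x = p m (p n x)" if "x \<in> carrier G" for m n x
    using AutoGroup_mult_apply[OF p p that, of m n] A.int_pow_mult[OF \<theta>, of m n]
    by (simp add: p_def)
  have zero: "p 0 x = x" if "x \<in> carrier G" for x
    using that by (simp add: p_def AutoGroup_def BijGroup_def)
  have one: "p m \<one>\<^bsub>G\<^esub> = \<one>\<^bsub>G\<^esub>" for m
    using hom_one[OF hom G G] .
  show ?thesis
  proof (rule groupI)
    fix x assume "x \<in> carrier (semidirect_int G \<theta>)"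
    then obtain a m where x: "x = (a, m)" "a \<in> carrier G"
      by (auto simp: semidirect_int_def)
    show "\<exists>y\<in>carrier (semidirect_int G \<theta>).
        y \<otimes>\<^bsub>semidirect_int G \<theta>\<^esub> x = \<one>\<^bsub>semidirect_int G \<theta>\<^esub>"
      using x by (intro bexI[where x = "(p (- m) (inv\<^bsub>G\<^esub> a), - m)"])
        (auto simp: semidirect_int_def p_def[symmetric] cl one mult[symmetric])
  qed (auto simp: semidirect_int_def p_def[symmetric] cl zero add mult G.m_assoc)
qed

text \<open>The type \<^typ>\<open>int perm\<close> consists of the finitely supported bijections of the integers.\<close>

definition Sym_fin :: "int perm monoid" where
  "Sym_fin = \<lparr>carrier = UNIV, mult = (*), one = 1\<rparr>"

text \<open>Conjugation by the translation \<open>n \<mapsto> n + 1\<close>.\<close>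

lift_definition theta :: "int perm \<Rightarrow> int perm"
  is "\<lambda>\<sigma>. (\<lambda>n. n + 1) \<circ> \<sigma> \<circ> (\<lambda>n. n - 1)"
proof -
  fix \<sigma> :: "int \<Rightarrow> int"
  assume *: "bij \<sigma> \<and> finite {a. \<sigma> a \<noteq> a}"
  have "bij (\<lambda>n::int. n + 1)" "bij (\<lambda>n::int. n - 1)"
    by (rule bij_betw_byWitness[where f' = "\<lambda>n. n - 1"]; simp)
      (rule bij_betw_byWitness[where f' = "\<lambda>n. n + 1"]; simp)
  moreover have "{a. ((\<lambda>n. n + 1) \<circ> \<sigma> \<circ> (\<lambda>n. n - 1)) a \<noteq> a} \<subseteq> (\<lambda>n. n + 1) ` {a. \<sigma> a \<noteq> a}"
  proof
    fix x assume "x \<in> {a. ((\<lambda>n. n + 1) \<circ> \<sigma> \<circ> (\<lambda>n. n - 1)) a \<noteq> a}"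
    then show "x \<in> (\<lambda>n. n + 1) ` {a. \<sigma> a \<noteq> a}"
      by (intro image_eqI[of _ _ "x - 1"]) auto
  qed
  ultimately show "bij ((\<lambda>n. n + 1) \<circ> \<sigma> \<circ> (\<lambda>n. n - 1)) \<and>
      finite {a. ((\<lambda>n. n + 1) \<circ> \<sigma> \<circ> (\<lambda>n. n - 1)) a \<noteq> a}"
    using * by (meson bij_comp finite_imageI finite_subset)
qed

definition Gamma_grp :: "(int perm \<times> int) monoid" where
  "Gamma_grp = semidirect_int Sym_fin theta"

lemma group_Sym_fin: "group Sym_fin"
  by (rule groupI) (auto simp: Sym_fin_def mult.assoc intro: perm.left_inverse)

lemma theta_in_AutoGroup: "theta \<in> carrier (AutoGroup Sym_fin)"
proof -
  have "theta (\<sigma> * \<tau>) = theta \<sigma> * theta \<tau>" for \<sigma> \<tau>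
    by transfer auto
  moreover have "inj theta"
  proof (rule injI)
    fix \<sigma> \<tau> assume "theta \<sigma> = theta \<tau>"
    then have eq: "apply \<sigma> (n - 1) = apply \<tau> (n - 1)" for n
      by transfer (metis add_right_cancel comp_apply)
    show "\<sigma> = \<tau>"
      by (rule perm_eqI) (use eq[of "_ + 1"] in simp)
  qed
  moreover have "surj theta"
  proof (rule surjI)
    fix \<sigma> :: "int perm"
    let ?f = "(\<lambda>n. n - 1) \<circ> apply \<sigma> \<circ> (\<lambda>n. n + 1)"
    have "bij (\<lambda>n::int. n + 1)" "bij (\<lambda>n::int. n - 1)"
      by (rule bij_betw_byWitness[where f' = "\<lambda>n. n - 1"]; simp)
        (rule bij_betw_byWitness[where f' = "\<lambda>n. n + 1"]; simp)
    then have "bij ?f" by (simp add: bij_comp)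
    moreover have "{a. ?f a \<noteq> a} \<subseteq> (\<lambda>n. n - 1) ` affected \<sigma>"
    proof
      fix x assume "x \<in> {a. ?f a \<noteq> a}"
      then show "x \<in> (\<lambda>n. n - 1) ` affected \<sigma>"
        by (intro image_eqI[of _ _ "x + 1"]) (auto simp: in_affected)
    qed
    then have "finite {a. ?f a \<noteq> a}"
      using finite_affected finite_subset by blast
    ultimately have "apply (Perm ?f) = ?f"
      by (simp add: Perm_inverse)
    then show "theta (Perm ?f) = \<sigma>"
      by (intro perm_eqI) (simp add: theta.rep_eq)
  qed
  ultimately show ?thesis
    by (auto simp: AutoGroup_def auto_def hom_def Bij_def Sym_fin_def bij_def)
qed

lemma group_Gamma_grp: "group Gamma_grp"
  unfolding Gamma_grp_def by (rule group_semidirect_int[OF group_Sym_fin theta_in_AutoGroup])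

lemma carrier_Gamma_grp: "carrier Gamma_grp = UNIV"
  by (simp add: Gamma_grp_def semidirect_int_def Sym_fin_def)


section \<open>The Hilbert space of square summable functions\<close>

typedef 'a ell2 = "{\<xi> :: 'a \<Rightarrow> complex. (\<lambda>x. (norm (\<xi> x))\<^sup>2) summable_on UNIV}"
  by (rule exI[of _ "\<lambda>_. 0"]) simp

setup_lifting type_definition_ell2

lemma square_summable_add:
  fixes f g :: "'a \<Rightarrow> complex"
  assumes "(\<lambda>x. (norm (f x))\<^sup>2) summable_on UNIV" "(\<lambda>x. (norm (g x))\<^sup>2) summable_on UNIV"
  shows "(\<lambda>x. (norm (f x + g x))\<^sup>2) summable_on UNIV"
proof (rule summable_on_comparison_test)
  show "(\<lambda>x. 2 * (norm (f x))\<^sup>2 + 2 * (norm (g x))\<^sup>2) summable_on UNIV"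
    using assms by (intro summable_on_add summable_on_cmult_right)
  fix x
  have "(norm (f x + g x))\<^sup>2 \<le> (norm (f x) + norm (g x))\<^sup>2"
    by (simp add: norm_triangle_ineq power_mono)
  also have "\<dots> \<le> 2 * (norm (f x))\<^sup>2 + 2 * (norm (g x))\<^sup>2"
    using zero_le_power2[of "norm (f x) - norm (g x)"] by (simp add: power2_eq_square algebra_simps)
  finally show "(norm (f x + g x))\<^sup>2 \<le> 2 * (norm (f x))\<^sup>2 + 2 * (norm (g x))\<^sup>2" .
qed auto

lemma square_summable_mult:
  fixes f g :: "'a \<Rightarrow> complex"
  assumes "(\<lambda>x. (norm (f x))\<^sup>2) summable_on UNIV" "(\<lambda>x. (norm (g x))\<^sup>2) summable_on UNIV"
  shows "(\<lambda>x. f x * cnj (g x)) summable_on UNIV"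
proof (rule abs_summable_summable, rule summable_on_comparison_test)
  show "(\<lambda>x. (norm (f x))\<^sup>2 + (norm (g x))\<^sup>2) summable_on UNIV"
    using assms by (intro summable_on_add)
  fix x
  have "2 * (norm (f x) * norm (g x)) \<le> (norm (f x))\<^sup>2 + (norm (g x))\<^sup>2"
    using zero_le_power2[of "norm (f x) - norm (g x)"] by (simp add: power2_eq_square algebra_simps)
  moreover have "0 \<le> norm (f x) * norm (g x)" by simp
  ultimately show "norm (f x * cnj (g x)) \<le> (norm (f x))\<^sup>2 + (norm (g x))\<^sup>2"
    unfolding norm_mult complex_mod_cnj by linarith
qed auto

lemma square_summable_cmult:
  fixes f :: "'a \<Rightarrow> complex"
  assumes "(\<lambda>x. (norm (f x))\<^sup>2) summable_on UNIV"
  shows "(\<lambda>x. (norm (c * f x))\<^sup>2) summable_on UNIV"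
  using summable_on_cmult_right[OF assms, of "(norm c)\<^sup>2"] by (simp add: norm_mult power_mult_distrib)

text \<open>The inner product is linear in the first and antilinear in the second variable.\<close>

lift_definition cinner :: "'a ell2 \<Rightarrow> 'a ell2 \<Rightarrow> complex"
  is "\<lambda>\<xi> \<eta>. \<Sum>\<^sub>\<infinity>x. \<xi> x * cnj (\<eta> x)" .

lift_definition scaleC :: "complex \<Rightarrow> 'a ell2 \<Rightarrow> 'a ell2"
  is "\<lambda>c \<xi> x. c * \<xi> x"
  by (rule square_summable_cmult)

text \<open>As a real inner product space, \<^typ>\<open>'a ell2\<close> carries the real part of
  \<^const>\<open>cinner\<close>; this induces the usual norm.\<close>

instantiation ell2 :: (type) real_inner
begin

lift_definition zero_ell2 :: "'a ell2" is "\<lambda>_. 0" by simp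
lift_definition plus_ell2 :: "'a ell2 \<Rightarrow> 'a ell2 \<Rightarrow> 'a ell2" is "\<lambda>\<xi> \<eta> x. \<xi> x + \<eta> x"
  by (rule square_summable_add)
lift_definition uminus_ell2 :: "'a ell2 \<Rightarrow> 'a ell2" is "\<lambda>\<xi> x. - \<xi> x" by simp
lift_definition minus_ell2 :: "'a ell2 \<Rightarrow> 'a ell2 \<Rightarrow> 'a ell2" is "\<lambda>\<xi> \<eta> x. \<xi> x - \<eta> x"
  using square_summable_add[of _ "\<lambda>x. - _ x"] by fastforce
lift_definition scaleR_ell2 :: "real \<Rightarrow> 'a ell2 \<Rightarrow> 'a ell2" is "\<lambda>r \<xi> x. of_real r * \<xi> x"
  by (rule square_summable_cmult)

definition inner_ell2 :: "'a ell2 \<Rightarrow> 'a ell2 \<Rightarrow> real" where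
  "inner_ell2 \<xi> \<eta> = Re (cinner \<xi> \<eta>)"
definition norm_ell2 :: "'a ell2 \<Rightarrow> real" where
  "norm_ell2 \<xi> = sqrt (inner \<xi> \<xi>)"
definition sgn_ell2 :: "'a ell2 \<Rightarrow> 'a ell2" where
  "sgn_ell2 \<xi> = inverse (norm \<xi>) *\<^sub>R \<xi>"
definition dist_ell2 :: "'a ell2 \<Rightarrow> 'a ell2 \<Rightarrow> real" where
  "dist_ell2 \<xi> \<eta> = norm (\<xi> - \<eta>)"
definition uniformity_ell2 :: "('a ell2 \<times> 'a ell2) filter" where
  "uniformity_ell2 = (INF e\<in>{0<..}. principal {(x, y). dist x y < e})"
definition open_ell2 :: "'a ell2 set \<Rightarrow> bool" where
  "open_ell2 U \<longleftrightarrow> (\<forall>x\<in>U. \<forall>\<^sub>F (x', y) in uniformity. x' = x \<longrightarrow> y \<in> U)"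

instance
proof
  fix \<xi> \<eta> \<zeta> :: "'a ell2" and r s :: real
  show "\<xi> + \<eta> + \<zeta> = \<xi> + (\<eta> + \<zeta>)" "\<xi> + \<eta> = \<eta> + \<xi>" "0 + \<xi> = \<xi>" "- \<xi> + \<xi> = 0" "\<xi> - \<eta> = \<xi> + - \<eta>"
    "r *\<^sub>R (\<xi> + \<eta>) = r *\<^sub>R \<xi> + r *\<^sub>R \<eta>" "(r + s) *\<^sub>R \<xi> = r *\<^sub>R \<xi> + s *\<^sub>R \<xi>"
    "r *\<^sub>R s *\<^sub>R \<xi> = (r * s) *\<^sub>R \<xi>" "1 *\<^sub>R \<xi> = \<xi>"
    by (transfer; simp add: algebra_simps)+
  show "inner \<xi> \<eta> = inner \<eta> \<xi>"
  proof -
    have "cinner \<eta> \<xi> = cnj (cinner \<xi> \<eta>)"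
      by transfer (simp flip: infsum_cnj add: mult.commute)
    then show ?thesis by (simp add: inner_ell2_def)
  qed
  show "inner (\<xi> + \<eta>) \<zeta> = inner \<xi> \<zeta> + inner \<eta> \<zeta>"
  proof -
    have "cinner (\<xi> + \<eta>) \<zeta> = cinner \<xi> \<zeta> + cinner \<eta> \<zeta>"
      by transfer (simp add: distrib_right infsum_add square_summable_mult)
    then show ?thesis by (simp add: inner_ell2_def)
  qed
  show "inner (r *\<^sub>R \<xi>) \<eta> = r * inner \<xi> \<eta>"
  proof -
    have "cinner (r *\<^sub>R \<xi>) \<eta> = of_real r * cinner \<xi> \<eta>"
      by transfer (simp add: mult.assoc infsum_cmult_right')
    then show ?thesis by (simp add: inner_ell2_def)
  qed
  have sq: "inner \<xi> \<xi> = (\<Sum>\<^sub>\<infinity>x. (norm (Rep_ell2 \<xi> x))\<^sup>2)"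
  proof -
    have "(\<lambda>x. Rep_ell2 \<xi> x * cnj (Rep_ell2 \<xi> x)) summable_on UNIV"
      using Rep_ell2[of \<xi>] by (simp add: square_summable_mult)
    then show ?thesis
      by (simp add: inner_ell2_def cinner.rep_eq infsum_Re[symmetric] cmod_power2
          flip: power2_eq_square)
  qed
  show "0 \<le> inner \<xi> \<xi>"
    unfolding sq by (rule infsum_nonneg) simp
  show "inner \<xi> \<xi> = 0 \<longleftrightarrow> \<xi> = 0"
  proof
    assume "inner \<xi> \<xi> = 0"
    then have "(norm (Rep_ell2 \<xi> x))\<^sup>2 = 0" for x
      using nonneg_infsum_le_0D[of "\<lambda>x. (norm (Rep_ell2 \<xi> x))\<^sup>2" UNIV x] Rep_ell2[of \<xi>]
      unfolding sq by simp
    then show "\<xi> = 0"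
      by (simp add: Rep_ell2_inject[symmetric] zero_ell2.rep_eq fun_eq_iff)
  qed (simp add: inner_ell2_def cinner.rep_eq zero_ell2.rep_eq)
qed (simp_all only: norm_ell2_def sgn_ell2_def dist_ell2_def uniformity_ell2_def open_ell2_def)

end

lift_definition delta :: "'a \<Rightarrow> 'a ell2" is "\<lambda>g x. if x = g then 1 else 0"
proof -
  fix g :: 'a
  have "(\<lambda>x. (norm (if x = g then 1 else 0 :: complex))\<^sup>2) summable_on {g}" by simp
  then show "(\<lambda>x. (norm (if x = g then 1 else 0 :: complex))\<^sup>2) summable_on UNIV"
    by (rule summable_on_cong_neutral[THEN iffD1, rotated -1]) auto
qed


section \<open>Von Neumann algebras\<close>

text \<open>The type \<^typ>\<open>'a ell2 \<Rightarrow>\<^sub>L 'a ell2\<close> contains all bounded real-linear operators;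
  the complex-linear ones are singled out here.\<close>

definition bounded_ops :: "('a ell2 \<Rightarrow>\<^sub>L 'a ell2) set" where
  "bounded_ops = {T :: 'a ell2 \<Rightarrow>\<^sub>L 'a ell2. \<forall>c \<xi>. T (scaleC c \<xi>) = scaleC c (T \<xi>)}"

definition adj :: "('a ell2 \<Rightarrow>\<^sub>L 'a ell2) \<Rightarrow> ('a ell2 \<Rightarrow>\<^sub>L 'a ell2)" where
  "adj T = (THE S :: 'a ell2 \<Rightarrow>\<^sub>L 'a ell2. \<forall>\<xi> \<eta>. cinner (T \<xi>) \<eta> = cinner \<xi> (S \<eta>))"

text \<open>The order on \<^typ>\<open>complex\<close> is the one in which the nonnegative elements are the
  nonnegative reals.\<close>

definition positive_op :: "('a ell2 \<Rightarrow>\<^sub>L 'a ell2) \<Rightarrow> bool" where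
  "positive_op T \<longleftrightarrow> T \<in> bounded_ops \<and> (\<forall>\<xi>. 0 \<le> cinner (T \<xi>) \<xi>)"

definition commutant :: "('a ell2 \<Rightarrow>\<^sub>L 'a ell2) set \<Rightarrow> ('a ell2 \<Rightarrow>\<^sub>L 'a ell2) set" where
  "commutant S = {T \<in> bounded_ops. \<forall>A\<in>S. T o\<^sub>L A = A o\<^sub>L T}"

text \<open>A self-adjoint set of operators equal to its bicommutant; it is then a unital
  subalgebra of the algebra of all bounded operators.\<close>

definition von_neumann_algebra :: "('a ell2 \<Rightarrow>\<^sub>L 'a ell2) set \<Rightarrow> bool" where
  "von_neumann_algebra N \<longleftrightarrow>
     N \<subseteq> bounded_ops \<and> (\<forall>T\<in>N. adj T \<in> N) \<and> commutant (commutant N) = N"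

definition Sub :: "('a ell2 \<Rightarrow>\<^sub>L 'a ell2) set \<Rightarrow> ('a ell2 \<Rightarrow>\<^sub>L 'a ell2) set set" where
  "Sub M = {N. von_neumann_algebra N \<and> N \<subseteq> M}"

text \<open>Complex linearity of \<open>E\<close> follows from additivity and \<open>N\<close>-bimodularity,
  since \<open>N\<close> contains the scalars. Extensionality makes \<open>E\<close> unique as a HOL function.\<close>

definition is_cond_exp ::
  "('a ell2 \<Rightarrow>\<^sub>L 'a ell2) set \<Rightarrow> (('a ell2 \<Rightarrow>\<^sub>L 'a ell2) \<Rightarrow> complex) \<Rightarrow> ('a ell2 \<Rightarrow>\<^sub>L 'a ell2) set \<Rightarrow>
    (('a ell2 \<Rightarrow>\<^sub>L 'a ell2) \<Rightarrow> ('a ell2 \<Rightarrow>\<^sub>L 'a ell2)) \<Rightarrow> bool" where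
  "is_cond_exp M \<tau> N E \<longleftrightarrow>
     E \<in> M \<rightarrow>\<^sub>E N \<and>
     (\<forall>x\<in>M. \<forall>y\<in>M. E (x + y) = E x + E y) \<and>
     (\<forall>x\<in>M. positive_op x \<longrightarrow> positive_op (E x)) \<and>
     (\<forall>x\<in>N. E x = x) \<and>
     (\<forall>a\<in>N. \<forall>x\<in>M. \<forall>b\<in>N. E (a o\<^sub>L x o\<^sub>L b) = a o\<^sub>L E x o\<^sub>L b) \<and>
     (\<forall>x\<in>M. \<tau> (E x) = \<tau> x)"

definition cond_exp ::
  "('a ell2 \<Rightarrow>\<^sub>L 'a ell2) set \<Rightarrow> (('a ell2 \<Rightarrow>\<^sub>L 'a ell2) \<Rightarrow> complex) \<Rightarrow> ('a ell2 \<Rightarrow>\<^sub>L 'a ell2) set \<Rightarrow>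
    ('a ell2 \<Rightarrow>\<^sub>L 'a ell2) \<Rightarrow> ('a ell2 \<Rightarrow>\<^sub>L 'a ell2)" where
  "cond_exp M \<tau> N = (THE E. is_cond_exp M \<tau> N E)"

definition L2_norm :: "(('a ell2 \<Rightarrow>\<^sub>L 'a ell2) \<Rightarrow> complex) \<Rightarrow> ('a ell2 \<Rightarrow>\<^sub>L 'a ell2) \<Rightarrow> real" where
  "L2_norm \<tau> x = sqrt (Re (\<tau> (adj x o\<^sub>L x)))"

text \<open>The maps \<open>N \<mapsto> E\<^sub>N(x)\<close> take values in \<open>M\<close>, so their continuity into the completion
  \<open>L\<^sup>2(M, \<tau>)\<close> is continuity into \<open>M\<close> with the metric of \<^const>\<open>L2_norm\<close>, whose topology
  has the open balls around the points of \<open>M\<close> as a basis.\<close>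

definition effros_marechal ::
  "('a ell2 \<Rightarrow>\<^sub>L 'a ell2) set \<Rightarrow> (('a ell2 \<Rightarrow>\<^sub>L 'a ell2) \<Rightarrow> complex) \<Rightarrow>
    ('a ell2 \<Rightarrow>\<^sub>L 'a ell2) set topology" where
  "effros_marechal M \<tau> = topology_generated_by
     {{N \<in> Sub M. L2_norm \<tau> (cond_exp M \<tau> N x - y) < r} | x y r. x \<in> M \<and> y \<in> M \<and> 0 < r}"

text \<open>In \<^typ>\<open>ennreal\<close> the supremum of the empty set is \<open>0\<close> and \<open>inverse 0 = \<infinity>\<close>.\<close>

definition pimsner_popa_const ::
  "('a ell2 \<Rightarrow>\<^sub>L 'a ell2) set \<Rightarrow> (('a ell2 \<Rightarrow>\<^sub>L 'a ell2) \<Rightarrow> complex) \<Rightarrow> ('a ell2 \<Rightarrow>\<^sub>L 'a ell2) set \<Rightarrow> ennreal" where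
  "pimsner_popa_const M \<tau> N =
     (SUP c\<in>{c::real. 0 < c \<and> (\<forall>x\<in>M. positive_op x \<longrightarrow> positive_op (cond_exp M \<tau> N x - c *\<^sub>R x))}.
        ennreal c)"

definition pimsner_popa_index ::
  "('a ell2 \<Rightarrow>\<^sub>L 'a ell2) set \<Rightarrow> (('a ell2 \<Rightarrow>\<^sub>L 'a ell2) \<Rightarrow> complex) \<Rightarrow> ('a ell2 \<Rightarrow>\<^sub>L 'a ell2) set \<Rightarrow> ennreal" where
  "pimsner_popa_index M \<tau> N = inverse (pimsner_popa_const M \<tau> N)"

definition maximal_subalgebra ::
  "('a ell2 \<Rightarrow>\<^sub>L 'a ell2) set \<Rightarrow> ('a ell2 \<Rightarrow>\<^sub>L 'a ell2) set \<Rightarrow> bool" where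
  "maximal_subalgebra M N \<longleftrightarrow>
     N \<in> Sub M \<and> N \<noteq> M \<and> (\<forall>P\<in>Sub M. N \<subseteq> P \<and> P \<noteq> M \<longrightarrow> P = N)"

text \<open>The analogue of \<^const>\<open>isolated_in\<close> for a point of an abstract topology.\<close>

definition isolated_in_topology :: "'a topology \<Rightarrow> 'a \<Rightarrow> 'a set \<Rightarrow> bool" where
  "isolated_in_topology X x S \<longleftrightarrow> x \<in> S \<and> (\<exists>U. openin X U \<and> U \<inter> S = {x})"


section \<open>Group von Neumann algebras\<close>

text \<open>The following definitions are meant for groups whose carrier is the whole type, so that
  \<^typ>\<open>'a ell2\<close> is the Hilbert space of square summable functions on the group.\<close>

definition left_reg :: "('a, 'b) monoid_scheme \<Rightarrow> 'a \<Rightarrow> ('a ell2 \<Rightarrow>\<^sub>L 'a ell2)" where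
  "left_reg G g = Blinfun (\<lambda>\<xi>. Abs_ell2 (\<lambda>x. Rep_ell2 \<xi> (inv\<^bsub>G\<^esub> g \<otimes>\<^bsub>G\<^esub> x)))"

definition group_vN :: "('a, 'b) monoid_scheme \<Rightarrow> ('a ell2 \<Rightarrow>\<^sub>L 'a ell2) set" where
  "group_vN G = commutant (commutant (left_reg G ` carrier G))"

definition canonical_trace :: "('a, 'b) monoid_scheme \<Rightarrow> ('a ell2 \<Rightarrow>\<^sub>L 'a ell2) \<Rightarrow> complex" where
  "canonical_trace G x = cinner (x (delta \<one>\<^bsub>G\<^esub>)) (delta \<one>\<^bsub>G\<^esub>)"

definition conj_subalgebra ::
  "('a, 'b) monoid_scheme \<Rightarrow> 'a \<Rightarrow> ('a ell2 \<Rightarrow>\<^sub>L 'a ell2) set \<Rightarrow> ('a ell2 \<Rightarrow>\<^sub>L 'a ell2) set" where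
  "conj_subalgebra G g N = (\<lambda>x. left_reg G g o\<^sub>L x o\<^sub>L adj (left_reg G g)) ` N"

lemma left_reg_apply:
  assumes "group G" "carrier G = UNIV"
  shows "Rep_ell2 (left_reg G g \<xi>) x = Rep_ell2 \<xi> (inv\<^bsub>G\<^esub> g \<otimes>\<^bsub>G\<^esub> x)"
proof -
  interpret group G by fact
  let ?h = "\<lambda>x. inv\<^bsub>G\<^esub> g \<otimes>\<^bsub>G\<^esub> x"
  have bij: "bij ?h"
    by (rule bij_betw_byWitness[where f' = "\<lambda>x. g \<otimes>\<^bsub>G\<^esub> x"])
      (auto simp: assms m_assoc[symmetric])
  define S where "S \<xi> = Abs_ell2 (\<lambda>x. Rep_ell2 \<xi> (?h x))" for \<xi>
  have S: "Rep_ell2 (S \<xi>) x = Rep_ell2 \<xi> (?h x)" for \<xi> x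
    using Rep_ell2[of \<xi>]
      summable_on_reindex_bij_betw[OF bij, of "\<lambda>x. (norm (Rep_ell2 \<xi> x))\<^sup>2"]
    by (simp add: S_def Abs_ell2_inverse)
  have "bounded_linear S"
  proof (rule bounded_linear_intro[where K = 1])
    show "S (\<xi> + \<eta>) = S \<xi> + S \<eta>" for \<xi> \<eta>
      by (rule Rep_ell2_inject[THEN iffD1], rule ext) (simp only: S plus_ell2.rep_eq)
    show "S (r *\<^sub>R \<xi>) = r *\<^sub>R S \<xi>" for r \<xi>
      by (rule Rep_ell2_inject[THEN iffD1], rule ext) (simp only: S scaleR_ell2.rep_eq)
    show "norm (S \<xi>) \<le> norm \<xi> * 1" for \<xi>
      using infsum_reindex_bij_betw[OF bij, of "\<lambda>x. Rep_ell2 \<xi> x * cnj (Rep_ell2 \<xi> x)"]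
      by (simp add: norm_ell2_def inner_ell2_def cinner.rep_eq S)
  qed
  then show ?thesis
    by (simp add: left_reg_def S_def[symmetric, abs_def] bounded_linear_Blinfun_apply S)
qed

end

theory Submission
  imports Defs
begin

text \<open>
  The subalgebra is \<open>N = M \<inter> {u}'\<close> for a symmetry \<open>u\<close> (a self-adjoint unitary) in \<open>M = L(\<Gamma>)\<close>. Write
  \<open>p\<close> and \<open>q\<close> for the spectral projections of \<open>u\<close>, so that \<open>N = pMp + qMq\<close>. For every noncentral
  \<open>u\<close> this algebra has index \<open>2\<close> and is maximal. The trace preserving expectation is
  \<open>E(x) = (x + uxu)/2\<close> (\<open>cond_exp_relcomm\<close>), so the constant \<open>1/2\<close> is admissible, and a nonzero corner
  \<open>q z p\<close> yields a positive element showing that it is optimal (\<open>index_relcomm\<close>). An algebra \<open>P\<close>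
  strictly between \<open>N\<close> and \<open>M\<close> would contain some \<open>b = q z p \<noteq> 0\<close>; since \<open>M\<close> is a factor, a vector
  annihilated by all \<open>b \<lambda>\<^sub>g\<close> vanishes, and this forces every operator commuting with \<open>P\<close> to commute
  with \<open>M\<close> (\<open>maximal_relcomm\<close>). Factoriality enters through a sequence \<open>s\<^sub>n\<close> in \<open>\<Gamma>\<close> with
  \<open>s\<^sub>n y s\<^sub>n\<^sup>-\<^sup>1 \<rightarrow> \<infinity>\<close> for all \<open>y \<noteq> 1\<close> (\<open>spreading_annihilator\<close>, \<open>spreading_exists\<close>).

  Conjugation by \<open>\<lambda>\<^sub>g\<close> turns \<open>N\<close> into \<open>M \<inter> {\<lambda>\<^sub>g u \<lambda>\<^sub>g\<^sup>*}'\<close>, and these algebras converge to \<open>N\<close> when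
  \<open>\<lambda>\<^sub>g u \<lambda>\<^sub>g\<^sup>* \<rightarrow> u\<close> in the 2-norm (\<open>relcomm_convergence\<close>). So \<open>u\<close> must be almost, but never exactly,
  invariant under conjugation by suitable \<open>g\<close>. This is arranged by an infinite product
  \<open>u = \<Prod>\<^sub>m (1 - 2 e\<^sub>m)\<close>, where \<open>e\<^sub>m\<close> is the average of \<open>\<lambda>\<^sub>h\<close> over \<open>h\<close> in the finite group \<open>Sym {0..<4\<^bsup>m+1\<^esup>}\<close>.
  The \<open>e\<^sub>m\<close> are commuting projections with \<open>\<parallel>e\<^sub>m \<delta>\<^sub>1\<parallel> \<le> 2\<^bsup>-m\<^esup>\<close>, so the product converges. The
  transposition \<open>g\<^sub>m\<close> of \<open>4\<^bsup>m+1\<^esup> - 1\<close> and \<open>4\<^bsup>m+1\<^esup>\<close> normalizes all these groups except the \<open>m\<close>-th. Hence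
  conjugation by it changes only the \<open>m\<close>-th factor, a change that tends to \<open>0\<close>
  (\<open>conj_u_tendsto\<close>). On the other hand \<open>e\<^sub>m\<close> lies in \<open>N\<close>, so its conjugate by \<open>\<lambda>\<close> of \<open>g\<^sub>m\<close> lies in the
  conjugate of \<open>N\<close>; but this conjugate of \<open>e\<^sub>m\<close> is not in \<open>N\<close>, because it commutes with every \<open>e\<^sub>k\<close>
  except \<open>e\<^sub>m\<close> (\<open>relcomm_conj_u_ne\<close>). Thus \<open>N\<close> is a limit of conjugates different from \<open>N\<close>.

  The statements on \<open>\<Gamma>\<close> itself come from its faithful action on \<open>\<int>\<close>: it is generated by one
  transposition and the translation, conjugation by transpositions produces infinite classes,
  and an explicit Folner sequence gives amenability.
\<close>

section \<open>Square summable functions\<close>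

lemma ell2_eqI: "(\<And>x. Rep_ell2 \<xi> x = Rep_ell2 \<eta> x) \<Longrightarrow> \<xi> = \<eta>"
  by (simp add: Rep_ell2_inject[symmetric] fun_eq_iff)

lemma square_summable_Rep_ell2: "(\<lambda>x. (norm (Rep_ell2 \<xi> x))\<^sup>2) summable_on UNIV"
  using Rep_ell2[of \<xi>] by simp

lemma cinner_commute: "cinner \<eta> \<xi> = cnj (cinner \<xi> \<eta>)"
  by transfer (simp flip: infsum_cnj add: mult.commute)

lemma cinner_scaleC_left: "cinner (scaleC c \<xi>) \<eta> = c * cinner \<xi> \<eta>"
  by transfer (simp add: mult.assoc infsum_cmult_right')

lemma cinner_scaleC_right: "cinner \<xi> (scaleC c \<eta>) = cnj c * cinner \<xi> \<eta>"
  by (metis cinner_commute cinner_scaleC_left complex_cnj_mult)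

lemma scaleR_eq_scaleC: "r *\<^sub>R \<xi> = scaleC (of_real r) \<xi>"
  by transfer simp

lemma scaleC_scaleC [simp]: "scaleC a (scaleC b \<xi>) = scaleC (a * b) \<xi>"
  by transfer (simp add: mult.assoc)

lemma cinner_self: "cinner \<xi> \<xi> = of_real ((norm \<xi>)\<^sup>2)"
proof (rule complex_eqI)
  show "Re (cinner \<xi> \<xi>) = Re (of_real ((norm \<xi>)\<^sup>2))"
    by (simp add: power2_norm_eq_inner inner_ell2_def)
  show "Im (cinner \<xi> \<xi>) = Im (of_real ((norm \<xi>)\<^sup>2))"
    using cinner_commute[of \<xi> \<xi>] by (metis Im_complex_of_real complex_cnj_cancel_iff
        complex_cnj_complex_of_real complex_is_Real_iff Reals_cnj_iff)
qed

lemma norm_scaleC [simp]: "norm (scaleC c \<xi>) = norm c * norm \<xi>"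
proof -
  have "complex_of_real ((norm (scaleC c \<xi>))\<^sup>2) = of_real ((norm c * norm \<xi>)\<^sup>2)"
    by (simp add: cinner_self[symmetric] cinner_scaleC_left cinner_scaleC_right
        power_mult_distrib complex_norm_square del: of_real_power)
  then have "(norm (scaleC c \<xi>))\<^sup>2 = (norm c * norm \<xi>)\<^sup>2"
    using of_real_eq_iff by blast
  then show ?thesis
    by (simp add: power2_eq_iff_nonneg)
qed

lemma cinner_Cauchy_Schwarz: "norm (cinner \<xi> \<eta>) \<le> norm \<xi> * norm \<eta>"
proof (cases "cinner \<xi> \<eta> = 0")
  case False
  define a where "a = cnj (cinner \<xi> \<eta>) / norm (cinner \<xi> \<eta>)"
  have "norm a = 1"
    using False by (simp add: a_def norm_divide)
  have "a * cinner \<xi> \<eta> = of_real (norm (cinner \<xi> \<eta>))"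
    using False by (simp add: a_def mult.commute flip: complex_norm_square)
      (simp add: power2_eq_square)
  then have "norm (cinner \<xi> \<eta>) = inner (scaleC a \<xi>) \<eta>"
    by (simp add: inner_ell2_def cinner_scaleC_left)
  also have "\<dots> \<le> norm (scaleC a \<xi>) * norm \<eta>"
    by (rule norm_cauchy_schwarz)
  finally show ?thesis
    using \<open>norm a = 1\<close> by simp
qed simp

interpretation cinner: bounded_bilinear cinner
proof
  fix \<xi> \<eta> \<zeta> :: "'a ell2" and r
  show add: "cinner (\<xi> + \<eta>) \<zeta> = cinner \<xi> \<zeta> + cinner \<eta> \<zeta>" for \<xi> \<eta> \<zeta> :: "'a ell2"
    by transfer (simp add: distrib_right infsum_add square_summable_mult)
  show "cinner \<zeta> (\<xi> + \<eta>) = cinner \<zeta> \<xi> + cinner \<zeta> \<eta>"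
    by (metis cinner_commute add complex_cnj_add)
  show "cinner (r *\<^sub>R \<xi>) \<eta> = r *\<^sub>R cinner \<xi> \<eta>" "cinner \<xi> (r *\<^sub>R \<eta>) = r *\<^sub>R cinner \<xi> \<eta>"
    by (simp_all add: scaleR_eq_scaleC cinner_scaleC_left cinner_scaleC_right scaleR_conv_of_real)
  show "\<exists>K. \<forall>\<xi> \<eta> :: 'a ell2. norm (cinner \<xi> \<eta>) \<le> norm \<xi> * norm \<eta> * K"
    by (intro exI[of _ 1]) (simp add: cinner_Cauchy_Schwarz)
qed

interpretation scaleC: bounded_bilinear scaleC
proof
  fix \<xi> \<eta> :: "'a ell2" and r a b
  show "scaleC (a + b) \<xi> = scaleC a \<xi> + scaleC b \<xi>" "scaleC a (\<xi> + \<eta>) = scaleC a \<xi> + scaleC a \<eta>"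
    by (transfer, simp add: algebra_simps)+
  show "scaleC (r *\<^sub>R a) \<xi> = r *\<^sub>R scaleC a \<xi>" "scaleC a (r *\<^sub>R \<xi>) = r *\<^sub>R scaleC a \<xi>"
    by (simp_all add: scaleR_eq_scaleC scaleR_conv_of_real mult.commute)
  show "\<exists>K. \<forall>a (\<xi> :: 'a ell2). norm (scaleC a \<xi>) \<le> norm a * norm \<xi> * K"
    by (intro exI[of _ 1]) simp
qed

lemma norm_ell2_infsum: "(norm \<xi>)\<^sup>2 = (\<Sum>\<^sub>\<infinity>x. (norm (Rep_ell2 \<xi> x))\<^sup>2)"
proof -
  have "(\<lambda>x. Rep_ell2 \<xi> x * cnj (Rep_ell2 \<xi> x)) summable_on UNIV"
    using Rep_ell2[of \<xi>] by (simp add: square_summable_mult)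
  then show ?thesis
    unfolding power2_norm_eq_inner[of \<xi>]
    by (simp add: inner_ell2_def cinner.rep_eq infsum_Re[symmetric] cmod_power2
        flip: power2_eq_square)
qed

lemma cinner_delta [simp]: "cinner \<xi> (delta x) = Rep_ell2 \<xi> x"
proof -
  have "(\<Sum>\<^sub>\<infinity>y. Rep_ell2 \<xi> y * cnj (if y = x then 1 else 0))
      = (\<Sum>\<^sub>\<infinity>y\<in>{x}. Rep_ell2 \<xi> y * cnj (if y = x then 1 else 0))"
    by (rule infsum_cong_neutral) auto
  then show ?thesis
    by (simp add: cinner.rep_eq delta.rep_eq)
qed

lemma norm_delta [simp]: "norm (delta x) = 1"
  using cinner_self[of "delta x"] by (simp add: delta.rep_eq power2_eq_1_iff flip: of_real_power)
    (metis norm_ge_zero not_one_le_zero neg_0_le_iff_le)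

lemma Rep_ell2_add [simp]: "Rep_ell2 (\<xi> + \<eta>) x = Rep_ell2 \<xi> x + Rep_ell2 \<eta> x"
  and Rep_ell2_diff [simp]: "Rep_ell2 (\<xi> - \<eta>) x = Rep_ell2 \<xi> x - Rep_ell2 \<eta> x"
  and Rep_ell2_zero [simp]: "Rep_ell2 0 x = 0"
  and Rep_ell2_scaleC [simp]: "Rep_ell2 (scaleC c \<xi>) x = c * Rep_ell2 \<xi> x"
  and Rep_ell2_scaleR [simp]: "Rep_ell2 (r *\<^sub>R \<xi>) x = of_real r * Rep_ell2 \<xi> x"
  by (simp_all add: plus_ell2.rep_eq minus_ell2.rep_eq zero_ell2.rep_eq scaleC.rep_eq
      scaleR_ell2.rep_eq)

lemma Rep_ell2_sum [simp]: "Rep_ell2 (sum f F) x = (\<Sum>i\<in>F. Rep_ell2 (f i) x)"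
  by (induction F rule: infinite_finite_induct) auto

lemma norm_Rep_ell2_le: "norm (Rep_ell2 \<xi> x) \<le> norm \<xi>"
  using cinner_Cauchy_Schwarz[of \<xi> "delta x"] by simp

lemma norm_finite_combination:
  assumes "finite F"
  shows "(norm (\<Sum>x\<in>F. scaleC (f x) (delta x)))\<^sup>2 = (\<Sum>x\<in>F. (norm (f x))\<^sup>2)"
proof -
  have "complex_of_real ((norm (\<Sum>x\<in>F. scaleC (f x) (delta x)))\<^sup>2) = (\<Sum>x\<in>F. f x * cnj (f x))"
    using assms unfolding cinner_self[symmetric]
    by (subst cinner.sum_right, intro sum.cong)
      (simp_all add: cinner_scaleC_right delta.rep_eq if_distrib sum.delta cong: if_cong)
  also have "\<dots> = of_real (\<Sum>x\<in>F. (norm (f x))\<^sup>2)"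
    by (simp only: of_real_sum complex_norm_square)
  finally show ?thesis
    using of_real_eq_iff by blast
qed

lemma norm_truncation_error:
  assumes "finite F"
  shows "(norm (\<xi> - (\<Sum>x\<in>F. scaleC (Rep_ell2 \<xi> x) (delta x))))\<^sup>2
    = (norm \<xi>)\<^sup>2 - (\<Sum>x\<in>F. (norm (Rep_ell2 \<xi> x))\<^sup>2)"
proof -
  let ?\<eta> = "\<Sum>x\<in>F. scaleC (Rep_ell2 \<xi> x) (delta x)"
  have "cinner \<xi> ?\<eta> = of_real (\<Sum>x\<in>F. (norm (Rep_ell2 \<xi> x))\<^sup>2)"
    by (simp only: cinner.sum_right cinner_scaleC_right cinner_delta of_real_sum complex_norm_square
        mult.commute)
  then have "inner \<xi> ?\<eta> = (\<Sum>x\<in>F. (norm (Rep_ell2 \<xi> x))\<^sup>2)"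
    by (simp add: inner_ell2_def del: of_real_sum)
  then show ?thesis
    using norm_finite_combination[OF assms, of "Rep_ell2 \<xi>"]
    by (simp add: power2_norm_eq_inner inner_diff_left inner_diff_right inner_commute)
qed

text \<open>Finite combinations of point masses are dense, so closed linear properties need only be
  verified on point masses.\<close>

lemma ell2_induct [case_names closed add delta]:
  assumes closed: "closed {\<xi>. P \<xi>}"
    and add: "\<And>\<xi> \<eta>. P \<xi> \<Longrightarrow> P \<eta> \<Longrightarrow> P (\<xi> + \<eta>)"
    and delta: "\<And>c x. P (scaleC c (delta x))"
  shows "P \<xi>"
proof -
  have zero: "P 0"
    using delta[of 0] by (simp add: scaleC.zero_left)
  have sum: "P (\<Sum>x\<in>F. scaleC (f x) (delta x))" for F f
    by (induction F rule: infinite_finite_induct) (auto simp: zero add delta)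
  have "\<xi> \<in> closure {\<xi>. P \<xi>}"
    unfolding closure_approachable
  proof (intro allI impI)
    fix e :: real assume "e > 0"
    have "((\<lambda>x. (norm (Rep_ell2 \<xi> x))\<^sup>2) has_sum (norm \<xi>)\<^sup>2) UNIV"
      using square_summable_Rep_ell2[of \<xi>] by (simp add: norm_ell2_infsum)
    then have "\<forall>\<^sub>F F in finite_subsets_at_top UNIV.
        dist (\<Sum>x\<in>F. (norm (Rep_ell2 \<xi> x))\<^sup>2) ((norm \<xi>)\<^sup>2) < e\<^sup>2"
      using \<open>e > 0\<close> unfolding has_sum_def by (intro tendstoD) auto
    then obtain F where F: "finite F" "dist (\<Sum>x\<in>F. (norm (Rep_ell2 \<xi> x))\<^sup>2) ((norm \<xi>)\<^sup>2) < e\<^sup>2"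
      by (auto simp: eventually_finite_subsets_at_top)
    then have "(norm (\<xi> - (\<Sum>x\<in>F. scaleC (Rep_ell2 \<xi> x) (delta x))))\<^sup>2 < e\<^sup>2"
      by (simp add: norm_truncation_error dist_real_def)
    then have "norm (\<xi> - (\<Sum>x\<in>F. scaleC (Rep_ell2 \<xi> x) (delta x))) < e"
      using \<open>e > 0\<close> by (simp add: power2_less_imp_less)
    then show "\<exists>\<eta>\<in>{\<xi>. P \<xi>}. dist \<eta> \<xi> < e"
      using sum by (auto simp: dist_norm norm_minus_commute[of \<xi>])
  qed
  then show ?thesis
    using closed by (simp add: closure_closed)
qed

lemma square_summable_bounded:
  fixes f :: "'a \<Rightarrow> complex"
  assumes "\<And>F. finite F \<Longrightarrow> (\<Sum>x\<in>F. (norm (f x))\<^sup>2) \<le> C\<^sup>2" and "C \<ge> 0"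
  shows "Rep_ell2 (Abs_ell2 f) = f" and "norm (Abs_ell2 f) \<le> C"
proof -
  have "(\<lambda>x. (norm (f x))\<^sup>2) summable_on UNIV"
    using assms by (intro nonneg_bdd_above_summable_on) (auto simp: bdd_above_def)
  then show *: "Rep_ell2 (Abs_ell2 f) = f"
    by (simp add: Abs_ell2_inverse)
  have "(norm (Abs_ell2 f))\<^sup>2 \<le> C\<^sup>2"
    unfolding norm_ell2_infsum * using assms by (intro infsum_le_finite_sums)
      (auto simp: \<open>(\<lambda>x. (norm (f x))\<^sup>2) summable_on UNIV\<close>)
  then show "norm (Abs_ell2 f) \<le> C"
    using \<open>C \<ge> 0\<close> power2_le_imp_le by blast
qed

instance ell2 :: (type) banach
proof
  fix X :: "nat \<Rightarrow> 'a ell2"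
  assume X: "Cauchy X"
  have "\<exists>l. (\<lambda>n. Rep_ell2 (X n) x) \<longlonglongrightarrow> l" for x
  proof -
    have "Cauchy (\<lambda>n. Rep_ell2 (X n) x)"
    proof (rule metric_CauchyI)
      fix e :: real assume "e > 0"
      then obtain N where N: "\<And>m n. m \<ge> N \<Longrightarrow> n \<ge> N \<Longrightarrow> dist (X m) (X n) < e"
        using metric_CauchyD[OF X] by metis
      have "dist (Rep_ell2 (X m) x) (Rep_ell2 (X n) x) \<le> dist (X m) (X n)" for m n
        using norm_Rep_ell2_le[of "X m - X n" x] by (simp add: dist_norm)
      then show "\<exists>N. \<forall>m\<ge>N. \<forall>n\<ge>N. dist (Rep_ell2 (X m) x) (Rep_ell2 (X n) x) < e"
        using N by (meson le_less_trans)
    qed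
    then show ?thesis
      by (simp add: Cauchy_convergent_iff convergent_def)
  qed
  then obtain f where f: "\<And>x. (\<lambda>n. Rep_ell2 (X n) x) \<longlonglongrightarrow> f x"
    by metis
  \<comment> \<open>Fatou's argument: the bound on differences survives in the limit on each finite set.\<close>
  have fatou: "\<exists>N. \<forall>n\<ge>N. \<forall>F. finite F \<longrightarrow> (\<Sum>x\<in>F. (norm (Rep_ell2 (X n) x - f x))\<^sup>2) \<le> e\<^sup>2"
    if "e > 0" for e :: real
  proof -
    obtain N where N: "\<And>m n. m \<ge> N \<Longrightarrow> n \<ge> N \<Longrightarrow> dist (X m) (X n) < e"
      using metric_CauchyD[OF X \<open>e > 0\<close>] by blast
    have "(\<Sum>x\<in>F. (norm (Rep_ell2 (X n) x - f x))\<^sup>2) \<le> e\<^sup>2" if "n \<ge> N" "finite F" for n F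
    proof (rule LIMSEQ_le_const2)
      show "(\<lambda>m. \<Sum>x\<in>F. (norm (Rep_ell2 (X n) x - Rep_ell2 (X m) x))\<^sup>2)
          \<longlonglongrightarrow> (\<Sum>x\<in>F. (norm (Rep_ell2 (X n) x - f x))\<^sup>2)"
        by (intro tendsto_intros f)
      have "(\<Sum>x\<in>F. (norm (Rep_ell2 (X n) x - Rep_ell2 (X m) x))\<^sup>2) \<le> e\<^sup>2" if "m \<ge> N" for m
      proof -
        have "(\<Sum>x\<in>F. (norm (Rep_ell2 (X n - X m) x))\<^sup>2) \<le> (norm (X n - X m))\<^sup>2"
          using norm_truncation_error[OF \<open>finite F\<close>, of "X n - X m"]
            zero_le_power2[of "norm (X n - X m - (\<Sum>x\<in>F. scaleC (Rep_ell2 (X n - X m) x) (delta x)))"]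
          by linarith
        also have "\<dots> \<le> e\<^sup>2"
          using N[OF \<open>n \<ge> N\<close> \<open>m \<ge> N\<close>] by (intro power_mono) (auto simp: dist_norm)
        finally show ?thesis
          by simp
      qed
      then show "\<exists>k. \<forall>m\<ge>k. (\<Sum>x\<in>F. (norm (Rep_ell2 (X n) x - Rep_ell2 (X m) x))\<^sup>2) \<le> e\<^sup>2"
        by blast
    qed
    then show ?thesis
      by blast
  qed
  obtain n0 where n0: "\<And>F. finite F \<Longrightarrow> (\<Sum>x\<in>F. (norm (Rep_ell2 (X n0) x - f x))\<^sup>2) \<le> 1\<^sup>2"
    using fatou[of 1] by auto
  define Y where "Y = X n0 - Abs_ell2 (\<lambda>x. Rep_ell2 (X n0) x - f x)"
  have Y: "Rep_ell2 Y x = f x" for x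
    by (simp add: Y_def square_summable_bounded(1)[OF n0])
  have "X \<longlonglongrightarrow> Y"
  proof (rule metric_LIMSEQ_I)
    fix e :: real assume "e > 0"
    then obtain N where N: "\<And>n F. n \<ge> N \<Longrightarrow> finite F \<Longrightarrow>
        (\<Sum>x\<in>F. (norm (Rep_ell2 (X n) x - f x))\<^sup>2) \<le> (e/2)\<^sup>2"
      using fatou[of "e/2"] by auto
    have "dist (X n) Y < e" if "n \<ge> N" for n
    proof -
      have "X n - Y = Abs_ell2 (\<lambda>x. Rep_ell2 (X n) x - f x)"
        using square_summable_bounded(1)[OF N[OF that]] \<open>e > 0\<close> by (intro ell2_eqI) (simp add: Y)
      then have "norm (X n - Y) \<le> e/2"
        using square_summable_bounded(2)[OF N[OF that]] \<open>e > 0\<close> by simp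
      then show ?thesis
        using \<open>e > 0\<close> by (simp add: dist_norm)
    qed
    then show "\<exists>N. \<forall>n\<ge>N. dist (X n) Y < e"
      by blast
  qed
  then show "convergent X"
    by (auto simp: convergent_def)
qed


section \<open>Adjoints, commutants and strong limits\<close>

lemma bounded_ops_scaleC: "T \<in> bounded_ops \<Longrightarrow> T (scaleC c \<xi>) = scaleC c (T \<xi>)"
  by (simp add: bounded_ops_def)

lemma bounded_ops_closed:
  "id_blinfun \<in> bounded_ops"
  "S \<in> bounded_ops \<Longrightarrow> T \<in> bounded_ops \<Longrightarrow> S + T \<in> bounded_ops"
  "S \<in> bounded_ops \<Longrightarrow> T \<in> bounded_ops \<Longrightarrow> S - T \<in> bounded_ops"
  "S \<in> bounded_ops \<Longrightarrow> r *\<^sub>R S \<in> bounded_ops"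
  "S \<in> bounded_ops \<Longrightarrow> T \<in> bounded_ops \<Longrightarrow> S o\<^sub>L T \<in> bounded_ops"
  by (simp_all add: bounded_ops_def blinfun.bilinear_simps scaleC.add_right scaleC.diff_right
      scaleC.scaleR_right)

lemma bounded_ops_eqI:
  assumes "S \<in> bounded_ops" "T \<in> bounded_ops" "\<And>x. S (delta x) = T (delta x)"
  shows "S = T"
proof (rule blinfun_eqI)
  fix \<xi>
  show "S \<xi> = T \<xi>"
  proof (induction \<xi> rule: ell2_induct)
    case closed
    show ?case
      by (intro closed_Collect_eq continuous_intros)
  qed (simp_all add: blinfun.add_right bounded_ops_scaleC assms)
qed

lemma cinner_extensional: "(\<And>\<zeta>. cinner \<zeta> \<xi> = cinner \<zeta> \<eta>) \<Longrightarrow> \<xi> = \<eta>"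
  by (rule ell2_eqI) (metis cinner_commute cinner_delta)

lemmas continuous_on_cinner [continuous_intros] =
  bounded_bilinear.continuous_on[OF cinner.bounded_bilinear_axioms]
lemmas tendsto_cinner [tendsto_intros] = cinner.tendsto

text \<open>The adjoint is built in coordinates: its values at \<open>\<eta>\<close> are the numbers
  \<open>\<langle>\<eta>, T \<delta>\<^sub>x\<rangle>\<close>, and testing \<open>T\<close> on the finite combinations with these very coefficients
  bounds their sum of squares.\<close>

lemma adjoint_exists:
  fixes T :: "'a ell2 \<Rightarrow>\<^sub>L 'a ell2"
  assumes T: "T \<in> bounded_ops"
  shows "\<exists>S\<in>bounded_ops. \<forall>\<xi> \<eta>. cinner (T \<xi>) \<eta> = cinner \<xi> (S \<eta>)"
proof -
  define f where "f \<eta> x = cinner \<eta> (T (delta x))" for \<eta> x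
  have bound: "(\<Sum>x\<in>F. (norm (f \<eta> x))\<^sup>2) \<le> (norm T * norm \<eta>)\<^sup>2" if "finite F" for F \<eta>
  proof -
    define v where "v = (\<Sum>x\<in>F. scaleC (f \<eta> x) (delta x))"
    define s where "s = (\<Sum>x\<in>F. (norm (f \<eta> x))\<^sup>2)"
    have v: "(norm v)\<^sup>2 = s"
      unfolding v_def s_def by (rule norm_finite_combination[OF that])
    have "of_real s = cinner \<eta> (T v)"
      unfolding s_def v_def blinfun.sum_right cinner.sum_right bounded_ops_scaleC[OF T]
        cinner_scaleC_right f_def[symmetric] of_real_sum complex_norm_square
      by (simp add: mult.commute)
    then have "(norm v)\<^sup>2 \<le> norm \<eta> * norm (T v)"
      using cinner_Cauchy_Schwarz[of \<eta> "T v"] v by (metis abs_norm_cancel norm_of_real norm_power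
          power2_abs real_norm_def abs_power2)
    also have "\<dots> \<le> norm \<eta> * (norm T * norm v)"
      by (intro mult_left_mono norm_blinfun) auto
    finally have "norm v * norm v \<le> (norm T * norm \<eta>) * norm v"
      by (simp add: power2_eq_square mult_ac)
    then have "norm v \<le> norm T * norm \<eta>"
      by (cases "norm v = 0") (auto simp: mult_le_cancel_right)
    then show ?thesis
      using v power_mono[of "norm v" "norm T * norm \<eta>" 2] by (simp add: s_def)
  qed
  define S where "S \<eta> = Abs_ell2 (f \<eta>)" for \<eta>
  have S: "Rep_ell2 (S \<eta>) x = cinner \<eta> (T (delta x))" and norm_S: "norm (S \<eta>) \<le> norm T * norm \<eta>" for \<eta> x
    using square_summable_bounded[OF bound, of \<eta>] by (simp_all add: S_def) (simp add: f_def)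
  have "bounded_linear S"
    by (rule bounded_linear_intro[where K = "norm T"])
      (auto intro!: ell2_eqI simp: S cinner.add_left cinner.scaleR_left scaleR_conv_of_real norm_S
        mult.commute[of _ "norm T"])
  then have app: "blinfun_apply (Blinfun S) = S"
    by (rule bounded_linear_Blinfun_apply)
  have "cinner (T \<xi>) \<eta> = cinner \<xi> (S \<eta>)" for \<xi> \<eta>
  proof (induction \<xi> rule: ell2_induct)
    case closed
    show ?case
      by (intro closed_Collect_eq continuous_intros)
  next
    case (delta c x)
    have "cinner (T (delta x)) \<eta> = cinner (delta x) (S \<eta>)"
      by (metis S cinner_commute cinner_delta)
    then show ?case
      by (simp add: bounded_ops_scaleC[OF T] cinner_scaleC_left)
  qed (simp add: blinfun.add_right cinner.add_left)
  moreover have "Blinfun S \<in> bounded_ops"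
    by (auto simp: bounded_ops_def app S cinner_scaleC_left intro!: ell2_eqI)
  ultimately show ?thesis
    using app by (intro bexI[of _ "Blinfun S"]) auto
qed

lemma adj_eqI:
  fixes S T :: "'a ell2 \<Rightarrow>\<^sub>L 'a ell2"
  assumes "\<And>\<xi> \<eta>. cinner (T \<xi>) \<eta> = cinner \<xi> (S \<eta>)"
  shows "adj T = S"
  unfolding adj_def
proof (rule the_equality)
  fix S' assume "\<forall>\<xi> \<eta>. cinner (T \<xi>) \<eta> = cinner \<xi> (blinfun_apply S' \<eta>)"
  then show "S' = S"
    using assms by (intro blinfun_eqI cinner_extensional) metis
qed (use assms in auto)

lemma adj_props:
  fixes T :: "'a ell2 \<Rightarrow>\<^sub>L 'a ell2"
  assumes "T \<in> bounded_ops"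
  shows adj_bounded_ops: "adj T \<in> bounded_ops" and cinner_adj: "cinner (T \<xi>) \<eta> = cinner \<xi> (adj T \<eta>)"
  using adjoint_exists[OF assms] adj_eqI by blast+

lemma cinner_adj': "T \<in> bounded_ops \<Longrightarrow> cinner (adj T \<xi>) \<eta> = cinner \<xi> (T \<eta>)"
  by (metis cinner_adj cinner_commute)

lemma adj_adj: "T \<in> bounded_ops \<Longrightarrow> adj (adj T) = T"
  by (rule adj_eqI) (rule cinner_adj')

lemma adj_add:
  "S \<in> bounded_ops \<Longrightarrow> T \<in> bounded_ops \<Longrightarrow> adj (S + T) = adj S + adj T"
  by (rule adj_eqI) (simp add: cinner_adj blinfun.add_left cinner.add_left cinner.add_right)

lemma adj_diff:
  "S \<in> bounded_ops \<Longrightarrow> T \<in> bounded_ops \<Longrightarrow> adj (S - T) = adj S - adj T"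
  by (rule adj_eqI) (simp add: cinner_adj blinfun.diff_left cinner.diff_left cinner.diff_right)

lemma adj_scaleR: "T \<in> bounded_ops \<Longrightarrow> adj (r *\<^sub>R T) = r *\<^sub>R adj T"
  by (rule adj_eqI) (simp add: cinner_adj blinfun.scaleR_left cinner.scaleR_left cinner.scaleR_right)

lemma adj_id [simp]: "adj id_blinfun = id_blinfun"
  by (rule adj_eqI) simp

lemma commutantD:
  fixes S :: "('a ell2 \<Rightarrow>\<^sub>L 'a ell2) set"
  shows "T \<in> commutant S \<Longrightarrow> A \<in> S \<Longrightarrow> T (A \<xi>) = A (T \<xi>)"
  unfolding commutant_def by (metis (mono_tags, lifting) blinfun_apply_blinfun_compose mem_Collect_eq)

lemma commutantI:
  fixes S :: "('a ell2 \<Rightarrow>\<^sub>L 'a ell2) set"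
  shows
  "T \<in> bounded_ops \<Longrightarrow> (\<And>A \<xi>. A \<in> S \<Longrightarrow> T (A \<xi>) = A (T \<xi>)) \<Longrightarrow> T \<in> commutant S"
  unfolding commutant_def by (auto intro!: blinfun_eqI)

lemma commutant_bounded_ops: "T \<in> commutant S \<Longrightarrow> T \<in> bounded_ops"
  by (simp add: commutant_def)

lemma commutant_closed:
  "id_blinfun \<in> commutant S"
  "A \<in> commutant S \<Longrightarrow> B \<in> commutant S \<Longrightarrow> A + B \<in> commutant S"
  "A \<in> commutant S \<Longrightarrow> B \<in> commutant S \<Longrightarrow> A - B \<in> commutant S"
  "A \<in> commutant S \<Longrightarrow> r *\<^sub>R A \<in> commutant S"
  "A \<in> commutant S \<Longrightarrow> B \<in> commutant S \<Longrightarrow> A o\<^sub>L B \<in> commutant S"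
proof -
  show "id_blinfun \<in> commutant S"
    by (intro commutantI bounded_ops_closed) simp
  show "A + B \<in> commutant S" "A - B \<in> commutant S" "A o\<^sub>L B \<in> commutant S"
    if "A \<in> commutant S" "B \<in> commutant S"
    using that[THEN commutant_bounded_ops] by (auto intro!: commutantI bounded_ops_closed
      simp: blinfun.bilinear_simps commutantD[OF that(1)] commutantD[OF that(2)])
  show "r *\<^sub>R A \<in> commutant S" if "A \<in> commutant S"
    using that[THEN commutant_bounded_ops] by (auto intro!: commutantI bounded_ops_closed
      simp: blinfun.bilinear_simps commutantD[OF that])
qed

lemma commutant_antimono: "S \<subseteq> T \<Longrightarrow> commutant T \<subseteq> commutant S"
  by (auto simp: commutant_def)

lemma subset_bicommutant: "S \<subseteq> bounded_ops \<Longrightarrow> S \<subseteq> commutant (commutant S)"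
  by (auto intro!: commutantI simp: commutantD)

lemma commutant_adj:
  assumes "S \<subseteq> bounded_ops" "\<And>A. A \<in> S \<Longrightarrow> adj A \<in> S" "T \<in> commutant S"
  shows "adj T \<in> commutant S"
proof (rule commutantI)
  have T: "T \<in> bounded_ops"
    using assms(3) by (rule commutant_bounded_ops)
  then show "adj T \<in> bounded_ops"
    by (rule adj_bounded_ops)
  fix A \<xi> assume A: "A \<in> S"
  then have "T (adj A \<zeta>) = adj A (T \<zeta>)" for \<zeta>
    using assms commutantD by blast
  then show "adj T (A \<xi>) = A (adj T \<xi>)"
  proof (intro cinner_extensional)
    fix \<zeta>
    have A': "A \<in> bounded_ops"
      using A assms(1) by blast
    have "cinner \<zeta> (adj T (A \<xi>)) = cinner (adj A (T \<zeta>)) \<xi>"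
      by (simp add: cinner_adj[OF T, symmetric] cinner_adj'[OF A'])
    also have "\<dots> = cinner (T (adj A \<zeta>)) \<xi>"
      by (simp add: \<open>\<And>\<zeta>. T (adj A \<zeta>) = adj A (T \<zeta>)\<close>)
    also have "\<dots> = cinner \<zeta> (A (adj T \<xi>))"
      by (simp add: cinner_adj[OF T] cinner_adj'[OF A'])
    finally show "cinner \<zeta> (adj T (A \<xi>)) = cinner \<zeta> (A (adj T \<xi>))" .
  qed
qed

lemma von_neumann_algebra_commutant:
  assumes "S \<subseteq> bounded_ops" "\<And>A. A \<in> S \<Longrightarrow> adj A \<in> S"
  shows "von_neumann_algebra (commutant S)"
  unfolding von_neumann_algebra_def
proof (intro conjI ballI)
  show sub: "commutant S \<subseteq> bounded_ops"
    by (auto simp: commutant_def)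
  show "adj T \<in> commutant S" if "T \<in> commutant S" for T
    using assms that by (rule commutant_adj)
  show "commutant (commutant (commutant S)) = commutant S"
    using subset_bicommutant[OF sub] commutant_antimono[OF subset_bicommutant[OF assms(1)]] by blast
qed

text \<open>The uniform bound makes the set of vectors at which the sequence is Cauchy a closed subspace,
  which contains the point masses.\<close>

lemma strong_limit_exists:
  fixes X :: "nat \<Rightarrow> 'a ell2 \<Rightarrow>\<^sub>L 'a ell2"
  assumes X: "\<And>n. X n \<in> bounded_ops" and bound: "\<And>n. norm (X n) \<le> C"
    and conv: "\<And>x. convergent (\<lambda>n. X n (delta x))"
  shows "\<exists>T\<in>bounded_ops. \<forall>\<xi>. (\<lambda>n. X n \<xi>) \<longlonglongrightarrow> T \<xi>"
proof -
  have C: "C \<ge> 0"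
    using bound[of 0] norm_ge_zero order_trans by blast
  have bound': "norm (X n \<xi>) \<le> norm \<xi> * C" for n \<xi>
    using norm_blinfun[of "X n" \<xi>] bound[of n] mult_right_mono[OF bound norm_ge_zero[of \<xi>]]
    by (simp add: mult.commute order_trans)
  have "Cauchy (\<lambda>n. X n \<xi>)" for \<xi>
  proof (induction \<xi> rule: ell2_induct)
    case closed
    show ?case
    proof (clarsimp simp: closed_limpt islimpt_approachable)
      fix \<xi> assume *: "\<forall>e>0. \<exists>\<eta>. Cauchy (\<lambda>n. X n \<eta>) \<and> \<eta> \<noteq> \<xi> \<and> dist \<eta> \<xi> < e"
      show "Cauchy (\<lambda>n. X n \<xi>)"
      proof (rule metric_CauchyI)
        fix e :: real assume e: "e > 0"
        define d where "d = e / (3 * (C + 1))"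
        have d: "d > 0" "d * C \<le> e / 3"
          using e C by (simp_all add: d_def field_simps)
        obtain \<eta> where \<eta>: "Cauchy (\<lambda>n. X n \<eta>)" "dist \<eta> \<xi> < d"
          using * d by blast
        obtain N where N: "\<And>m n. m \<ge> N \<Longrightarrow> n \<ge> N \<Longrightarrow> dist (X m \<eta>) (X n \<eta>) < e / 3"
          using metric_CauchyD[OF \<eta>(1), of "e / 3"] e by auto
        have close: "dist (X n \<xi>) (X n \<eta>) \<le> e / 3" for n
        proof -
          have "dist (X n \<xi>) (X n \<eta>) = norm (X n (\<xi> - \<eta>))"
            by (simp add: dist_norm blinfun.diff_right)
          also have "\<dots> \<le> norm (\<xi> - \<eta>) * C"
            by (rule bound')
          also have "\<dots> \<le> d * C"
            using \<eta>(2) C by (intro mult_right_mono) (auto simp: dist_norm norm_minus_commute)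
          finally show ?thesis
            using d by simp
        qed
        have "dist (X m \<xi>) (X n \<xi>) < e" if "m \<ge> N" "n \<ge> N" for m n
          using close[of m] close[of n] N[OF that]
            dist_triangle[of "X m \<xi>" "X n \<xi>" "X m \<eta>"] dist_triangle[of "X m \<eta>" "X n \<xi>" "X n \<eta>"]
          by (simp add: dist_commute)
        then show "\<exists>N. \<forall>m\<ge>N. \<forall>n\<ge>N. dist (X m \<xi>) (X n \<xi>) < e"
          by blast
      qed
    qed
  next
    case (add \<xi> \<eta>)
    then show ?case
      by (simp add: blinfun.add_right Cauchy_convergent_iff convergent_add)
  next
    case (delta c x)
    obtain l where "(\<lambda>n. X n (delta x)) \<longlonglongrightarrow> l"
      using conv convergent_def by blast
    then have "(\<lambda>n. X n (scaleC c (delta x))) \<longlonglongrightarrow> scaleC c l"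
      unfolding bounded_ops_scaleC[OF X] by (intro scaleC.tendsto tendsto_const)
    then show ?case
      by (simp add: LIMSEQ_imp_Cauchy)
  qed
  then obtain T where T: "\<And>\<xi>. (\<lambda>n. X n \<xi>) \<longlonglongrightarrow> T \<xi>"
    unfolding Cauchy_convergent_iff convergent_def by metis
  have "bounded_linear T"
  proof (rule bounded_linear_intro[where K = C])
    fix \<xi> \<eta> and r :: real
    show "T (\<xi> + \<eta>) = T \<xi> + T \<eta>"
      using tendsto_add[OF T[of \<xi>] T[of \<eta>]] T[of "\<xi> + \<eta>"]
      by (simp add: blinfun.add_right LIMSEQ_unique)
    show "T (r *\<^sub>R \<xi>) = r *\<^sub>R T \<xi>"
      using tendsto_scaleR[OF tendsto_const[of r] T[of \<xi>]] T[of "r *\<^sub>R \<xi>"]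
      by (simp add: blinfun.scaleR_right LIMSEQ_unique)
    show "norm (T \<xi>) \<le> norm \<xi> * C"
      using bound' by (intro Lim_bounded[OF tendsto_norm[OF T]]) auto
  qed
  then have app: "blinfun_apply (Blinfun T) = T"
    by (rule bounded_linear_Blinfun_apply)
  have "T (scaleC c \<xi>) = scaleC c (T \<xi>)" for c \<xi>
    using scaleC.tendsto[OF tendsto_const[of c] T[of \<xi>]] T[of "scaleC c \<xi>"]
    by (simp add: bounded_ops_scaleC[OF X] LIMSEQ_unique)
  then have "Blinfun T \<in> bounded_ops"
    by (simp add: bounded_ops_def app)
  then show ?thesis
    using T app by (intro bexI[of _ "Blinfun T"]) auto
qed

lemma strong_limitI:
  fixes X :: "nat \<Rightarrow> 'a ell2 \<Rightarrow>\<^sub>L 'a ell2"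
  assumes "\<And>n. X n \<in> bounded_ops" "\<And>n. norm (X n) \<le> C" "T \<in> bounded_ops"
    and lim: "\<And>x. (\<lambda>n. X n (delta x)) \<longlonglongrightarrow> T (delta x)"
  shows "(\<lambda>n. X n \<xi>) \<longlonglongrightarrow> T \<xi>"
proof -
  have "\<And>x. convergent (\<lambda>n. X n (delta x))"
    using lim convergent_def by blast
  then obtain T' where T': "T' \<in> bounded_ops" "\<And>\<xi>. (\<lambda>n. X n \<xi>) \<longlonglongrightarrow> T' \<xi>"
    using strong_limit_exists[of X C] assms(1,2) by blast
  have "T' = T"
    using T' lim by (intro bounded_ops_eqI assms(3)) (auto intro: LIMSEQ_unique)
  then show ?thesis
    using T' by simp
qed

lemma commutant_strong_limit:
  assumes "\<And>n. X n \<in> commutant S" "T \<in> bounded_ops" "\<And>\<xi>. (\<lambda>n. X n \<xi>) \<longlonglongrightarrow> T \<xi>"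
  shows "T \<in> commutant S"
proof (rule commutantI)
  fix A \<xi> assume A: "A \<in> S"
  have "(\<lambda>n. A (X n \<xi>)) \<longlonglongrightarrow> A (T \<xi>)"
    by (intro blinfun.tendsto tendsto_const assms)
  moreover have "(\<lambda>n. A (X n \<xi>)) \<longlonglongrightarrow> T (A \<xi>)"
    using assms(3)[of "A \<xi>"] by (simp add: commutantD[OF assms(1) A])
  ultimately show "T (A \<xi>) = A (T \<xi>)"
    using LIMSEQ_unique by blast
qed (rule assms)


section \<open>Group von Neumann algebras\<close>

lemma precompose_bij:
  fixes \<pi> :: "'a \<Rightarrow> 'a"
  assumes "bij \<pi>"
  defines "S \<equiv> \<lambda>\<xi>. Abs_ell2 (\<lambda>x. Rep_ell2 \<xi> (\<pi> x))"
  shows "Rep_ell2 (S \<xi>) x = Rep_ell2 \<xi> (\<pi> x)" "bounded_linear S"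
proof -
  show S: "Rep_ell2 (S \<xi>) x = Rep_ell2 \<xi> (\<pi> x)" for \<xi> x
    using Rep_ell2[of \<xi>]
      summable_on_reindex_bij_betw[OF assms(1), of "\<lambda>x. (norm (Rep_ell2 \<xi> x))\<^sup>2"]
    by (simp add: S_def Abs_ell2_inverse)
  show "bounded_linear S"
  proof (rule bounded_linear_intro[where K = 1])
    show "norm (S \<xi>) \<le> norm \<xi> * 1" for \<xi>
      using infsum_reindex_bij_betw[OF assms(1), of "\<lambda>x. Rep_ell2 \<xi> x * cnj (Rep_ell2 \<xi> x)"]
      by (simp add: norm_ell2_def inner_ell2_def cinner.rep_eq S)
  qed (auto intro!: ell2_eqI simp: S)
qed

text \<open>Boundedness of the sequence makes the set of good test vectors \<open>\<xi>\<close> closed, and convergence of the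
  coordinates says that it contains the point masses.\<close>

lemma weak_convergence_coordinatewise:
  assumes bound: "\<And>n. norm (Y n) \<le> C" and lim: "\<And>x. (\<lambda>n. Rep_ell2 (Y n) x) \<longlonglongrightarrow> Rep_ell2 y x"
  shows "(\<lambda>n. cinner \<xi> (Y n)) \<longlonglongrightarrow> cinner \<xi> y"
proof -
  define Z where "Z n = Y n - y" for n
  define K where "K = C + norm y + 1"
  have "C \<ge> 0"
    using bound[of 0] norm_ge_zero order_trans by blast
  then have K: "K > 0" "norm (Z n) \<le> K" for n
    using bound[of n] norm_triangle_ineq4[of "Y n" y] by (auto simp: K_def Z_def add_nonneg_pos)
  have "(\<lambda>n. cinner \<xi> (Z n)) \<longlonglongrightarrow> 0"
  proof (induction \<xi> rule: ell2_induct)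
    case closed
    show ?case
    proof (clarsimp simp: closed_limpt islimpt_approachable)
      fix \<xi>
      assume *: "\<forall>e>0. \<exists>\<eta>. (\<lambda>n. cinner \<eta> (Z n)) \<longlonglongrightarrow> 0 \<and> \<eta> \<noteq> \<xi> \<and> dist \<eta> \<xi> < e"
      show "(\<lambda>n. cinner \<xi> (Z n)) \<longlonglongrightarrow> 0"
      proof (rule tendstoI)
        fix e :: real assume "e > 0"
        then obtain \<eta> where \<eta>: "(\<lambda>n. cinner \<eta> (Z n)) \<longlonglongrightarrow> 0" "dist \<eta> \<xi> < e / (2 * K)"
          using *[rule_format, of "e / (2 * K)"] K by auto
        have "\<forall>\<^sub>F n in sequentially. dist (cinner \<eta> (Z n)) 0 < e/2"
          using \<eta>(1) \<open>e > 0\<close> by (intro tendstoD) auto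
        then show "\<forall>\<^sub>F n in sequentially. dist (cinner \<xi> (Z n)) 0 < e"
        proof eventually_elim
          case (elim n)
          have "norm (cinner (\<xi> - \<eta>) (Z n)) \<le> norm (\<xi> - \<eta>) * K"
            using cinner_Cauchy_Schwarz[of "\<xi> - \<eta>" "Z n"] mult_left_mono[OF K(2)[of n], of "norm (\<xi> - \<eta>)"]
            by simp
          also have "\<dots> < e/2"
            using \<eta>(2) K by (simp add: dist_norm norm_minus_commute field_simps)
          finally have "norm (cinner \<xi> (Z n) - cinner \<eta> (Z n)) < e/2"
            by (simp add: cinner.diff_left)
          then show ?case
            using elim norm_triangle_sub[of "cinner \<xi> (Z n)" "cinner \<eta> (Z n)"] by simp
        qed
      qed
    qed
  next
    case (add \<xi> \<eta>)
    then show ?case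
      using tendsto_add by (fastforce simp: cinner.add_left)
  next
    case (delta c x)
    have "(\<lambda>n. cinner (delta x) (Z n)) = (\<lambda>n. cnj (Rep_ell2 (Y n) x - Rep_ell2 y x))"
      by (metis Rep_ell2_diff Z_def cinner_commute cinner_delta)
    moreover have "(\<lambda>n. cnj (Rep_ell2 (Y n) x - Rep_ell2 y x)) \<longlonglongrightarrow> cnj (Rep_ell2 y x - Rep_ell2 y x)"
      by (intro tendsto_intros lim)
    ultimately have "(\<lambda>n. cinner (delta x) (Z n)) \<longlonglongrightarrow> 0"
      by simp
    from tendsto_mult_left[OF this, of c] show ?case
      by (simp add: cinner_scaleC_left)
  qed
  then show ?thesis
    by (simp add: Z_def cinner.diff_right LIM_zero_iff)
qed

lemma Rep_ell2_vanishes: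
  assumes "\<And>z. \<forall>\<^sub>F n in sequentially. t n \<noteq> z"
  shows "(\<lambda>n. Rep_ell2 \<xi> (t n)) \<longlonglongrightarrow> 0"
proof -
  have "(\<lambda>n. cinner \<xi> (delta (t n))) \<longlonglongrightarrow> cinner \<xi> 0"
  proof (rule weak_convergence_coordinatewise)
    show "(\<lambda>n. Rep_ell2 (delta (t n)) x) \<longlonglongrightarrow> Rep_ell2 0 x" for x
      by (rule tendsto_eventually, use assms[of x] in eventually_elim) (auto simp: delta.rep_eq)
  qed (rule eq_refl, rule norm_delta)
  then show ?thesis
    by (simp add: cinner.zero_right)
qed

locale discrete_group = group G for G :: "('a, 'b) monoid_scheme" (structure) +
  assumes carrier_eq_UNIV: "carrier G = UNIV"
begin

lemma in_carrier [simp]: "x \<in> carrier G"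
  by (simp add: carrier_eq_UNIV)

lemma bij_mult_left: "bij (\<lambda>x. g \<otimes> x)"
  by (rule bij_betw_byWitness[where f' = "\<lambda>x. inv g \<otimes> x"]) (auto simp: m_assoc[symmetric])

lemma bij_mult_right: "bij (\<lambda>x. x \<otimes> g)"
  by (rule bij_betw_byWitness[where f' = "\<lambda>x. x \<otimes> inv g"]) (auto simp: m_assoc)

lemma bij_inv: "bij (\<lambda>x. inv x)"
  by (rule bij_betw_byWitness[where f' = "\<lambda>x. inv x"]) auto

abbreviation lam :: "'a \<Rightarrow> 'a ell2 \<Rightarrow>\<^sub>L 'a ell2" where
  "lam \<equiv> left_reg G"

definition rho :: "'a \<Rightarrow> 'a ell2 \<Rightarrow>\<^sub>L 'a ell2" where
  "rho g = Blinfun (\<lambda>\<xi>. Abs_ell2 (\<lambda>x. Rep_ell2 \<xi> (x \<otimes> g)))"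

abbreviation M :: "('a ell2 \<Rightarrow>\<^sub>L 'a ell2) set" where
  "M \<equiv> group_vN G"

abbreviation \<tau> :: "('a ell2 \<Rightarrow>\<^sub>L 'a ell2) \<Rightarrow> complex" where
  "\<tau> \<equiv> canonical_trace G"

lemma Rep_lam: "Rep_ell2 (lam g \<xi>) x = Rep_ell2 \<xi> (inv g \<otimes> x)"
  by (rule left_reg_apply) (rule is_group carrier_eq_UNIV)+

lemma Rep_rho: "Rep_ell2 (rho g \<xi>) x = Rep_ell2 \<xi> (x \<otimes> g)"
  using precompose_bij[OF bij_mult_right[of g]]
  by (simp add: rho_def bounded_linear_Blinfun_apply)

lemma lam_bounded_ops: "lam g \<in> bounded_ops" and rho_bounded_ops: "rho g \<in> bounded_ops"
  by (auto simp: bounded_ops_def Rep_lam Rep_rho intro!: ell2_eqI)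

lemma lam_delta: "lam g (delta h) = delta (g \<otimes> h)"
  by (rule ell2_eqI) (auto simp: Rep_lam delta.rep_eq inv_solve_left' m_assoc[symmetric])

lemma rho_delta: "rho g (delta h) = delta (h \<otimes> inv g)"
  by (rule ell2_eqI) (auto simp: Rep_rho delta.rep_eq m_assoc)

lemma lam_lam [simp]: "lam g (lam h \<xi>) = lam (g \<otimes> h) \<xi>"
  by (rule ell2_eqI) (simp add: Rep_lam inv_mult_group m_assoc)

lemma lam_one [simp]: "lam \<one> = id_blinfun"
  by (rule blinfun_eqI, rule ell2_eqI) (simp add: Rep_lam)

lemma cinner_lam_lam: "cinner (lam g \<xi>) (lam g \<eta>) = cinner \<xi> \<eta>"
  using infsum_reindex_bij_betw[OF bij_mult_left[of "inv g"],
      of "\<lambda>x. Rep_ell2 \<xi> x * cnj (Rep_ell2 \<eta> x)"]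
  by (simp add: cinner.rep_eq Rep_lam)

lemma cinner_rho_rho: "cinner (rho g \<xi>) (rho g \<eta>) = cinner \<xi> \<eta>"
  using infsum_reindex_bij_betw[OF bij_mult_right[of g],
      of "\<lambda>x. Rep_ell2 \<xi> x * cnj (Rep_ell2 \<eta> x)"]
  by (simp add: cinner.rep_eq Rep_rho)

lemma norm_lam [simp]: "norm (lam g \<xi>) = norm \<xi>" and norm_rho [simp]: "norm (rho g \<xi>) = norm \<xi>"
  by (simp_all add: norm_ell2_def inner_ell2_def cinner_lam_lam cinner_rho_rho)

lemma adj_lam [simp]: "adj (lam g) = lam (inv g)"
proof (rule adj_eqI)
  fix \<xi> \<eta>
  show "cinner (lam g \<xi>) \<eta> = cinner \<xi> (lam (inv g) \<eta>)"
    using cinner_lam_lam[of g \<xi> "lam (inv g) \<eta>"] by simp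
qed

lemma rho_in_commutant: "rho g \<in> commutant (lam ` carrier G)"
  by (rule commutantI) (auto simp: rho_bounded_ops Rep_lam Rep_rho m_assoc intro!: ell2_eqI)

lemma lam_in_M: "lam g \<in> M"
  unfolding group_vN_def by (rule set_mp[OF subset_bicommutant]) (auto simp: lam_bounded_ops)

lemma von_neumann_algebra_M: "von_neumann_algebra M"
  unfolding group_vN_def
proof (rule von_neumann_algebra_commutant)
  show "commutant (lam ` carrier G) \<subseteq> bounded_ops"
    by (auto simp: commutant_bounded_ops)
  fix A assume "A \<in> commutant (lam ` carrier G)"
  then show "adj A \<in> commutant (lam ` carrier G)"
    by (rule commutant_adj[rotated 2]) (auto simp: lam_bounded_ops)
qed

lemma M_bounded_ops: "x \<in> M \<Longrightarrow> x \<in> bounded_ops"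
  by (simp add: group_vN_def commutant_bounded_ops)

lemma M_adj: "x \<in> M \<Longrightarrow> adj x \<in> M"
  using von_neumann_algebra_M by (simp add: von_neumann_algebra_def)

lemmas M_closed = commutant_closed[where S = "commutant (lam ` carrier G)", folded group_vN_def]

lemma M_rho: "x \<in> M \<Longrightarrow> x (rho g \<xi>) = rho g (x \<xi>)"
  unfolding group_vN_def by (rule commutantD) (auto simp: rho_in_commutant)

text \<open>Elements of \<open>M\<close> commute with the right translations, which permute the point masses
  transitively; they are therefore controlled by their value at \<open>\<delta>\<^sub>1\<close>.\<close>

lemma M_delta: "x \<in> M \<Longrightarrow> x (delta h) = rho (inv h) (x (delta \<one>))"
  by (simp add: M_rho[symmetric] rho_delta)

lemma M_eqI: "x \<in> M \<Longrightarrow> y \<in> M \<Longrightarrow> x (delta \<one>) = y (delta \<one>) \<Longrightarrow> x = y"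
  by (rule bounded_ops_eqI) (metis M_bounded_ops M_delta)+

lemma M_strong_limitI:
  assumes X: "\<And>n. X n \<in> M" "\<And>n. norm (X n) \<le> C" and T: "T \<in> M"
    and lim: "(\<lambda>n. X n (delta \<one>)) \<longlonglongrightarrow> T (delta \<one>)"
  shows "(\<lambda>n. X n \<xi>) \<longlonglongrightarrow> T \<xi>"
proof (rule strong_limitI)
  show "(\<lambda>n. X n (delta h)) \<longlonglongrightarrow> T (delta h)" for h
    unfolding M_delta[where h = h, OF X(1)] M_delta[where h = h, OF T] by (intro blinfun.tendsto tendsto_const lim)
qed (use X T M_bounded_ops in auto)

lemma M_strong_limit_exists:
  assumes X: "\<And>n. X n \<in> M" "\<And>n. norm (X n) \<le> C" and conv: "convergent (\<lambda>n. X n (delta \<one>))"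
  shows "\<exists>T\<in>M. \<forall>\<xi>. (\<lambda>n. X n \<xi>) \<longlonglongrightarrow> T \<xi>"
proof -
  have "convergent (\<lambda>n. X n (delta h))" for h
  proof -
    obtain l where "(\<lambda>n. X n (delta \<one>)) \<longlonglongrightarrow> l"
      using conv convergent_def by blast
    then have "(\<lambda>n. rho (inv h) (X n (delta \<one>))) \<longlonglongrightarrow> rho (inv h) l"
      by (intro blinfun.tendsto tendsto_const)
    then show ?thesis
      unfolding M_delta[where h = h, OF X(1)] convergent_def by blast
  qed
  then obtain T where T: "T \<in> bounded_ops" "\<And>\<xi>. (\<lambda>n. X n \<xi>) \<longlonglongrightarrow> T \<xi>"
    using strong_limit_exists[of X C] X M_bounded_ops by blast
  have "T \<in> M"
    unfolding group_vN_def
    by (rule commutant_strong_limit[of X]) (use X(1) T in \<open>simp_all add: group_vN_def\<close>)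
  with T show ?thesis
    by blast
qed

text \<open>In coordinates \<open>\<tau>(xy)\<close> is \<open>\<Sum>\<^sub>g y(g) x(g\<^sup>-\<^sup>1)\<close>, which the substitution \<open>g \<mapsto> g\<^sup>-\<^sup>1\<close> makes
  symmetric in \<open>x\<close> and \<open>y\<close>.\<close>

lemma trace_commute:
  assumes x: "x \<in> M" and y: "y \<in> M"
  shows "\<tau> (x o\<^sub>L y) = \<tau> (y o\<^sub>L x)"
proof -
  define f where "f z g = Rep_ell2 (z (delta \<one>)) g" for z :: "'a ell2 \<Rightarrow>\<^sub>L 'a ell2" and g
  have *: "\<tau> (x o\<^sub>L y) = (\<Sum>\<^sub>\<infinity>g. f y g * f x (inv g))" if "x \<in> M" for x y
  proof -
    have "cnj (Rep_ell2 (adj x (delta \<one>)) g) = f x (inv g)" for g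
    proof -
      have "cnj (Rep_ell2 (adj x (delta \<one>)) g) = cinner (x (delta g)) (delta \<one>)"
        by (metis cinner_adj'[OF M_bounded_ops[OF that]] cinner_commute cinner_delta)
      also have "\<dots> = f x (inv g)"
        by (subst M_delta[OF that]) (simp add: Rep_rho f_def)
      finally show ?thesis .
    qed
    moreover have "\<tau> (x o\<^sub>L y) = cinner (y (delta \<one>)) (adj x (delta \<one>))"
      using cinner_adj[OF M_bounded_ops[OF that]] by (simp add: canonical_trace_def del: cinner_delta)
    ultimately show ?thesis
      by (simp add: cinner.rep_eq f_def)
  qed
  show ?thesis
    using infsum_reindex_bij_betw[OF bij_inv, of "\<lambda>g. f y g * f x (inv g)"]
    by (simp add: *[OF x] *[OF y] mult.commute)
qed

lemma L2_norm_eq: "x \<in> M \<Longrightarrow> L2_norm \<tau> x = norm (x (delta \<one>))"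
  by (simp add: L2_norm_def canonical_trace_def cinner_adj' M_bounded_ops norm_ell2_def
      inner_ell2_def del: cinner_delta)


section \<open>Symmetries and their relative commutants\<close>

text \<open>A symmetry is a self-adjoint unitary, that is, \<open>2p - 1\<close> for a projection \<open>p\<close>.\<close>

definition symmetry :: "('a ell2 \<Rightarrow>\<^sub>L 'a ell2) \<Rightarrow> bool" where
  "symmetry u \<longleftrightarrow> u \<in> M \<and> adj u = u \<and> u o\<^sub>L u = id_blinfun"

definition relcomm :: "('a ell2 \<Rightarrow>\<^sub>L 'a ell2) \<Rightarrow> ('a ell2 \<Rightarrow>\<^sub>L 'a ell2) set" where
  "relcomm u = {x \<in> M. \<forall>\<xi>. x (u \<xi>) = u (x \<xi>)}"

lemma symmetryD:
  assumes "symmetry u"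
  shows "u \<in> M" "adj u = u" "u (u \<xi>) = \<xi>" "cinner (u \<xi>) \<eta> = cinner \<xi> (u \<eta>)"
proof -
  show "u \<in> M" "adj u = u"
    using assms by (auto simp: symmetry_def)
  show "u (u \<xi>) = \<xi>"
    using assms by (metis symmetry_def blinfun_apply_blinfun_compose blinfun_apply_id_blinfun id_apply)
  show "cinner (u \<xi>) \<eta> = cinner \<xi> (u \<eta>)"
    using cinner_adj[of u \<xi> \<eta>] \<open>u \<in> M\<close> \<open>adj u = u\<close> by (simp add: M_bounded_ops)
qed

lemma symmetryI:
  assumes "u \<in> M" "\<And>\<xi> \<eta>. cinner (u \<xi>) \<eta> = cinner \<xi> (u \<eta>)" "\<And>\<xi>. u (u \<xi>) = \<xi>"
  shows "symmetry u"
  unfolding symmetry_def using assms adj_eqI[of u u] by (auto intro: blinfun_eqI)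

lemma norm_symmetry_le: "symmetry u \<Longrightarrow> norm u \<le> 1"
proof (rule norm_blinfun_bound)
  fix \<xi> assume u: "symmetry u"
  have "cinner (u \<xi>) (u \<xi>) = cinner \<xi> \<xi>"
    by (simp add: symmetryD[OF u])
  then show "norm (u \<xi>) \<le> 1 * norm \<xi>"
    by (simp add: norm_ell2_def inner_ell2_def)
qed simp

lemma relcomm_eq_commutant:
  assumes "symmetry u"
  shows "relcomm u = commutant (insert u (commutant (lam ` carrier G)))"
proof -
  have "(\<forall>\<xi>. x (u \<xi>) = u (x \<xi>)) \<longleftrightarrow> x o\<^sub>L u = u o\<^sub>L x" for x :: "'a ell2 \<Rightarrow>\<^sub>L 'a ell2"
    by (metis blinfun_apply_blinfun_compose blinfun_eqI)
  then show ?thesis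
    by (auto simp: relcomm_def group_vN_def commutant_def)
qed

lemma relcomm_Sub:
  assumes u: "symmetry u"
  shows "relcomm u \<in> Sub M"
proof -
  have "von_neumann_algebra (relcomm u)"
    unfolding relcomm_eq_commutant[OF u]
  proof (rule von_neumann_algebra_commutant)
    show "insert u (commutant (lam ` carrier G)) \<subseteq> bounded_ops"
      using u by (auto simp: symmetryD M_bounded_ops commutant_bounded_ops)
    fix A assume "A \<in> insert u (commutant (lam ` carrier G))"
    moreover have "adj A \<in> commutant (lam ` carrier G)" if "A \<in> commutant (lam ` carrier G)"
      using that by (rule commutant_adj[rotated 2]) (auto simp: lam_bounded_ops)
    ultimately show "adj A \<in> insert u (commutant (lam ` carrier G))"
      using u by (auto simp: symmetryD)
  qed
  then show ?thesis
    by (auto simp: Sub_def relcomm_def)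
qed

lemma Sub_closed:
  assumes "P \<in> Sub M"
  shows "A \<in> P \<Longrightarrow> adj A \<in> P"
    "A \<in> P \<Longrightarrow> B \<in> P \<Longrightarrow> A + B \<in> P"
    "A \<in> P \<Longrightarrow> B \<in> P \<Longrightarrow> A - B \<in> P"
    "A \<in> P \<Longrightarrow> B \<in> P \<Longrightarrow> A o\<^sub>L B \<in> P"
    "A \<in> P \<Longrightarrow> A \<in> M"
    "id_blinfun \<in> P"
  using assms commutant_closed[where S = "commutant P"] by (auto simp: Sub_def von_neumann_algebra_def)

text \<open>Any two conditional expectations agree after pairing with \<open>N\<close> through the trace,
  and the trace is faithful.\<close>

lemma cond_exp_unique:
  assumes N: "N \<in> Sub M" and E: "is_cond_exp M \<tau> N E" and E': "is_cond_exp M \<tau> N E'"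
  shows "E = E'"
proof (rule PiE_ext)
  show "E \<in> M \<rightarrow>\<^sub>E N" "E' \<in> M \<rightarrow>\<^sub>E N"
    using E E' by (auto simp: is_cond_exp_def)
  fix x assume x: "x \<in> M"
  define d where "d = E x - E' x"
  have in_N: "E x \<in> N" "E' x \<in> N"
    using E E' x by (auto simp: is_cond_exp_def)
  then have d: "d \<in> N" "adj d \<in> N" "d \<in> bounded_ops"
    using Sub_closed[OF N] M_bounded_ops by (auto simp: d_def)
  have *: "\<tau> (E x o\<^sub>L y) = \<tau> (x o\<^sub>L y)" if E: "is_cond_exp M \<tau> N E" and y: "y \<in> N" for E y
  proof -
    have "\<forall>a\<in>N. \<forall>x\<in>M. \<forall>b\<in>N. E (a o\<^sub>L x o\<^sub>L b) = a o\<^sub>L E x o\<^sub>L b"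
      using E by (simp add: is_cond_exp_def)
    then have "E (id_blinfun o\<^sub>L x o\<^sub>L y) = id_blinfun o\<^sub>L E x o\<^sub>L y"
      using x y Sub_closed(6)[OF N] by blast
    moreover have "id_blinfun o\<^sub>L z = z" for z :: "'a ell2 \<Rightarrow>\<^sub>L 'a ell2"
      by (rule blinfun_eqI) simp
    moreover have "x o\<^sub>L y \<in> M"
      using x y Sub_closed(5)[OF N] by (intro M_closed)
    moreover have "\<tau> (E z) = \<tau> z" if "z \<in> M" for z
      using E that by (simp add: is_cond_exp_def)
    ultimately show ?thesis
      by metis
  qed
  have "\<tau> (d o\<^sub>L adj d) = \<tau> (E x o\<^sub>L adj d) - \<tau> (E' x o\<^sub>L adj d)"
    by (simp add: canonical_trace_def d_def blinfun.diff_left cinner.diff_left)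
  also have "\<dots> = 0"
    by (simp add: *[OF E d(2)] *[OF E' d(2)])
  finally have "cinner (adj d (delta \<one>)) (adj d (delta \<one>)) = 0"
    by (simp add: canonical_trace_def cinner_adj[OF d(3)] del: cinner_delta)
  then have "adj d (delta \<one>) = 0"
    by (simp add: cinner_self)
  then have "adj d = 0"
    using d(2) Sub_closed[OF N] M_closed(3)[of "adj d" "adj d"] by (intro M_eqI) auto
  then have "d = 0"
    using adj_adj[OF d(3)] by (metis adj_eqI cinner.zero_left cinner.zero_right zero_blinfun.rep_eq)
  then show "E x = E' x"
    by (simp add: d_def)
qed

definition conj_mean :: "('a ell2 \<Rightarrow>\<^sub>L 'a ell2) \<Rightarrow> ('a ell2 \<Rightarrow>\<^sub>L 'a ell2) \<Rightarrow> ('a ell2 \<Rightarrow>\<^sub>L 'a ell2)" where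
  "conj_mean u x = (1/2) *\<^sub>R (x + (u o\<^sub>L x o\<^sub>L u))"

lemma conj_mean_apply: "conj_mean u x \<xi> = (1/2) *\<^sub>R (x \<xi> + u (x (u \<xi>)))"
  by (simp add: conj_mean_def blinfun.bilinear_simps)

lemma conj_mean_in_M: "symmetry u \<Longrightarrow> x \<in> M \<Longrightarrow> conj_mean u x \<in> M"
  unfolding conj_mean_def by (intro M_closed) (auto simp: symmetryD)

lemma cond_exp_relcomm:
  assumes u: "symmetry u" and x: "x \<in> M"
  shows "cond_exp M \<tau> (relcomm u) x = conj_mean u x"
proof -
  note uD = symmetryD[OF u]
  let ?E = "restrict (conj_mean u) M"
  have "is_cond_exp M \<tau> (relcomm u) ?E"
    unfolding is_cond_exp_def
  proof (intro conjI ballI impI)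
    show "?E \<in> M \<rightarrow>\<^sub>E relcomm u"
      using u by (auto simp: relcomm_def conj_mean_in_M conj_mean_apply uD blinfun.bilinear_simps add.commute)
  next
    fix x y assume "x \<in> M" "y \<in> M"
    then show "?E (x + y) = ?E x + ?E y"
      by (auto intro!: blinfun_eqI simp: M_closed conj_mean_apply blinfun.bilinear_simps algebra_simps)
  next
    fix x assume x: "x \<in> M" "positive_op x"
    then have pos: "0 \<le> cinner (x \<xi>) \<xi>" for \<xi>
      by (simp add: positive_op_def)
    have "0 \<le> cinner (conj_mean u x \<xi>) \<xi>" for \<xi>
    proof -
      have eq: "cinner (conj_mean u x \<xi>) \<xi> = of_real (1/2) * (cinner (x \<xi>) \<xi> + cinner (x (u \<xi>)) (u \<xi>))"
        by (simp add: conj_mean_apply cinner.scaleR_left cinner.add_left uD scaleR_conv_of_real)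
      show ?thesis
        using pos[of \<xi>] pos[of "u \<xi>"] unfolding eq less_eq_complex_def by simp
    qed
    then show "positive_op (?E x)"
      using x by (simp add: positive_op_def conj_mean_in_M[OF u] M_bounded_ops)
  next
    fix x assume "x \<in> relcomm u"
    then show "?E x = x"
      by (auto intro!: blinfun_eqI simp: relcomm_def conj_mean_apply uD simp flip: scaleR_2)
  next
    fix a x b assume *: "a \<in> relcomm u" "x \<in> M" "b \<in> relcomm u"
    then have "a o\<^sub>L x o\<^sub>L b \<in> M"
      by (intro M_closed) (auto simp: relcomm_def)
    moreover have "u (a \<xi>) = a (u \<xi>)" "u (b \<xi>) = b (u \<xi>)" for \<xi>
      using * by (auto simp: relcomm_def)
    ultimately show "?E (a o\<^sub>L x o\<^sub>L b) = a o\<^sub>L ?E x o\<^sub>L b"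
      using * by (intro blinfun_eqI) (simp add: conj_mean_apply blinfun.bilinear_simps)
  next
    fix x assume x: "x \<in> M"
    have "\<tau> (u o\<^sub>L x o\<^sub>L u) = \<tau> (u o\<^sub>L (u o\<^sub>L x))"
      using x uD by (intro trace_commute M_closed)
    also have "u o\<^sub>L (u o\<^sub>L x) = x"
      by (rule blinfun_eqI) (simp add: uD)
    finally show "\<tau> (?E x) = \<tau> x"
      using x by (simp add: canonical_trace_def conj_mean_def blinfun.bilinear_simps)
  qed
  then have "cond_exp M \<tau> (relcomm u) = ?E"
    unfolding cond_exp_def using cond_exp_unique[OF relcomm_Sub[OF u]] by blast
  then show ?thesis
    using x by simp
qed

text \<open>The spectral projections of a symmetry for the eigenvalues \<open>1\<close> and \<open>-1\<close>.\<close>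

definition ppart :: "('a ell2 \<Rightarrow>\<^sub>L 'a ell2) \<Rightarrow> ('a ell2 \<Rightarrow>\<^sub>L 'a ell2)" where
  "ppart u = (1/2) *\<^sub>R (id_blinfun + u)"
definition qpart :: "('a ell2 \<Rightarrow>\<^sub>L 'a ell2) \<Rightarrow> ('a ell2 \<Rightarrow>\<^sub>L 'a ell2)" where
  "qpart u = (1/2) *\<^sub>R (id_blinfun - u)"

lemma spectral_projections:
  assumes u: "symmetry u"
  defines "p \<equiv> ppart u" and "q \<equiv> qpart u"
  shows "p \<in> relcomm u" "q \<in> relcomm u"
    and "p (p \<xi>) = p \<xi>" "q (q \<xi>) = q \<xi>" "p (q \<xi>) = 0" "q (p \<xi>) = 0"
    and "p \<xi> + q \<xi> = \<xi>" "u (p \<xi>) = p \<xi>" "u (q \<xi>) = - q \<xi>" "u \<xi> = p \<xi> - q \<xi>"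
    and "adj p = p" "adj q = q"
proof -
  note uD = symmetryD[OF u]
  show "p \<in> relcomm u" "q \<in> relcomm u"
    by (auto simp: relcomm_def p_def q_def ppart_def qpart_def uD M_closed blinfun.bilinear_simps)
  show "p (p \<xi>) = p \<xi>" "q (q \<xi>) = q \<xi>" "p (q \<xi>) = 0" "q (p \<xi>) = 0"
    "p \<xi> + q \<xi> = \<xi>" "u (p \<xi>) = p \<xi>" "u (q \<xi>) = - q \<xi>" "u \<xi> = p \<xi> - q \<xi>"
    by (simp_all add: p_def q_def ppart_def qpart_def uD blinfun.bilinear_simps algebra_simps
        flip: scaleR_2 scaleR_left.add)
  show "adj p = p" "adj q = q"
    unfolding p_def q_def ppart_def qpart_def
    by (simp_all add: adj_scaleR adj_add adj_diff bounded_ops_closed M_bounded_ops uD)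
qed

text \<open>If \<open>q y p\<close> and \<open>q y\<^sup>* p\<close> both vanish, then so does \<open>p y q\<close>; hence \<open>y\<close> is block diagonal with
  respect to \<open>p\<close> and \<open>q\<close>, that is, it commutes with \<open>u = p - q\<close>.\<close>

lemma nonzero_corner:
  assumes u: "symmetry u" and y: "y \<in> M" "y \<notin> relcomm u"
  shows "\<exists>z\<in>{y, adj y}. \<exists>\<xi>. qpart u (z (ppart u \<xi>)) \<noteq> 0"
proof (rule ccontr)
  assume "\<not> ?thesis"
  then have zero: "qpart u (y (ppart u \<xi>)) = 0" "qpart u (adj y (ppart u \<xi>)) = 0" for \<xi>
    by auto
  note P = spectral_projections[OF u]
  have bo: "ppart u \<in> bounded_ops" "qpart u \<in> bounded_ops" "y \<in> bounded_ops"
    using P y M_bounded_ops by (auto simp: relcomm_def)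
  have zero': "ppart u (y (qpart u \<xi>)) = 0" for \<xi>
  proof (rule cinner_extensional)
    fix \<zeta>
    have "cinner \<zeta> (ppart u (y (qpart u \<xi>))) = cinner (qpart u (adj y (ppart u \<zeta>))) \<xi>"
      using bo by (metis cinner_adj cinner_adj' P(11,12))
    then show "cinner \<zeta> (ppart u (y (qpart u \<xi>))) = cinner \<zeta> 0"
      by (simp add: zero cinner.zero_left cinner.zero_right)
  qed
  have "y (u \<xi>) = u (y \<xi>)" for \<xi>
  proof -
    have p: "ppart u (y (ppart u \<xi>)) = y (ppart u \<xi>)"
      using P(7)[of "y (ppart u \<xi>)"] zero by simp
    have q: "qpart u (y (qpart u \<xi>)) = y (qpart u \<xi>)"
      using P(7)[of "y (qpart u \<xi>)"] zero' by simp
    have "u (y \<xi>) = u (y (ppart u \<xi>)) + u (y (qpart u \<xi>))"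
      by (simp flip: blinfun.add_right add: P(7))
    also have "\<dots> = y (ppart u \<xi>) - y (qpart u \<xi>)"
      using P(8)[of "y (ppart u \<xi>)"] P(9)[of "y (qpart u \<xi>)"] p q by simp
    also have "\<dots> = y (u \<xi>)"
      by (simp add: P(10)[of \<xi>] blinfun.diff_right)
    finally show ?thesis ..
  qed
  then show False
    using y by (simp add: relcomm_def)
qed


section \<open>Index and maximality\<close>

text \<open>Testing \<open>E\<^sub>N\<close> on \<open>w\<^sup>*w\<close> with \<open>w = q z p + q\<close>, at a vector \<open>\<xi> = p \<xi> + v\<close>
  with \<open>v = q z p \<xi>\<close>, compares \<open>\<parallel>2v\<parallel>\<^sup>2\<close> with the mean of \<open>\<parallel>2v\<parallel>\<^sup>2\<close> and \<open>0\<close>: the constant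
  \<open>1/2\<close> cannot be improved.\<close>

lemma index_relcomm:
  assumes u: "symmetry u" and proper: "relcomm u \<noteq> M"
  shows "pimsner_popa_index M \<tau> (relcomm u) = 2"
proof -
  note uD = symmetryD[OF u] and P = spectral_projections[OF u]
  define p q where "p = ppart u" and "q = qpart u"
  have pq: "p \<in> M" "q \<in> M"
    using P by (auto simp: relcomm_def p_def q_def)
  let ?C = "{c::real. 0 < c \<and> (\<forall>x\<in>M. positive_op x \<longrightarrow>
      positive_op (cond_exp M \<tau> (relcomm u) x - c *\<^sub>R x))}"
  have half: "1/2 \<in> ?C"
  proof (intro CollectI conjI ballI impI)
    fix x assume x: "x \<in> M" "positive_op x"
    have eq: "cinner ((conj_mean u x - (1/2) *\<^sub>R x) \<xi>) \<xi> = of_real (1/2) * cinner (x (u \<xi>)) (u \<xi>)" for \<xi>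
      by (simp add: conj_mean_apply blinfun.bilinear_simps scaleR_add_right cinner.scaleR_left uD
          scaleR_conv_of_real)
    have "0 \<le> cinner ((conj_mean u x - (1/2) *\<^sub>R x) \<xi>) \<xi>" for \<xi>
      using x(2) unfolding eq less_eq_complex_def positive_op_def by simp
    moreover have "conj_mean u x - (1/2) *\<^sub>R x \<in> bounded_ops"
      using x by (intro M_bounded_ops M_closed conj_mean_in_M u)
    ultimately show "positive_op (cond_exp M \<tau> (relcomm u) x - (1/2) *\<^sub>R x)"
      unfolding cond_exp_relcomm[OF u x(1)] positive_op_def by blast
  qed simp
  have le_half: "c \<le> 1/2" if c: "c \<in> ?C" for c
  proof -
    obtain y where "y \<in> M" "y \<notin> relcomm u"
      using proper by (auto simp: relcomm_def)
    then obtain z \<xi> where z: "z \<in> M" "q (z (p \<xi>)) \<noteq> 0"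
      using nonzero_corner[OF u] M_adj unfolding p_def q_def by blast
    define w where "w = (q o\<^sub>L z o\<^sub>L p) + q"
    define v where "v = q (z (p \<xi>))"
    define \<zeta> where "\<zeta> = p \<xi> + v"
    have wM: "w \<in> M"
      unfolding w_def using pq z by (intro M_closed)
    have bo: "w \<in> bounded_ops" "adj w \<in> bounded_ops"
      using wM M_adj M_bounded_ops by auto
    have w\<zeta>: "w \<zeta> = 2 *\<^sub>R v" and wu\<zeta>: "w (u \<zeta>) = 0"
      by (simp_all add: w_def \<zeta>_def v_def p_def q_def blinfun.bilinear_simps P scaleR_2)
    define x where "x = adj w o\<^sub>L w"
    have x: "cinner (x \<eta>) \<eta> = cinner (w \<eta>) (w \<eta>)" for \<eta>
      by (simp add: x_def cinner_adj' bo)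
    have xM: "x \<in> M"
      unfolding x_def using wM M_adj by (intro M_closed)
    have "positive_op x"
      using M_bounded_ops[OF xM] by (simp add: positive_op_def x cinner_self less_eq_complex_def)
    then have "positive_op (conj_mean u x - c *\<^sub>R x)"
      using c xM by (auto simp: cond_exp_relcomm[OF u])
    then have "0 \<le> cinner ((conj_mean u x - c *\<^sub>R x) \<zeta>) \<zeta>"
      by (simp add: positive_op_def)
    also have "\<dots> = of_real (1/2) * (cinner (x \<zeta>) \<zeta> + cinner (x (u \<zeta>)) (u \<zeta>))
        - of_real c * cinner (x \<zeta>) \<zeta>"
      by (simp add: conj_mean_apply blinfun.bilinear_simps cinner.diff_left cinner.add_left
          cinner.scaleR_left uD scaleR_conv_of_real)
    also have "\<dots> = of_real ((1/2 - c) * (norm (2 *\<^sub>R v))\<^sup>2)"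
      unfolding x w\<zeta> wu\<zeta> cinner_self by (simp add: algebra_simps)
    finally have "0 \<le> (1/2 - c) * (norm (2 *\<^sub>R v))\<^sup>2"
      by (simp only: less_eq_complex_def Re_complex_of_real zero_complex.sel)
    moreover have "(norm (2 *\<^sub>R v))\<^sup>2 > 0"
      using z by (simp add: v_def)
    ultimately show ?thesis
      by (simp add: zero_le_mult_iff)
  qed
  have "pimsner_popa_const M \<tau> (relcomm u) = ennreal (1/2)"
    unfolding pimsner_popa_const_def
  proof (rule antisym)
    show "(SUP c\<in>?C. ennreal c) \<le> ennreal (1/2)"
      using le_half by (intro SUP_least ennreal_leI) auto
    show "ennreal (1/2) \<le> (SUP c\<in>?C. ennreal c)"
      using half by (rule SUP_upper)
  qed
  moreover have "inverse (ennreal (1/2)) = 2"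
    by (subst inverse_ennreal) auto
  ultimately show ?thesis
    by (simp only: pimsner_popa_index_def)
qed

definition spreading :: "(nat \<Rightarrow> 'a) \<Rightarrow> bool" where
  "spreading s \<longleftrightarrow> (\<forall>y z. y \<noteq> \<one> \<longrightarrow> (\<forall>\<^sub>F n in sequentially. s n \<otimes> y \<otimes> inv (s n) \<noteq> z))"

text \<open>A sequence conjugating every nontrivial element to infinity makes \<open>\<lambda>\<^sub>g\<^sup>* c \<lambda>\<^sub>g\<close> converge
  weakly to \<open>\<tau>(c)\<close>, because the coefficients of \<open>c\<close> vanish at infinity; apply this to
  \<open>c = b\<^sup>*b\<close>. In effect the lemma says that \<open>M\<close> is a factor.\<close>

lemma spreading_annihilator:
  assumes s: "spreading s" and b: "b \<in> M" and zero: "\<And>g. b (lam g \<zeta>) = 0"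
  shows "b = 0 \<or> \<zeta> = 0"
proof -
  define c where "c = adj b o\<^sub>L b"
  have bo: "b \<in> bounded_ops" "adj b \<in> bounded_ops" and c: "c \<in> M"
    using b M_adj by (auto simp: M_bounded_ops c_def intro: M_closed)
  have coord: "\<tau> c * Rep_ell2 \<zeta> k = 0" for k
  proof -
    define Y where "Y n = lam (inv (s n)) (c (lam (s n) (delta k)))" for n
    have "(\<lambda>n. cinner \<zeta> (Y n)) \<longlonglongrightarrow> cinner \<zeta> (scaleC (\<tau> c) (delta k))"
    proof (rule weak_convergence_coordinatewise)
      show "norm (Y n) \<le> norm c" for n
        using norm_blinfun[of c "lam (s n) (delta k)"] by (simp add: Y_def)
      fix x
      have Y: "Rep_ell2 (Y n) x = Rep_ell2 (c (delta \<one>)) (s n \<otimes> (x \<otimes> inv k) \<otimes> inv (s n))" for n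
        by (simp add: Y_def lam_delta Rep_lam M_delta[OF c, of "s n \<otimes> k"] Rep_rho
            inv_mult_group m_assoc)
      show "(\<lambda>n. Rep_ell2 (Y n) x) \<longlonglongrightarrow> Rep_ell2 (scaleC (\<tau> c) (delta k)) x"
      proof (cases "x = k")
        case True
        then show ?thesis
          unfolding Y by (simp add: canonical_trace_def delta.rep_eq)
      next
        case False
        then have "x \<otimes> inv k \<noteq> \<one>"
          by (metis in_carrier inv_equality inv_inv inv_closed)
        then have "(\<lambda>n. Rep_ell2 (Y n) x) \<longlonglongrightarrow> 0"
          unfolding Y using s by (intro Rep_ell2_vanishes) (auto simp: spreading_def)
        then show ?thesis
          using False by (simp add: delta.rep_eq)
      qed
    qed
    moreover have "cinner \<zeta> (Y n) = 0" for n
    proof -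
      have "cinner \<zeta> (Y n) = cinner (lam (s n) \<zeta>) (c (lam (s n) (delta k)))"
        using cinner_lam_lam[of "s n" \<zeta> "Y n"] by (simp add: Y_def)
      also have "\<dots> = cinner (b (lam (s n) \<zeta>)) (b (lam (s n) (delta k)))"
        by (simp add: c_def cinner_adj[OF bo(1)])
      finally show ?thesis
        by (simp add: zero cinner.zero_left)
    qed
    ultimately have "cinner \<zeta> (scaleC (\<tau> c) (delta k)) = 0"
      using LIMSEQ_unique[OF tendsto_const] by fastforce
    then show ?thesis
      by (simp add: cinner_scaleC_right)
  qed
  have "\<tau> c = cinner (b (delta \<one>)) (b (delta \<one>))"
    by (simp add: canonical_trace_def c_def cinner_adj' bo del: cinner_delta)
  then have "\<tau> c = 0 \<Longrightarrow> b (delta \<one>) = (0 :: 'a ell2 \<Rightarrow>\<^sub>L 'a ell2) (delta \<one>)"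
    by (simp add: cinner_self)
  moreover have "(0 :: 'a ell2 \<Rightarrow>\<^sub>L 'a ell2) \<in> M"
    using M_closed(3)[OF b b] by simp
  ultimately have "\<tau> c = 0 \<Longrightarrow> b = 0"
    using b by (intro M_eqI) auto
  moreover have "\<zeta> = 0" if "\<tau> c \<noteq> 0"
    using coord that by (intro ell2_eqI) simp
  ultimately show ?thesis
    by blast
qed

text \<open>Let \<open>P\<close> contain \<open>N\<close> and an element with a nonzero corner \<open>b = q z p\<close>, and let \<open>T\<close> commute with
  \<open>P\<close>. For \<open>x\<close> in \<open>M\<close> the operators \<open>b \<lambda>\<^sub>g p\<close> and \<open>b \<lambda>\<^sub>g p x q\<close> lie in \<open>P\<close>, so \<open>b \<lambda>\<^sub>g\<close> annihilates the
  commutator of \<open>T\<close> with \<open>p x q\<close> for every \<open>g\<close>, whence \<open>T\<close> commutes with \<open>p x q\<close>. Taking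
  adjoints, \<open>T\<close> commutes with \<open>M\<close>, and \<open>P = P''\<close> is all of \<open>M\<close>.\<close>

lemma maximal_relcomm:
  assumes s: "spreading s" and u: "symmetry u" and proper: "relcomm u \<noteq> M"
  shows "maximal_subalgebra M (relcomm u)"
  unfolding maximal_subalgebra_def
proof (intro conjI ballI impI relcomm_Sub[OF u] proper, elim conjE)
  note uD = symmetryD[OF u] and P = spectral_projections[OF u]
  define p q where "p = ppart u" and "q = qpart u"
  note Pq = P[folded p_def q_def]
  have pq: "p \<in> M" "q \<in> M" "p \<in> bounded_ops" "q \<in> bounded_ops"
    using Pq M_bounded_ops by (auto simp: relcomm_def)
  fix A assume A: "A \<in> Sub M" and N_A: "relcomm u \<subseteq> A" and "A \<noteq> M"
  note A_closed = Sub_closed[OF A]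
  show "A = relcomm u"
  proof (rule ccontr)
    assume "A \<noteq> relcomm u"
    then obtain y where y: "y \<in> A" "y \<notin> relcomm u"
      using N_A by blast
    then obtain z \<xi>\<^sub>0 where z: "z \<in> A" "q (z (p \<xi>\<^sub>0)) \<noteq> 0"
      using nonzero_corner[OF u A_closed(5) y(2)] A_closed(1) unfolding p_def q_def by blast
    define b where "b = q o\<^sub>L z o\<^sub>L p"
    have b: "b \<in> A" "b \<in> M" "b \<noteq> 0"
    proof -
      show "b \<in> A"
        unfolding b_def using z N_A Pq(1,2) by (intro A_closed) auto
      then show "b \<in> M"
        by (rule A_closed)
      show "b \<noteq> 0"
        using z by (auto simp: b_def dest: arg_cong[where f = "\<lambda>T. blinfun_apply T \<xi>\<^sub>0"])
    qed
    have key: "T (p (x (q \<xi>))) = p (x (q (T \<xi>)))"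
      if T: "T \<in> commutant A" and x: "x \<in> M" for T x \<xi>
    proof -
      note Tc = commutantD[OF T]
      define \<zeta> where "\<zeta> = T (p (x (q \<xi>))) - p (x (q (T \<xi>)))"
      have pA: "p \<in> A"
        using N_A Pq(1) by blast
      have p\<zeta>: "p \<zeta> = \<zeta>"
        by (simp add: \<zeta>_def blinfun.diff_right Pq Tc[OF pA, symmetric])
      have "b (lam g \<zeta>) = 0" for g
      proof -
        define v where "v = b o\<^sub>L (p o\<^sub>L lam g o\<^sub>L p)"
        define w where "w = q o\<^sub>L z o\<^sub>L p o\<^sub>L lam g o\<^sub>L p o\<^sub>L x o\<^sub>L q"
        have "p o\<^sub>L lam g o\<^sub>L p \<in> relcomm u"
          by (auto simp: relcomm_def Pq blinfun.bilinear_simps intro!: M_closed pq lam_in_M)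
        then have v: "v \<in> A"
          unfolding v_def by (intro A_closed(4)[OF b(1)] subsetD[OF N_A])
        have "w \<in> relcomm u"
          unfolding relcomm_def w_def using z A_closed(5) x
          by (auto simp: Pq blinfun.bilinear_simps intro!: M_closed pq lam_in_M)
        then have w: "w \<in> A"
          using N_A by blast
        have vw: "v (p (x (q \<eta>))) = w \<eta>" for \<eta>
          by (simp add: v_def w_def b_def Pq)
        have "b (lam g \<zeta>) = v \<zeta>"
        proof -
          have "p (lam g \<zeta>) = p (lam g (p \<zeta>))"
            by (simp add: p\<zeta>)
          then show ?thesis
            by (simp add: v_def b_def Pq p\<zeta>)
        qed
        also have "\<dots> = T (w \<xi>) - w (T \<xi>)"
          by (simp add: \<zeta>_def blinfun.diff_right Tc[OF v, symmetric] vw)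
        also have "\<dots> = 0"
          by (simp add: Tc[OF w])
        finally show ?thesis .
      qed
      then have "\<zeta> = 0"
        using spreading_annihilator[OF s b(2)] b(3) by blast
      then show ?thesis
        by (simp add: \<zeta>_def)
    qed
    have "x \<in> A" if x: "x \<in> M" for x
    proof -
      have "x \<in> commutant (commutant A)"
      proof (rule commutantI)
        show "x \<in> bounded_ops"
          using x by (rule M_bounded_ops)
        fix T \<xi> assume T: "T \<in> commutant A"
        have bo: "T \<in> bounded_ops" "x \<in> bounded_ops"
          using T x by (auto simp: commutant_bounded_ops M_bounded_ops)
        have "adj T \<in> commutant A"
          using T A by (intro commutant_adj) (auto simp: Sub_def von_neumann_algebra_def)
        then have key': "adj T (p (adj x (q \<xi>))) = p (adj x (q (adj T \<xi>)))" for \<xi>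
          using x by (intro key M_adj)
        have lower: "T (q (x (p \<xi>))) = q (x (p (T \<xi>)))" for \<xi>
        proof (rule cinner_extensional)
          fix \<zeta>
          have adjs: "cinner \<eta> (q (x (p \<eta>'))) = cinner (p (adj x (q \<eta>))) \<eta>'" for \<eta> \<eta>'
            using bo pq by (metis cinner_adj cinner_adj' Pq(11,12))
          have "cinner \<zeta> (T (q (x (p \<xi>)))) = cinner (p (adj x (q (adj T \<zeta>)))) \<xi>"
            by (simp add: cinner_adj'[OF bo(1), symmetric] adjs)
          also have "\<dots> = cinner \<zeta> (q (x (p (T \<xi>))))"
            by (simp add: key'[symmetric] cinner_adj'[OF bo(1)] adjs)
          finally show "cinner \<zeta> (T (q (x (p \<xi>)))) = cinner \<zeta> (q (x (p (T \<xi>))))" .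
        qed
        have "(p o\<^sub>L x o\<^sub>L p) + (q o\<^sub>L x o\<^sub>L q) \<in> relcomm u"
          using x by (auto simp: relcomm_def Pq blinfun.bilinear_simps intro!: M_closed pq)
        then have diag: "T (((p o\<^sub>L x o\<^sub>L p) + (q o\<^sub>L x o\<^sub>L q)) \<xi>) = ((p o\<^sub>L x o\<^sub>L p) + (q o\<^sub>L x o\<^sub>L q)) (T \<xi>)" for \<xi>
          using N_A by (intro commutantD[OF T]) auto
        have split: "x \<xi> = ((p o\<^sub>L x o\<^sub>L p) + (q o\<^sub>L x o\<^sub>L q)) \<xi> + p (x (q \<xi>)) + q (x (p \<xi>))" for \<xi>
        proof -
          have "x \<xi> = x (p \<xi>) + x (q \<xi>)"
            by (simp flip: blinfun.add_right add: Pq)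
          also have "\<dots> = (p (x (p \<xi>)) + q (x (p \<xi>))) + (p (x (q \<xi>)) + q (x (q \<xi>)))"
            by (simp only: Pq)
          finally show ?thesis
            by (simp add: blinfun.add_left)
        qed
        have "T (x \<xi>) = x (T \<xi>)"
          unfolding split[of \<xi>] split[of "T \<xi>"]
          by (simp only: blinfun.add_right diag key[OF T x] lower)
        then show "x (T \<xi>) = T (x \<xi>)" ..
      qed
      then show ?thesis
        using A by (simp add: Sub_def von_neumann_algebra_def)
    qed
    then show False
      using \<open>A \<noteq> M\<close> A_closed(5) by blast
  qed
qed


section \<open>Convergence of relative commutants\<close>

lemma strong_convergence_products:
  fixes u :: "'a ell2 \<Rightarrow>\<^sub>L 'a ell2" and v :: "nat \<Rightarrow> 'a ell2 \<Rightarrow>\<^sub>L 'a ell2"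
  assumes v: "\<And>n. norm (v n) \<le> 1" "\<And>\<xi>. (\<lambda>n. v n \<xi>) \<longlonglongrightarrow> u \<xi>" and \<eta>: "\<eta> \<longlonglongrightarrow> \<eta>'"
  shows "(\<lambda>n. v n (\<eta> n)) \<longlonglongrightarrow> u \<eta>'"
proof -
  have "(\<lambda>n. v n (\<eta> n - \<eta>')) \<longlonglongrightarrow> 0"
  proof (rule Lim_null_comparison)
    show "\<forall>\<^sub>F n in sequentially. norm (v n (\<eta> n - \<eta>')) \<le> norm (\<eta> n - \<eta>')"
    proof (intro always_eventually allI)
      fix n
      show "norm (v n (\<eta> n - \<eta>')) \<le> norm (\<eta> n - \<eta>')"
        using norm_blinfun[of "v n" "\<eta> n - \<eta>'"]
          mult_right_mono[OF v(1)[of n] norm_ge_zero[of "\<eta> n - \<eta>'"]] by simp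
    qed
    show "(\<lambda>n. norm (\<eta> n - \<eta>')) \<longlonglongrightarrow> 0"
      using \<eta> by (simp add: tendsto_norm_zero_iff LIM_zero_iff)
  qed
  from tendsto_add[OF this v(2)[of \<eta>']] show ?thesis
    by (simp add: blinfun.diff_right)
qed

text \<open>Convergence at \<open>\<delta>\<^sub>1\<close> forces \<open>v\<^sub>n \<rightarrow> u\<close> strongly, hence \<open>v\<^sub>n x v\<^sub>n \<delta>\<^sub>1 \<rightarrow> u x u \<delta>\<^sub>1\<close>, and the
  conditional expectations are the means of \<open>x\<close> and these conjugates.\<close>

lemma relcomm_convergence:
  assumes u: "symmetry u" and v: "\<And>n. symmetry (v n)"
    and lim: "(\<lambda>n. v n (delta \<one>)) \<longlonglongrightarrow> u (delta \<one>)"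
    and U: "openin (effros_marechal M \<tau>) U" "relcomm u \<in> U"
  shows "\<forall>\<^sub>F n in sequentially. relcomm (v n) \<in> U"
  using U unfolding effros_marechal_def openin_topology_generated_by_iff
proof (induction rule: generate_topology_on.induct)
  case (Int a b)
  then show ?case
    by (auto elim: eventually_elim2)
next
  case (UN K)
  then obtain k where "k \<in> K" "\<forall>\<^sub>F n in sequentially. relcomm (v n) \<in> k"
    by auto
  then show ?case
    by (auto elim: eventually_mono)
next
  case (Basis s)
  then obtain x y r where s: "s = {N \<in> Sub M. L2_norm \<tau> (cond_exp M \<tau> N x - y) < r}"
    and x: "x \<in> M" and y: "y \<in> M" by auto
  have v_strong: "(\<lambda>n. v n \<xi>) \<longlonglongrightarrow> u \<xi>" for \<xi>
    by (rule M_strong_limitI[where C = 1]) (intro symmetryD(1) norm_symmetry_le u v lim)+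
  have eq: "L2_norm \<tau> (cond_exp M \<tau> (relcomm w) x - y) = norm (conj_mean w x (delta \<one>) - y (delta \<one>))"
    if "symmetry w" for w
    using x y conj_mean_in_M[OF that x] that
    by (simp add: cond_exp_relcomm L2_norm_eq M_closed blinfun.diff_left)
  have "(\<lambda>n. v n (x (v n (delta \<one>)))) \<longlonglongrightarrow> u (x (u (delta \<one>)))"
    by (rule strong_convergence_products[OF norm_symmetry_le[OF v] v_strong
          blinfun.tendsto[OF tendsto_const v_strong]])
  then have "(\<lambda>n. norm (conj_mean (v n) x (delta \<one>) - y (delta \<one>)))
      \<longlonglongrightarrow> norm (conj_mean u x (delta \<one>) - y (delta \<one>))"
    unfolding conj_mean_apply
    by (intro tendsto_norm tendsto_diff tendsto_scaleR tendsto_add tendsto_const)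
  moreover have "norm (conj_mean u x (delta \<one>) - y (delta \<one>)) < r"
    using Basis s eq[OF u] by auto
  ultimately have "\<forall>\<^sub>F n in sequentially. norm (conj_mean (v n) x (delta \<one>) - y (delta \<one>)) < r"
    by (rule order_tendstoD)
  then show ?case
    by (simp add: s eq v relcomm_Sub)
qed simp

definition conj_op :: "'a \<Rightarrow> ('a ell2 \<Rightarrow>\<^sub>L 'a ell2) \<Rightarrow> ('a ell2 \<Rightarrow>\<^sub>L 'a ell2)" where
  "conj_op g x = lam g o\<^sub>L x o\<^sub>L lam (inv g)"

lemma conj_op_apply [simp]: "conj_op g x \<xi> = lam g (x (lam (inv g) \<xi>))"
  by (simp add: conj_op_def)

lemma conj_op_in_M: "x \<in> M \<Longrightarrow> conj_op g x \<in> M"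
  unfolding conj_op_def by (intro M_closed lam_in_M)

lemma conj_op_symmetry:
  assumes u: "symmetry u"
  shows "symmetry (conj_op g u)"
proof (rule symmetryI)
  fix \<xi> \<eta>
  have "cinner (lam g \<xi>) \<eta> = cinner \<xi> (lam (inv g) \<eta>)" for g \<xi> \<eta>
    using cinner_adj[OF lam_bounded_ops] by simp
  then show "cinner (conj_op g u \<xi>) \<eta> = cinner \<xi> (conj_op g u \<eta>)"
    by (simp add: symmetryD[OF u])
qed (simp_all add: conj_op_in_M symmetryD[OF u])

lemma conj_subalgebra_relcomm: "conj_subalgebra G g (relcomm u) = relcomm (conj_op g u)"
proof -
  have eq: "conj_subalgebra G g (relcomm u) = conj_op g ` relcomm u"
    by (simp add: conj_subalgebra_def conj_op_def)
  have sub: "conj_op g x \<in> relcomm (conj_op g u)" if "x \<in> relcomm u" for g x u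
    using that by (simp add: relcomm_def conj_op_in_M)
  have inverse: "conj_op g (conj_op (inv g) x) = x" "conj_op (inv g) (conj_op g x) = x" for x
    by (rule blinfun_eqI, simp)+
  show ?thesis
    unfolding eq
  proof (intro equalityI subsetI)
    fix y assume "y \<in> relcomm (conj_op g u)"
    then have "conj_op (inv g) y \<in> relcomm u"
      using sub[of y "conj_op g u" "inv g"] inverse by simp
    then show "y \<in> conj_op g ` relcomm u"
      using inverse(1)[of y] by (metis imageI)
  qed (use sub in auto)
qed

lemma not_isolated_relcomm:
  assumes u: "symmetry u" and lim: "(\<lambda>n. conj_op (g n) u (delta \<one>)) \<longlonglongrightarrow> u (delta \<one>)"
    and ne: "\<And>n. relcomm (conj_op (g n) u) \<noteq> relcomm u"
  shows "\<not> isolated_in_topology (effros_marechal M \<tau>) (relcomm u)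
    (effros_marechal M \<tau> closure_of {conj_subalgebra G g (relcomm u) | g. g \<in> carrier G})"
    (is "\<not> isolated_in_topology ?X ?N (?X closure_of ?S)")
proof
  assume "isolated_in_topology ?X ?N (?X closure_of ?S)"
  then obtain U where U: "openin ?X U" "U \<inter> ?X closure_of ?S = {?N}"
    by (auto simp: isolated_in_topology_def)
  have "\<forall>\<^sub>F n in sequentially. relcomm (conj_op (g n) u) \<in> U"
    using U by (intro relcomm_convergence[OF u _ lim]) (auto simp: conj_op_symmetry u)
  then obtain n where n: "relcomm (conj_op (g n) u) \<in> U"
    using eventually_happens'[OF sequentially_bot] by blast
  then have "relcomm (conj_op (g n) u) \<in> topspace ?X"
    using openin_subset[OF U(1)] by blast
  moreover have "relcomm (conj_op (g n) u) \<in> ?S"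
    by (auto simp: conj_subalgebra_relcomm)
  ultimately have "relcomm (conj_op (g n) u) \<in> ?X closure_of ?S"
    by (auto simp: in_closure_of)
  then show False
    using U n ne by blast
qed

end


context discrete_group
begin

section \<open>Averages over finite subgroups\<close>

definition avg :: "'a set \<Rightarrow> 'a ell2 \<Rightarrow>\<^sub>L 'a ell2" where
  "avg H = (1 / real (card H)) *\<^sub>R (\<Sum>h\<in>H. lam h)"

lemma avg_apply: "avg H \<xi> = (1 / real (card H)) *\<^sub>R (\<Sum>h\<in>H. lam h \<xi>)"
  by (simp add: avg_def blinfun.bilinear_simps blinfun.sum_left)

lemma avg_in_M: "avg H \<in> M"
proof -
  have "(0 :: 'a ell2 \<Rightarrow>\<^sub>L 'a ell2) \<in> M"
    using M_closed(3)[OF lam_in_M lam_in_M] by (metis diff_self)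
  then have "(\<Sum>h\<in>H. lam h) \<in> M"
    by (induction H rule: infinite_finite_induct) (auto intro: M_closed lam_in_M)
  then show ?thesis
    unfolding avg_def by (rule M_closed)
qed

lemma lam_avg_commute:
  assumes "finite H" "\<And>h. h \<in> H \<Longrightarrow> g \<otimes> h \<otimes> inv g \<in> H"
  shows "lam g (avg H \<xi>) = avg H (lam g \<xi>)"
proof -
  have inj: "inj_on (\<lambda>h. g \<otimes> h \<otimes> inv g) H"
    by (rule inj_onI) simp
  have bij: "bij_betw (\<lambda>h. g \<otimes> h \<otimes> inv g) H H"
    using inj endo_inj_surj[OF assms(1) _ inj] assms(2) by (auto simp: bij_betw_def)
  have "(\<Sum>h\<in>H. lam h (lam g \<xi>)) = (\<Sum>h\<in>H. lam (g \<otimes> h \<otimes> inv g) (lam g \<xi>))"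
    by (rule sum.reindex_bij_betw[OF bij, symmetric])
  also have "\<dots> = lam g (\<Sum>h\<in>H. lam h \<xi>)"
    by (simp add: blinfun.sum_right m_assoc)
  finally show ?thesis
    by (simp add: avg_apply blinfun.scaleR_right)
qed

lemma lam_avg_absorb:
  assumes "finite H" "subgroup H G" "h \<in> H"
  shows "lam h (avg H \<xi>) = avg H \<xi>" "avg H (lam h \<xi>) = avg H \<xi>"
proof -
  have inj: "inj_on (\<lambda>k. h \<otimes> k) H"
    by (rule inj_onI) simp
  have bij: "bij_betw (\<lambda>k. h \<otimes> k) H H"
    using inj endo_inj_surj[OF assms(1) _ inj] subgroup.m_closed[OF assms(2,3)] by (auto simp: bij_betw_def)
  have "(\<Sum>k\<in>H. lam (h \<otimes> k) \<xi>) = (\<Sum>k\<in>H. lam k \<xi>)"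
    using sum.reindex_bij_betw[OF bij, of "\<lambda>k. lam k \<xi>"] .
  then show *: "lam h (avg H \<xi>) = avg H \<xi>"
    by (simp add: avg_apply blinfun.scaleR_right blinfun.sum_right)
  have "lam h (avg H \<xi>) = avg H (lam h \<xi>)"
    using assms by (intro lam_avg_commute) (auto intro: subgroup.m_closed subgroup.m_inv_closed)
  then show "avg H (lam h \<xi>) = avg H \<xi>"
    using * by simp
qed

lemma avg_avg:
  assumes "finite K" "subgroup K G" "subgroup H G" "H \<subseteq> K"
  shows "avg H (avg K \<xi>) = avg K \<xi>" "avg K (avg H \<xi>) = avg K \<xi>"
proof -
  have H: "finite H" "card H \<noteq> 0"
    using finite_subset[OF assms(4,1)] subgroup.one_closed[OF assms(3)] by (auto simp: card_eq_0_iff)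
  have *: "lam h (avg K \<xi>) = avg K \<xi>" "avg K (lam h \<xi>) = avg K \<xi>" if "h \<in> H" for h
    using lam_avg_absorb[of K h] assms that by auto
  show "avg H (avg K \<xi>) = avg K \<xi>"
    using H by (simp add: avg_apply[of H] * sum_constant_scaleR)
  show "avg K (avg H \<xi>) = avg K \<xi>"
    using H by (simp add: avg_apply[of H] blinfun.scaleR_right blinfun.sum_right * sum_constant_scaleR)
qed

lemma avg_self_adjoint:
  assumes "finite H" "subgroup H G"
  shows "cinner (avg H \<xi>) \<eta> = cinner \<xi> (avg H \<eta>)"
proof -
  have lam: "cinner (lam h \<xi>) \<eta> = cinner \<xi> (lam (inv h) \<eta>)" for h
    using cinner_adj[OF lam_bounded_ops] by simp
  have bij: "bij_betw (\<lambda>h. inv h) H H"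
    using assms by (intro bij_betw_byWitness[where f' = "\<lambda>h. inv h"])
      (auto intro: subgroup.m_inv_closed)
  have "(\<Sum>h\<in>H. cinner \<xi> (lam (inv h) \<eta>)) = (\<Sum>h\<in>H. cinner \<xi> (lam h \<eta>))"
    by (rule sum.reindex_bij_betw[OF bij])
  then show ?thesis
    by (simp add: avg_apply cinner.scaleR_left cinner.scaleR_right cinner.sum_left cinner.sum_right lam)
qed

lemma avg_delta_one:
  assumes "finite H"
  shows "avg H (delta \<one>) = (\<Sum>h\<in>H. scaleC (1 / of_nat (card H)) (delta h))"
  by (simp add: avg_apply lam_delta scaleR_eq_scaleC scaleC.sum_right)

lemma norm_avg_delta_one:
  assumes "finite H" "H \<noteq> {}"
  shows "norm (avg H (delta \<one>)) = 1 / sqrt (card H)"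
proof -
  have "card H > 0"
    using assms by (simp add: card_gt_0_iff)
  have "(norm (avg H (delta \<one>)))\<^sup>2 = (\<Sum>h\<in>H. (norm (1 / complex_of_nat (card H)))\<^sup>2)"
    unfolding avg_delta_one[OF assms(1)] by (rule norm_finite_combination[OF assms(1)])
  also have "\<dots> = 1 / card H"
    using \<open>card H > 0\<close> by (simp add: norm_divide power2_eq_square)
  finally show ?thesis
    by (metis norm_ge_zero real_sqrt_divide real_sqrt_one real_sqrt_unique)
qed

text \<open>For finite subgroups \<open>H\<close> and \<open>K\<close> with averages \<open>e\<^sub>H\<close> and \<open>e\<^sub>K\<close>, the coefficient of \<open>e\<^sub>H e\<^sub>K \<delta>\<^sub>1\<close>
  at \<open>x\<close> is nonzero exactly when \<open>x\<close> lies in \<open>HK\<close>. The averages over \<open>K\<close> and \<open>gKg\<^sup>-\<^sup>1\<close> thus fail to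
  commute as soon as some element \<open>k gk'g\<^sup>-\<^sup>1\<close> of \<open>K gKg\<^sup>-\<^sup>1\<close> is not in \<open>gKg\<^sup>-\<^sup>1 K\<close>.\<close>

lemma avg_not_commute:
  assumes K: "finite K" and k: "k \<in> K" "k' \<in> K"
    and avoid: "\<And>h. h \<in> K \<Longrightarrow> g \<otimes> h \<otimes> inv g \<otimes> k \<otimes> g \<otimes> k' \<otimes> inv g \<notin> K"
    and inv_closed: "\<And>h. h \<in> K \<Longrightarrow> inv h \<in> K"
  shows "\<exists>\<xi>. conj_op g (avg K) (avg K \<xi>) \<noteq> avg K (conj_op g (avg K) \<xi>)"
proof -
  define c where "c = (1 / card K :: real)"
  have c: "c > 0"
    using K k by (auto simp: c_def card_gt_0_iff)
  define x where "x = k \<otimes> g \<otimes> k' \<otimes> inv g"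
  have Rep_avg: "Rep_ell2 (avg K \<xi>) y = of_real c * (\<Sum>h\<in>K. Rep_ell2 \<xi> (inv h \<otimes> y))" for \<xi> y
    by (simp add: avg_apply c_def Rep_lam)
  have Rep_avg_delta: "Rep_ell2 (avg K (delta \<one>)) y = (if y \<in> K then of_real c else 0)" for y
    using K by (simp add: avg_delta_one c_def delta.rep_eq if_distrib sum.delta' cong: if_cong)
  have Rep_conj_delta: "Rep_ell2 (conj_op g (avg K) (delta \<one>)) y = (if inv g \<otimes> y \<otimes> g \<in> K then of_real c else 0)" for y
  proof -
    have "Rep_ell2 (conj_op g (avg K) (delta \<one>)) y = Rep_ell2 (avg K (delta (inv g))) (inv g \<otimes> y)"
      by (simp add: lam_delta Rep_lam)
    also have "\<dots> = Rep_ell2 (avg K (delta \<one>)) (inv g \<otimes> y \<otimes> g)"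
      by (subst M_delta[OF avg_in_M]) (simp add: Rep_rho)
    finally show ?thesis
      by (simp add: Rep_avg_delta)
  qed
  have "Rep_ell2 (conj_op g (avg K) (avg K (delta \<one>))) x = 0"
  proof -
    have "g \<otimes> (inv h \<otimes> (inv g \<otimes> x)) \<notin> K" if "h \<in> K" for h
      using avoid[OF inv_closed[OF that]] by (simp add: x_def m_assoc)
    then show ?thesis
      by (simp add: Rep_lam Rep_avg[of "lam (inv g) _"] Rep_avg_delta)
  qed
  moreover have "Rep_ell2 (avg K (conj_op g (avg K) (delta \<one>))) x \<noteq> 0"
  proof -
    define S where "S = (\<Sum>h\<in>K. if inv g \<otimes> (inv h \<otimes> x) \<otimes> g \<in> K then c else 0)"
    have "inv g \<otimes> (inv k \<otimes> x) \<otimes> g = k'"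
      by (simp add: x_def m_assoc inv_solve_left')
    moreover have "inv g \<otimes> (inv k \<otimes> x) \<otimes> g \<in> K"
      using calculation k by simp
    ultimately have "S > 0"
      unfolding S_def using K k c by (intro sum_pos2[of K k]) auto
    moreover have "Rep_ell2 (avg K (conj_op g (avg K) (delta \<one>))) x = of_real (c * S)"
      unfolding Rep_avg[of "conj_op g (avg K) (delta \<one>)"] Rep_conj_delta S_def
      by (simp add: if_distrib cong: if_cong)
    ultimately show ?thesis
      using c by simp
  qed
  ultimately show ?thesis
    by metis
qed

end


section \<open>Infinite products of commuting symmetries\<close>

text \<open>For commuting projections \<open>e\<^sub>n\<close> with \<open>\<Sum>\<^sub>n \<parallel>e\<^sub>n \<delta>\<^sub>1\<parallel> < \<infinity>\<close> the partial products of the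
  symmetries \<open>1 - 2 e\<^sub>n\<close> form a Cauchy sequence at \<open>\<delta>\<^sub>1\<close>, so they converge strongly; the limit \<open>u\<close>
  is again a symmetry, in general with infinite support on the group.\<close>

locale projection_sequence = discrete_group G for G :: "('a, 'b) monoid_scheme" (structure) +
  fixes e :: "nat \<Rightarrow> 'a ell2 \<Rightarrow>\<^sub>L 'a ell2"
  assumes e_M: "e n \<in> M"
    and e_adj: "cinner (e n \<xi>) \<eta> = cinner \<xi> (e n \<eta>)"
    and e_idem: "e n (e n \<xi>) = e n \<xi>"
    and e_comm: "e m (e n \<xi>) = e n (e m \<xi>)"
    and e_small: "norm (e n (delta \<one>)) \<le> (1/2) ^ n"
begin

primrec U :: "nat \<Rightarrow> 'a ell2 \<Rightarrow>\<^sub>L 'a ell2" where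
  "U 0 = id_blinfun"
| "U (Suc n) = U n o\<^sub>L (id_blinfun - 2 *\<^sub>R e n)"

lemma U_Suc: "U (Suc n) \<xi> = U n (\<xi> - 2 *\<^sub>R e n \<xi>)"
  by (simp add: blinfun.diff_left blinfun.scaleR_left)

lemma U_commute:
  fixes A :: "'a ell2 \<Rightarrow>\<^sub>L 'a ell2"
  assumes "\<And>k \<xi>. k < n \<Longrightarrow> A (e k \<xi>) = e k (A \<xi>)"
  shows "A (U n \<xi>) = U n (A \<xi>)"
  using assms
proof (induction n arbitrary: \<xi>)
  case (Suc n)
  then show ?case
    unfolding U_Suc by (simp add: blinfun.diff_right blinfun.scaleR_right)
qed simp

lemma symmetry_U: "symmetry (U n)"
proof (induction n)
  case 0
  show ?case
    by (rule symmetryI) (auto intro: M_closed)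
next
  case (Suc n)
  note D = symmetryD[OF Suc]
  have comm: "e n (U n \<xi>) = U n (e n \<xi>)" for \<xi>
    by (rule U_commute) (rule e_comm)
  show ?case
  proof (rule symmetryI)
    show "U (Suc n) \<in> M"
      unfolding U.simps by (intro M_closed D e_M)
    show "cinner (U (Suc n) \<xi>) \<eta> = cinner \<xi> (U (Suc n) \<eta>)" for \<xi> \<eta>
      unfolding U_Suc by (simp add: D blinfun.bilinear_simps cinner.diff_left cinner.diff_right
          cinner.scaleR_left cinner.scaleR_right e_adj comm)
    show "U (Suc n) (U (Suc n) \<xi>) = \<xi>" for \<xi>
      unfolding U_Suc by (simp add: D blinfun.bilinear_simps comm e_idem scaleR_2 flip: D(4))
  qed
qed

lemma norm_U_le: "norm (U n \<xi>) \<le> norm \<xi>"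
  using norm_blinfun[of "U n" \<xi>] mult_right_mono[OF norm_symmetry_le[OF symmetry_U] norm_ge_zero]
  by (metis mult_1 order_trans)

lemma U_increment: "norm (U (n + k) (delta \<one>) - U n (delta \<one>)) \<le> 4 * (1/2) ^ n - 4 * (1/2) ^ (n + k)"
proof (induction k)
  case (Suc k)
  have "U (n + Suc k) (delta \<one>) - U (n + k) (delta \<one>) = - 2 *\<^sub>R U (n + k) (e (n + k) (delta \<one>))"
    unfolding add_Suc_right U_Suc by (simp add: blinfun.bilinear_simps)
  then have "norm (U (n + Suc k) (delta \<one>) - U (n + k) (delta \<one>)) \<le> 2 * (1/2) ^ (n + k)"
    using norm_U_le[of "n + k" "e (n + k) (delta \<one>)"] e_small[of "n + k"] by simp
  then show ?case
    using Suc norm_triangle_ineq[of "U (n + Suc k) (delta \<one>) - U (n + k) (delta \<one>)" "U (n + k) (delta \<one>) - U n (delta \<one>)"]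
    by simp
qed simp

lemma U_strongly_convergent: "\<exists>T\<in>M. \<forall>\<xi>. (\<lambda>n. U n \<xi>) \<longlonglongrightarrow> T \<xi>"
proof (rule M_strong_limit_exists)
  show "convergent (\<lambda>n. U n (delta \<one>))"
  proof (rule Cauchy_convergent, rule metric_CauchyI)
    fix \<epsilon> :: real assume "\<epsilon> > 0"
    then obtain N where N: "(1/2) ^ N < \<epsilon> / 8"
      using real_arch_pow_inv[of "\<epsilon> / 8" "1/2"] by auto
    have close: "dist (U n (delta \<one>)) (U N (delta \<one>)) < \<epsilon> / 2" if "n \<ge> N" for n
    proof -
      have "0 \<le> (1/2 :: real) ^ n"
        by simp
      then show ?thesis
        using U_increment[of N "n - N"] that N unfolding le_add_diff_inverse[OF that] dist_norm
        by linarith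
    qed
    have "dist (U m (delta \<one>)) (U n (delta \<one>)) < \<epsilon>" if "m \<ge> N" "n \<ge> N" for m n
      using close[OF that(1)] close[OF that(2)]
      by (rule dist_triangle_half_l[of _ "U N (delta \<one>)"])
    then show "\<exists>N. \<forall>m\<ge>N. \<forall>n\<ge>N. dist (U m (delta \<one>)) (U n (delta \<one>)) < \<epsilon>"
      by blast
  qed
qed (rule symmetryD(1)[OF symmetry_U] norm_symmetry_le[OF symmetry_U])+

definition u :: "'a ell2 \<Rightarrow>\<^sub>L 'a ell2" where
  "u = (SOME T. T \<in> M \<and> (\<forall>\<xi>. (\<lambda>n. U n \<xi>) \<longlonglongrightarrow> T \<xi>))"

lemma u_in_M: "u \<in> M" and U_tendsto: "(\<lambda>n. U n \<xi>) \<longlonglongrightarrow> u \<xi>"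
proof -
  have "u \<in> M \<and> (\<forall>\<xi>. (\<lambda>n. U n \<xi>) \<longlonglongrightarrow> u \<xi>)"
    unfolding u_def by (rule someI_ex) (use U_strongly_convergent in blast)
  then show "u \<in> M" "(\<lambda>n. U n \<xi>) \<longlonglongrightarrow> u \<xi>"
    by auto
qed

lemma symmetry_u: "symmetry u"
proof (rule symmetryI)
  fix \<xi> \<eta>
  have "(\<lambda>n. cinner (U n \<xi>) \<eta>) \<longlonglongrightarrow> cinner (u \<xi>) \<eta>" "(\<lambda>n. cinner \<xi> (U n \<eta>)) \<longlonglongrightarrow> cinner \<xi> (u \<eta>)"
    by (intro tendsto_cinner U_tendsto tendsto_const)+
  then show "cinner (u \<xi>) \<eta> = cinner \<xi> (u \<eta>)"
    by (simp add: symmetryD(4)[OF symmetry_U] LIMSEQ_unique)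
  have "(\<lambda>n. U n (U n \<xi>)) \<longlonglongrightarrow> u (u \<xi>)"
    by (rule strong_convergence_products[OF norm_symmetry_le[OF symmetry_U] U_tendsto U_tendsto])
  then show "u (u \<xi>) = \<xi>"
    by (simp add: symmetryD(3)[OF symmetry_U] LIMSEQ_const_iff)
qed (rule u_in_M)

lemma u_approximation: "norm (u (delta \<one>) - U n (delta \<one>)) \<le> 4 * (1/2) ^ n"
proof (rule LIMSEQ_le_const2)
  show "(\<lambda>k. norm (U k (delta \<one>) - U n (delta \<one>))) \<longlonglongrightarrow> norm (u (delta \<one>) - U n (delta \<one>))"
    by (intro tendsto_norm tendsto_diff U_tendsto tendsto_const)
  have "norm (U k (delta \<one>) - U n (delta \<one>)) \<le> 4 * (1/2) ^ n" if "k \<ge> n" for k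
  proof -
    have "0 \<le> (1/2 :: real) ^ k"
      by simp
    then show ?thesis
      using U_increment[of n "k - n"] that unfolding le_add_diff_inverse[OF that] by linarith
  qed
  then show "\<exists>N. \<forall>k\<ge>N. norm (U k (delta \<one>) - U n (delta \<one>)) \<le> 4 * (1/2) ^ n"
    by blast
qed

lemma e_in_relcomm: "e n \<in> relcomm u"
proof -
  have "e n (u \<xi>) = u (e n \<xi>)" for \<xi>
  proof (rule LIMSEQ_unique)
    show "(\<lambda>k. e n (U k \<xi>)) \<longlonglongrightarrow> e n (u \<xi>)"
      by (rule blinfun.tendsto[OF tendsto_const U_tendsto])
    show "(\<lambda>k. e n (U k \<xi>)) \<longlonglongrightarrow> u (e n \<xi>)"
      using U_tendsto[of "e n \<xi>"] by (simp add: U_commute[of _ "e n"] e_comm[of n])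
  qed
  then show ?thesis
    by (simp add: relcomm_def e_M)
qed

text \<open>Removing the factor \<open>1 - 2 e\<^sub>m\<close> from \<open>u\<close> leaves a product of the other factors,
  with which \<open>A\<close> commutes.\<close>

lemma commute_single_factor:
  fixes A :: "'a ell2 \<Rightarrow>\<^sub>L 'a ell2"
  assumes others: "\<And>k \<xi>. k \<noteq> m \<Longrightarrow> A (e k \<xi>) = e k (A \<xi>)" and u: "\<And>\<xi>. A (u \<xi>) = u (A \<xi>)"
  shows "A (e m \<xi>) = e m (A \<xi>)"
proof -
  define f where "f = id_blinfun - 2 *\<^sub>R e m"
  have f: "f \<xi> = \<xi> - 2 *\<^sub>R e m \<xi>" for \<xi>
    by (simp add: f_def blinfun.diff_left blinfun.scaleR_left)
  have ff: "f (f \<xi>) = \<xi>" for \<xi>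
    by (simp add: f blinfun.bilinear_simps e_idem scaleR_2)
  have fe: "f (e k \<xi>) = e k (f \<xi>)" for k \<xi>
    by (simp add: f blinfun.bilinear_simps e_comm[of m k])
  have "A (U (Suc m + k) (f \<xi>)) = U (Suc m + k) (f (A \<xi>))" for k \<xi>
  proof (induction k arbitrary: \<xi>)
    case 0
    have "U (Suc m) (f \<xi>) = U m \<xi>" for \<xi>
      unfolding U_Suc f[symmetric] ff ..
    then show ?case
      using U_commute[of m A \<xi>] others by simp
  next
    case (Suc k)
    let ?n = "Suc m + k"
    have *: "U (Suc ?n) (f \<xi>) = U ?n (f (\<xi> - 2 *\<^sub>R e ?n \<xi>))" for \<xi>
      unfolding U_Suc by (simp add: blinfun.diff_right[of f] blinfun.scaleR_right[of f] fe)
    have "A (\<xi> - 2 *\<^sub>R e ?n \<xi>) = A \<xi> - 2 *\<^sub>R e ?n (A \<xi>)"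
      using others[of ?n] by (simp add: blinfun.bilinear_simps)
    then show ?case
      unfolding add_Suc_right * Suc by simp
  qed
  then have *: "(\<lambda>k. A (U (k + Suc m) (f \<xi>))) = (\<lambda>k. U (k + Suc m) (f (A \<xi>)))" for \<xi>
    by (simp add: add.commute)
  have "A (u (f \<xi>)) = u (f (A \<xi>))" for \<xi>
  proof (rule LIMSEQ_unique)
    show "(\<lambda>k. A (U (k + Suc m) (f \<xi>))) \<longlonglongrightarrow> A (u (f \<xi>))"
      by (rule blinfun.tendsto[OF tendsto_const LIMSEQ_ignore_initial_segment[OF U_tendsto]])
    show "(\<lambda>k. A (U (k + Suc m) (f \<xi>))) \<longlonglongrightarrow> u (f (A \<xi>))"
      unfolding * by (rule LIMSEQ_ignore_initial_segment[OF U_tendsto])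
  qed
  then have "u (A (f \<xi>)) = u (f (A \<xi>))"
    by (simp add: u)
  then have "A (f \<xi>) = f (A \<xi>)"
    by (metis symmetryD(3)[OF symmetry_u])
  then show ?thesis
    by (simp add: f blinfun.bilinear_simps)
qed

text \<open>If \<open>\<lambda>\<^bsub>g n\<^esub>\<close> moves \<open>e\<^sub>n\<close> only, then conjugation by it changes \<open>u\<close> only in its \<open>n\<close>-th
  factor, which becomes negligible as \<open>n\<close> grows but does change the relative commutant.\<close>

context
  fixes g :: "nat \<Rightarrow> 'a"
  assumes g_comm: "\<And>n k \<xi>. k \<noteq> n \<Longrightarrow> lam (g n) (e k \<xi>) = e k (lam (g n) \<xi>)"
    and g_not_comm: "\<And>n. \<exists>\<xi>. conj_op (g n) (e n) (e n \<xi>) \<noteq> e n (conj_op (g n) (e n) \<xi>)"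
begin

lemma conj_u_tendsto: "(\<lambda>n. conj_op (g n) u (delta \<one>)) \<longlonglongrightarrow> u (delta \<one>)"
proof (rule LIM_zero_cancel, rule Lim_null_comparison)
  have "norm (conj_op (g n) u (delta \<one>) - u (delta \<one>)) \<le> 8 * (1/2) ^ n" for n
  proof -
    have "lam (g n) (U n \<xi>) = U n (lam (g n) \<xi>)" for \<xi>
      by (rule U_commute) (simp add: g_comm)
    then have "conj_op (g n) u (delta \<one>) - u (delta \<one>)
        = lam (g n) ((u - U n) (delta (inv (g n)))) - (u - U n) (delta \<one>)"
      by (simp add: blinfun.bilinear_simps lam_delta)
    also have "norm \<dots> \<le> norm ((u - U n) (delta (inv (g n)))) + norm ((u - U n) (delta \<one>))"
      by (rule order_trans[OF norm_triangle_ineq4]) simp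
    also have "norm ((u - U n) (delta (inv (g n)))) = norm ((u - U n) (delta \<one>))"
      by (subst M_delta[OF M_closed(3)[OF u_in_M symmetryD(1)[OF symmetry_U]]]) simp
    finally show ?thesis
      using u_approximation[of n] by (simp add: blinfun.diff_left)
  qed
  then show "\<forall>\<^sub>F n in sequentially. norm (conj_op (g n) u (delta \<one>) - u (delta \<one>)) \<le> 8 * (1/2) ^ n"
    by simp
  show "(\<lambda>n. 8 * (1/2) ^ n :: real) \<longlonglongrightarrow> 0"
    by (intro tendsto_mult_right_zero LIMSEQ_realpow_zero) auto
qed

lemma conj_e_not_in_relcomm: "conj_op (g n) (e n) \<notin> relcomm u"
proof
  assume "conj_op (g n) (e n) \<in> relcomm u"
  then have comm_u: "conj_op (g n) (e n) (u \<xi>) = u (conj_op (g n) (e n) \<xi>)" for \<xi>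
    by (simp only: relcomm_def mem_Collect_eq)
  have others: "conj_op (g n) (e n) (e k \<xi>) = e k (conj_op (g n) (e n) \<xi>)" if "k \<noteq> n" for k \<xi>
  proof -
    have "lam (inv (g n)) (e k \<xi>) = lam (inv (g n)) (e k (lam (g n) (lam (inv (g n)) \<xi>)))"
      by simp
    also have "\<dots> = e k (lam (inv (g n)) \<xi>)"
      by (simp add: g_comm[OF that, symmetric] del: lam_lam) simp
    finally show ?thesis
      by (simp add: e_comm[of n k] g_comm[OF that])
  qed
  show False
    using g_not_comm[of n] commute_single_factor[OF others comm_u] by blast
qed

lemma relcomm_conj_u_ne: "relcomm (conj_op (g n) u) \<noteq> relcomm u"
proof -
  have "conj_op (g n) (e n) \<in> relcomm (conj_op (g n) u)"
    using e_in_relcomm[of n] by (simp add: relcomm_def conj_op_in_M)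
  then show ?thesis
    using conj_e_not_in_relcomm by blast
qed

lemma relcomm_u_properties:
  assumes "spreading s"
  shows "relcomm u \<in> Sub M" "pimsner_popa_index M \<tau> (relcomm u) = 2" "maximal_subalgebra M (relcomm u)"
    "\<not> isolated_in_topology (effros_marechal M \<tau>) (relcomm u)
      (effros_marechal M \<tau> closure_of {conj_subalgebra G g (relcomm u) | g. g \<in> carrier G})"
proof -
  have "relcomm u \<noteq> M"
    using conj_e_not_in_relcomm conj_op_in_M[OF e_M] by blast
  then show "relcomm u \<in> Sub M" "pimsner_popa_index M \<tau> (relcomm u) = 2" "maximal_subalgebra M (relcomm u)"
    using symmetry_u assms by (auto intro: relcomm_Sub index_relcomm maximal_relcomm)
  show "\<not> isolated_in_topology (effros_marechal M \<tau>) (relcomm u)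
      (effros_marechal M \<tau> closure_of {conj_subalgebra G g (relcomm u) | g. g \<in> carrier G})"
    using symmetry_u conj_u_tendsto relcomm_conj_u_ne by (rule not_isolated_relcomm)
qed

end

end


section \<open>The group of finitary permutations extended by the translation\<close>

text \<open>\<open>\<Gamma>\<close> acts faithfully on the integers, the generator of \<open>\<int>\<close> by translation. All computations
  in \<open>\<Gamma>\<close> are carried out through this action.\<close>

definition act :: "int perm \<times> int \<Rightarrow> int \<Rightarrow> int" where
  "act g x = apply (fst g) (x + snd g)"

interpretation Gam: discrete_group Gamma_grp
  by (intro discrete_group.intro discrete_group_axioms.intro group_Gamma_grp carrier_Gamma_grp)

lemma Sym_fin_simps: "carrier Sym_fin = UNIV" "\<sigma> \<otimes>\<^bsub>Sym_fin\<^esub> \<rho> = \<sigma> * \<rho>"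
  by (simp_all add: Sym_fin_def)

lemma apply_theta: "apply (theta \<sigma>) x = apply \<sigma> (x - 1) + 1"
  by (simp add: theta.rep_eq)

lemma apply_theta_int_pow:
  "apply ((theta [^]\<^bsub>AutoGroup Sym_fin\<^esub> (m :: int)) \<sigma>) x = apply \<sigma> (x - m) + m"
proof -
  interpret A: group "AutoGroup Sym_fin"
    by (rule group.AutoGroup[OF group_Sym_fin])
  define p where "p m = theta [^]\<^bsub>AutoGroup Sym_fin\<^esub> m" for m :: int
  have p: "p m \<in> carrier (AutoGroup Sym_fin)" for m
    unfolding p_def using theta_in_AutoGroup by simp
  have Suc: "p (m + 1) \<sigma> = p m (theta \<sigma>)" for m \<sigma>
  proof -
    have "p (m + 1) = p m \<otimes>\<^bsub>AutoGroup Sym_fin\<^esub> theta"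
      using A.int_pow_mult[OF theta_in_AutoGroup, of m 1] theta_in_AutoGroup by (simp add: p_def)
    then show ?thesis
      by (simp add: AutoGroup_mult_apply[OF p theta_in_AutoGroup] Sym_fin_simps)
  qed
  have "surj theta"
    using theta_in_AutoGroup by (auto simp: AutoGroup_def auto_def Bij_def bij_betw_def Sym_fin_def)
  have "apply (p m \<sigma>) x = apply \<sigma> (x - m) + m"
  proof (induction m arbitrary: \<sigma> x rule: int_induct[where k = 0])
    case base
    have "p 0 \<sigma> = \<sigma>"
      by (simp add: p_def AutoGroup_def BijGroup_def Sym_fin_def)
    then show ?case
      by simp
  next
    case (step1 i)
    show ?case
      unfolding Suc step1(2) apply_theta by (simp add: algebra_simps)
  next
    case (step2 i)
    obtain \<rho> where \<rho>: "\<sigma> = theta \<rho>"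
      using \<open>surj theta\<close> by (metis surjD)
    have "p (i - 1) \<sigma> = p i \<rho>"
      using Suc[of "i - 1" \<rho>] \<rho> by simp
    then show ?case
      using step2 by (simp add: \<rho> apply_theta algebra_simps)
  qed
  then show ?thesis
    by (simp add: p_def)
qed

lemma act_mult [simp]: "act (g \<otimes>\<^bsub>Gamma_grp\<^esub> h) x = act g (act h x)"
  by (simp add: act_def Gamma_grp_def semidirect_int_def Sym_fin_simps split_beta apply_times
      apply_theta_int_pow algebra_simps)

lemma snd_mult [simp]: "snd (g \<otimes>\<^bsub>Gamma_grp\<^esub> h) = snd g + snd h"
  by (simp add: Gamma_grp_def semidirect_int_def split_beta)

lemma one_Gamma: "\<one>\<^bsub>Gamma_grp\<^esub> = (1, 0)"
  by (simp add: Gamma_grp_def semidirect_int_def Sym_fin_def)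

lemma act_one [simp]: "act \<one>\<^bsub>Gamma_grp\<^esub> x = x"
  by (simp add: one_Gamma act_def)

lemma act_inv [simp]: "act (inv\<^bsub>Gamma_grp\<^esub> g) (act g x) = x" "act g (act (inv\<^bsub>Gamma_grp\<^esub> g) x) = x"
  by (simp_all flip: act_mult)

lemma act_eq_iff [simp]: "act g x = act g y \<longleftrightarrow> x = y"
  by (metis act_inv(1))

lemma bij_act: "bij (act g)"
  by (rule bij_betw_byWitness[where f' = "act (inv\<^bsub>Gamma_grp\<^esub> g)"]) auto

lemma act_translation_outside_finite: "finite {x. act g x \<noteq> x + snd g}"
proof -
  have "{x. act g x \<noteq> x + snd g} \<subseteq> (\<lambda>x. x - snd g) ` affected (fst g)"
    by (auto simp: act_def in_affected intro!: image_eqI[where x = "_ + snd g"])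
  then show ?thesis
    by (rule finite_subset) simp
qed

lemma act_inject: "(\<And>x. act g x = act h x) \<Longrightarrow> g = h"
proof -
  assume *: "\<And>x. act g x = act h x"
  obtain x where "x \<notin> {x. act g x \<noteq> x + snd g} \<union> {x. act h x \<noteq> x + snd h}"
    using ex_new_if_finite[OF infinite_UNIV_int] act_translation_outside_finite by (meson finite_Un)
  then have snd: "snd g = snd h"
    using *[of x] by simp
  moreover have "fst g = fst h"
    using *[of "_ - snd g"] snd by (intro perm_eqI) (simp add: act_def)
  ultimately show "g = h"
    by (simp add: prod_eq_iff)
qed

lemma act_perm [simp]: "act (\<sigma>, 0) = apply \<sigma>"
  by (auto simp: act_def)

lemma act_translation [simp]: "act (1, i) x = x + i"
  by (simp add: act_def)

lemma nontrivial_moves: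
  assumes "g \<noteq> \<one>\<^bsub>Gamma_grp\<^esub>"
  shows "\<exists>x. act g x \<noteq> x"
  using act_inject[of g "\<one>\<^bsub>Gamma_grp\<^esub>"] assms by auto


section \<open>Generators, conjugacy classes and amenability\<close>

text \<open>Composing \<open>\<sigma>\<close> with the transposition of \<open>a\<close> and \<open>\<sigma> a\<close> fixes \<open>a\<close> and moves no new point.\<close>

lemma perm_swap_induct [case_names one swap]:
  fixes \<sigma> :: "'a perm"
  assumes one: "P 1" and swap: "\<And>a b \<sigma>. P \<sigma> \<Longrightarrow> P (Perm.swap a b * \<sigma>)"
  shows "P \<sigma>"
proof (induction "card (affected \<sigma>)" arbitrary: \<sigma> rule: less_induct)
  case less
  show ?case
  proof (cases "\<sigma> = 1")
    case False
    then obtain a where a: "apply \<sigma> a \<noteq> a"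
      using perm_eqI[of \<sigma> 1] by auto
    define b where "b = apply \<sigma> a"
    let ?\<rho> = "Perm.swap a b * \<sigma>"
    have "affected ?\<rho> \<subset> affected \<sigma>"
    proof
      show "affected ?\<rho> \<subseteq> affected \<sigma>"
      proof
        fix x assume x: "x \<in> affected ?\<rho>"
        show "x \<in> affected \<sigma>"
        proof (rule ccontr)
          assume "x \<notin> affected \<sigma>"
          then have "apply \<sigma> x = x"
            by (simp add: in_affected)
          moreover from this have "x \<noteq> a" "x \<noteq> b"
            using a by (auto simp: b_def dest: injD[OF bij_is_inj[OF bij_apply]])
          ultimately show False
            using x by (simp add: in_affected apply_times)
        qed
      qed
      have "a \<in> affected \<sigma>" "a \<notin> affected ?\<rho>"
        using a by (simp_all add: in_affected apply_times b_def)
      then show "affected ?\<rho> \<noteq> affected \<sigma>"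
        by blast
    qed
    then have "P ?\<rho>"
      by (intro less psubset_card_mono) auto
    then have "P (Perm.swap a b * ?\<rho>)"
      by (rule swap)
    then show ?thesis
      by (simp flip: mult.assoc)
  qed (simp add: one)
qed

lemma two_generated_Gamma: "two_generated Gamma_grp"
proof -
  define s where "s = (Perm.swap 0 1 :: int perm, 0 :: int)"
  define t where "t = (1 :: int perm, 1 :: int)"
  define H where "H = generate Gamma_grp {s, t}"
  have H: "subgroup H Gamma_grp"
    unfolding H_def by (rule Gam.generate_is_subgroup) simp
  have st: "s \<in> H" "t \<in> H"
    by (auto simp: H_def intro: generate.incl)
  have mult: "g \<otimes>\<^bsub>Gamma_grp\<^esub> h \<in> H" if "g \<in> H" "h \<in> H" for g h
    using H that by (rule subgroup.m_closed)
  have inv: "inv\<^bsub>Gamma_grp\<^esub> g \<in> H" if "g \<in> H" for g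
    using H that by (rule subgroup.m_inv_closed)
  have translation: "(1, i) \<in> H" for i :: int
  proof (induction i rule: int_induct[where k = 0])
    case base
    show ?case
      using subgroup.one_closed[OF H] by (simp add: one_Gamma)
  next
    case (step1 i)
    have "(1, i + 1) = (1, i) \<otimes>\<^bsub>Gamma_grp\<^esub> t"
      by (rule act_inject) (simp add: t_def)
    then show ?case
      using mult[OF step1(2) st(2)] by simp
  next
    case (step2 i)
    have "(1, i - 1) \<otimes>\<^bsub>Gamma_grp\<^esub> t = (1, i)"
      by (rule act_inject) (simp add: t_def)
    then have "(1, i - 1) = (1, i) \<otimes>\<^bsub>Gamma_grp\<^esub> inv\<^bsub>Gamma_grp\<^esub> t"
      by (simp add: Gam.inv_solve_right)
    then show ?case
      using mult[OF step2(2) inv[OF st(2)]] by simp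
  qed
  have adjacent: "(Perm.swap i (i + 1), 0) \<in> H" for i :: int
  proof -
    have "(Perm.swap i (i + 1), 0) \<otimes>\<^bsub>Gamma_grp\<^esub> (1, i) = (1, i) \<otimes>\<^bsub>Gamma_grp\<^esub> s"
    proof (rule act_inject)
      fix x :: int
      consider "x = 0" | "x = 1" | "x \<noteq> 0" "x \<noteq> 1" by blast
      then show "act ((Perm.swap i (i + 1), 0) \<otimes>\<^bsub>Gamma_grp\<^esub> (1, i)) x = act ((1, i) \<otimes>\<^bsub>Gamma_grp\<^esub> s) x"
        by cases (simp_all add: s_def add.commute)
    qed
    then have "(Perm.swap i (i + 1), 0) = (1, i) \<otimes>\<^bsub>Gamma_grp\<^esub> s \<otimes>\<^bsub>Gamma_grp\<^esub> inv\<^bsub>Gamma_grp\<^esub> (1, i)"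
      by (simp add: Gam.inv_solve_right)
    then show ?thesis
      using mult[OF mult[OF translation st(1)] inv[OF translation]] by simp
  qed
  have pos: "(Perm.swap i (i + 1 + int k), 0) \<in> H" for i :: int and k
  proof (induction k)
    case (Suc k)
    let ?j = "i + 1 + int k"
    have eq: "(Perm.swap i (i + 1 + int (Suc k)), 0)
        = (Perm.swap ?j (?j + 1), 0) \<otimes>\<^bsub>Gamma_grp\<^esub> (Perm.swap i ?j, 0) \<otimes>\<^bsub>Gamma_grp\<^esub> (Perm.swap ?j (?j + 1), 0)"
    proof (rule act_inject)
      fix x :: int
      have eq: "i + 1 + int (Suc k) = ?j + 1" by simp
      have ne: "i \<noteq> ?j" "i \<noteq> ?j + 1" by simp_all
      consider "x = i" | "x = ?j" | "x = ?j + 1" | "x \<noteq> i" "x \<noteq> ?j" "x \<noteq> ?j + 1" by blast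
      then show "act (Perm.swap i (i + 1 + int (Suc k)), 0) x =
          act ((Perm.swap ?j (?j + 1), 0) \<otimes>\<^bsub>Gamma_grp\<^esub> (Perm.swap i ?j, 0) \<otimes>\<^bsub>Gamma_grp\<^esub> (Perm.swap ?j (?j + 1), 0)) x"
        unfolding eq using ne by cases (simp_all del: of_nat_Suc)
    qed
    show ?case
      unfolding eq by (rule mult[OF mult[OF adjacent Suc] adjacent])
  qed (use adjacent in simp)
  have swap: "(Perm.swap i j, 0) \<in> H" for i j :: int
  proof -
    have less: "(Perm.swap i j, 0) \<in> H" if "i < j" for i j :: int
      using pos[of i "nat (j - i - 1)"] that by simp
    show ?thesis
      using less[of i j] less[of j i] subgroup.one_closed[OF H]
      by (cases i j rule: linorder_cases) (simp_all add: one_Gamma swap_sym)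
  qed
  have perm: "(\<sigma>, 0) \<in> H" for \<sigma>
  proof (induction \<sigma> rule: perm_swap_induct)
    case one
    show ?case
      using subgroup.one_closed[OF H] by (simp add: one_Gamma)
  next
    case (swap a b \<sigma>)
    have "(Perm.swap a b * \<sigma>, 0) = (Perm.swap a b, 0) \<otimes>\<^bsub>Gamma_grp\<^esub> (\<sigma>, 0)"
      by (rule act_inject) (simp add: apply_times)
    then show ?case
      using mult[OF \<open>\<And>i j. (Perm.swap i j, 0) \<in> H\<close> swap] by simp
  qed
  have "(\<sigma>, m) \<in> H" for \<sigma> m
  proof -
    have "(\<sigma>, m) = (\<sigma>, 0) \<otimes>\<^bsub>Gamma_grp\<^esub> (1, m)"
      by (rule act_inject) (simp add: act_def[of "(\<sigma>, m)"])
    then show ?thesis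
      using mult[OF perm translation] by simp
  qed
  then have "H = carrier Gamma_grp"
    by (auto simp: carrier_Gamma_grp)
  then show ?thesis
    unfolding two_generated_def H_def by (metis Gam.in_carrier)
qed

text \<open>If \<open>g\<close> moves \<open>x\<close>, then its conjugate by the transposition of \<open>g x\<close> and \<open>y\<close> sends \<open>x\<close> to \<open>y\<close>.\<close>

lemma icc_Gamma: "icc Gamma_grp"
  unfolding icc_def
proof (intro conjI ballI impI)
  have "(1, 1) \<noteq> \<one>\<^bsub>Gamma_grp\<^esub>"
    by (simp add: one_Gamma)
  then show "carrier Gamma_grp \<noteq> {\<one>\<^bsub>Gamma_grp\<^esub>}"
    unfolding carrier_Gamma_grp by (metis UNIV_I singletonD)
  fix g assume "g \<noteq> \<one>\<^bsub>Gamma_grp\<^esub>"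
  then obtain x where x: "act g x \<noteq> x"
    using nontrivial_moves by blast
  have "UNIV - {x, act g x} \<subseteq> (\<lambda>h. act h x) ` conjugacy_class Gamma_grp g"
  proof
    fix y assume y: "y \<in> UNIV - {x, act g x}"
    define s where "s = (Perm.swap (act g x) y, 0 :: int)"
    have "act (inv\<^bsub>Gamma_grp\<^esub> s) x = x"
      using x y act_inv(1)[of s x] by (simp add: s_def)
    then have "y = act (s \<otimes>\<^bsub>Gamma_grp\<^esub> g \<otimes>\<^bsub>Gamma_grp\<^esub> inv\<^bsub>Gamma_grp\<^esub> s) x"
      by (simp add: s_def)
    moreover have "s \<otimes>\<^bsub>Gamma_grp\<^esub> g \<otimes>\<^bsub>Gamma_grp\<^esub> inv\<^bsub>Gamma_grp\<^esub> s \<in> conjugacy_class Gamma_grp g"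
      unfolding conjugacy_class_def using Gam.in_carrier by blast
    ultimately show "y \<in> (\<lambda>h. act h x) ` conjugacy_class Gamma_grp g"
      by (rule image_eqI)
  qed
  moreover have "infinite (UNIV - {x, act g x})"
    by (simp add: infinite_UNIV_int)
  ultimately show "infinite (conjugacy_class Gamma_grp g)"
    by (meson finite_imageI infinite_super)
qed

lemma finite_support_in:
  assumes "finite S"
  shows "finite {g. \<forall>x. x \<notin> S \<longrightarrow> act g x = x}"
proof (rule finite_imageD[where f = act])
  have "act ` {g. \<forall>x. x \<notin> S \<longrightarrow> act g x = x} \<subseteq> {p. p permutes S}"
    using bij_act by (auto simp: permutes_def simp flip: bij_iff)
  then show "finite (act ` {g. \<forall>x. x \<notin> S \<longrightarrow> act g x = x})"
    using finite_permutations[OF assms] by (rule finite_subset)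
  show "inj_on act {g. \<forall>x. x \<notin> S \<longrightarrow> act g x = x}"
    by (rule inj_onI, rule act_inject) simp
qed

text \<open>The normalised counting measures of the sets \<open>F n\<close> lie in a compact product of intervals; any
  cluster point of the sequence is an invariant mean.\<close>

lemma amenable_if_Folner:
  fixes G :: "('a, 'b) monoid_scheme" and F :: "nat \<Rightarrow> 'a set"
  assumes "discrete_group G" and F: "\<And>n. finite (F n)" "\<And>n. F n \<noteq> {}"
    and inv: "\<And>g. (\<lambda>n. real (card ((g <#\<^bsub>G\<^esub> F n) - F n)) / card (F n)) \<longlonglongrightarrow> 0"
  shows "amenable G"
proof -
  interpret discrete_group G by fact
  define h where "h n A = real (card (A \<inter> F n)) / card (F n)" for n A
  have cardF: "card (F n) > 0" for n
    using F by (simp add: card_gt_0_iff)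
  have h01: "0 \<le> h n A" "h n A \<le> 1" for n A
    using card_mono[OF F(1), of "A \<inter> F n" n] cardF[of n] by (auto simp: h_def divide_le_eq_1)
  define S :: "('a set \<Rightarrow> real) set" where "S = (UNIV \<rightarrow>\<^sub>E {0..1})"
  have "compactin (product_topology (\<lambda>_. euclidean) UNIV) S"
    unfolding S_def compactin_PiE by auto
  then have "compact S"
    by (simp add: euclidean_product_topology)
  moreover have "eventually (\<lambda>\<nu>. \<nu> \<in> S) (filtermap h sequentially)"
    using h01 by (auto simp: eventually_filtermap S_def PiE_def extensional_def)
  ultimately obtain \<mu> where \<mu>: "inf (nhds \<mu>) (filtermap h sequentially) \<noteq> bot"
    unfolding compact_filter by (metis filtermap_bot_iff sequentially_bot)
  define \<Phi> where "\<Phi> = inf (nhds \<mu>) (filtermap h sequentially)"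
  have tendsto: "((\<lambda>\<nu>. \<nu> A) \<longlongrightarrow> \<mu> A) \<Phi>" for A
  proof -
    have "continuous_on UNIV (\<lambda>\<nu> :: 'a set \<Rightarrow> real. \<nu> A)"
      by (rule continuous_on_product_coordinates)
    then have "((\<lambda>\<nu>. \<nu> A) \<longlongrightarrow> \<mu> A) (at \<mu>)"
      by (simp add: continuous_on_def)
    then have "((\<lambda>\<nu>. \<nu> A) \<longlongrightarrow> \<mu> A) (nhds \<mu>)"
      by (rule tendsto_at_iff_tendsto_nhds[THEN iffD1])
    then show ?thesis
      unfolding \<Phi>_def by (rule tendsto_mono[OF inf_le1])
  qed
  have transfer: "eventually P \<Phi>" if "\<forall>\<^sub>F n in sequentially. P (h n)" for P
    using that unfolding \<Phi>_def by (intro filter_leD[OF inf_le2]) (simp add: eventually_filtermap)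
  have \<Phi>: "\<Phi> \<noteq> bot"
    using \<mu> by (simp add: \<Phi>_def)
  have mono: "\<mu> A \<le> \<mu> (g <#\<^bsub>G\<^esub> A)" for g A
  proof (rule field_le_epsilon)
    fix \<epsilon> :: real assume "\<epsilon> > 0"
    have card: "card (A \<inter> F n) \<le> card ((g <#\<^bsub>G\<^esub> A) \<inter> F n) + card ((g <#\<^bsub>G\<^esub> F n) - F n)" for n
    proof -
      have inj: "inj_on (\<lambda>x. g \<otimes>\<^bsub>G\<^esub> x) B" for B
        by (rule inj_onI) simp
      have "card (A \<inter> F n) = card ((\<lambda>x. g \<otimes>\<^bsub>G\<^esub> x) ` (A \<inter> F n))"
        by (rule card_image[OF inj, symmetric])
      also have "\<dots> \<le> card (((g <#\<^bsub>G\<^esub> A) \<inter> F n) \<union> ((g <#\<^bsub>G\<^esub> F n) - F n))"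
        using F(1)[of n] by (intro card_mono) (auto simp: l_coset_def)
      also have "\<dots> \<le> card ((g <#\<^bsub>G\<^esub> A) \<inter> F n) + card ((g <#\<^bsub>G\<^esub> F n) - F n)"
        by (rule card_Un_le)
      finally show ?thesis .
    qed
    have "\<forall>\<^sub>F n in sequentially. dist (real (card ((g <#\<^bsub>G\<^esub> F n) - F n)) / card (F n)) 0 < \<epsilon>"
      using inv \<open>\<epsilon> > 0\<close> by (rule tendstoD)
    then have "\<forall>\<^sub>F n in sequentially. h n A \<le> h n (g <#\<^bsub>G\<^esub> A) + \<epsilon>"
    proof eventually_elim
      case (elim n)
      have "h n A \<le> h n (g <#\<^bsub>G\<^esub> A) + real (card ((g <#\<^bsub>G\<^esub> F n) - F n)) / card (F n)"
        using card[of n] cardF[of n] unfolding h_def add_divide_distrib[symmetric]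
        by (intro divide_right_mono) (auto simp flip: of_nat_add)
      then show ?case
        using elim by simp
    qed
    then have "eventually (\<lambda>\<nu>. \<nu> A \<le> \<nu> (g <#\<^bsub>G\<^esub> A) + \<epsilon>) \<Phi>"
      by (rule transfer)
    then show "\<mu> A \<le> \<mu> (g <#\<^bsub>G\<^esub> A) + \<epsilon>"
      by (intro tendsto_le[OF \<Phi> tendsto_add[OF tendsto tendsto_const] tendsto])
  qed
  have "\<mu> (carrier G) = 1"
  proof (rule tendsto_unique[OF \<Phi> tendsto])
    have "eventually (\<lambda>\<nu>. \<nu> (carrier G) = 1) \<Phi>"
      using cardF by (intro transfer always_eventually) (simp add: h_def carrier_eq_UNIV)
    then show "((\<lambda>\<nu>. \<nu> (carrier G)) \<longlongrightarrow> 1) \<Phi>"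
      by (rule tendsto_eventually)
  qed
  moreover have "0 \<le> \<mu> A" for A
    by (rule tendsto_lowerbound[OF tendsto transfer \<Phi>]) (simp add: h01)
  moreover have "\<mu> (A \<union> B) = \<mu> A + \<mu> B" if "A \<inter> B = {}" for A B
  proof (rule tendsto_unique[OF \<Phi> tendsto])
    have "h n (A \<union> B) = h n A + h n B" for n
      using that F(1)[of n] by (simp add: h_def Int_Un_distrib2 card_Un_disjoint add_divide_distrib
          disjoint_iff)
    then have "eventually (\<lambda>\<nu>. \<nu> A + \<nu> B = \<nu> (A \<union> B)) \<Phi>"
      by (intro transfer always_eventually) simp
    then show "((\<lambda>\<nu>. \<nu> (A \<union> B)) \<longlongrightarrow> \<mu> A + \<mu> B) \<Phi>"
      using tendsto_add[OF tendsto[of A] tendsto[of B]] by (rule Lim_transform_eventually[rotated])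
  qed
  moreover have "\<mu> (g <#\<^bsub>G\<^esub> A) = \<mu> A" for g A
  proof (rule antisym)
    have "inv\<^bsub>G\<^esub> g <#\<^bsub>G\<^esub> (g <#\<^bsub>G\<^esub> A) = A"
      by (simp add: lcos_m_assoc carrier_eq_UNIV lcos_mult_one)
    then show "\<mu> (g <#\<^bsub>G\<^esub> A) \<le> \<mu> A"
      using mono[of "g <#\<^bsub>G\<^esub> A" "inv\<^bsub>G\<^esub> g"] by simp
  qed (rule mono)
  ultimately show ?thesis
    unfolding amenable_def by blast
qed

text \<open>The sets \<open>{t\<^sup>j a | 0 \<le> j \<le> n, a \<in> Sym {-2n..2n}}\<close> are asymptotically invariant: moving \<open>b t\<^sup>m\<close> past
  \<open>t\<^sup>j\<close> replaces \<open>b\<close> by a translate, whose support stays inside \<open>{-2n..2n}\<close> for large \<open>n\<close>, so that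
  only the \<open>\<bar>m\<bar>\<close> boundary values of \<open>j\<close> contribute.\<close>

lemma amenable_Gamma: "amenable Gamma_grp"
proof (rule amenable_if_Folner)
  show "discrete_group Gamma_grp" ..
  define K where "K n = {g. \<forall>x. x \<notin> {- 2 * int n..2 * int n} \<longrightarrow> act g x = x}" for n
  define \<phi> where "\<phi> = (\<lambda>(j :: int, a). (1, j) \<otimes>\<^bsub>Gamma_grp\<^esub> a)"
  define F where "F n = \<phi> ` ({0..<int (Suc n)} \<times> K n)" for n
  have finK: "finite (K n)" for n
    unfolding K_def by (rule finite_support_in) simp
  have oneK: "\<one>\<^bsub>Gamma_grp\<^esub> \<in> K n" for n
    by (simp add: K_def)
  have snd_K: "snd a = 0" if "a \<in> K n" for a n
  proof -
    obtain x where "x \<notin> {x. act a x \<noteq> x + snd a} \<union> {- 2 * int n..2 * int n}"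
      using ex_new_if_finite[OF infinite_UNIV_int] act_translation_outside_finite
      by (meson finite_Un finite_atLeastAtMost_int)
    then show ?thesis
      using that by (auto simp: K_def)
  qed
  show fin: "finite (F n)" for n
    unfolding F_def using finK by simp
  show "F n \<noteq> {}" for n
    unfolding F_def using oneK[of n] by auto
  have cardF: "card (F n) = Suc n * card (K n)" for n
  proof -
    have "inj_on \<phi> ({0..<int (Suc n)} \<times> K n)"
    proof (rule inj_onI, clarify)
      fix j a j' a'
      assume a: "a \<in> K n" "a' \<in> K n" and eq: "\<phi> (j, a) = \<phi> (j', a')"
      have "j = j'"
        using arg_cong[OF eq, of snd] snd_K a by (simp add: \<phi>_def)
      then show "j = j' \<and> a = a'"
        using eq by (simp add: \<phi>_def)
    qed
    then show ?thesis
      unfolding F_def by (simp add: card_image card_cartesian_product del: of_nat_Suc)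
  qed
  fix g :: "int perm \<times> int"
  define m where "m = snd g"
  obtain N where N: "\<And>n x. n \<ge> N \<Longrightarrow> \<bar>x\<bar> > int n \<Longrightarrow> apply (fst g) x = x"
  proof -
    have "bdd_above (abs ` affected (fst g))"
      by simp
    then obtain C where C: "\<And>x. x \<in> affected (fst g) \<Longrightarrow> \<bar>x\<bar> \<le> C"
      by (auto simp: bdd_above_def)
    have "apply (fst g) x = x" if "n \<ge> nat C" "\<bar>x\<bar> > int n" for n x
      using C[of x] that by (cases "apply (fst g) x = x") (auto simp: in_affected nat_le_iff)
    then show thesis
      using that by blast
  qed
  have bound: "card ((g <#\<^bsub>Gamma_grp\<^esub> F n) - F n) \<le> nat \<bar>m\<bar> * card (K n)" if n: "n \<ge> N" for n
  proof -
    define J where "J = {j. 0 \<le> j \<and> j < int (Suc n) \<and> \<not> (0 \<le> j + m \<and> j + m < int (Suc n))}"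
    have "(g <#\<^bsub>Gamma_grp\<^esub> F n) - F n \<subseteq> (\<lambda>y. g \<otimes>\<^bsub>Gamma_grp\<^esub> \<phi> y) ` (J \<times> K n)"
    proof
      fix z assume z: "z \<in> (g <#\<^bsub>Gamma_grp\<^esub> F n) - F n"
      then obtain j a where ja: "0 \<le> j" "j < int (Suc n)" "a \<in> K n" "z = g \<otimes>\<^bsub>Gamma_grp\<^esub> \<phi> (j, a)"
        by (auto simp: l_coset_def F_def)
      have "\<not> (0 \<le> j + m \<and> j + m < int (Suc n))"
      proof
        assume i: "0 \<le> j + m \<and> j + m < int (Suc n)"
        define b where "b = inv\<^bsub>Gamma_grp\<^esub> (1, j + m) \<otimes>\<^bsub>Gamma_grp\<^esub> z"
        have z_eq: "z = \<phi> (j + m, b)"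
          by (simp add: \<phi>_def b_def Gam.m_assoc[symmetric])
        have "act b x = x" if x: "x \<notin> {- 2 * int n..2 * int n}" for x
        proof -
          have "act z x = apply (fst g) (x + (j + m))"
            using ja(3) x by (simp add: ja(4) \<phi>_def K_def act_def[of g] m_def ac_simps)
          also have "\<dots> = x + (j + m)"
            using i x by (intro N[OF n]) auto
          also have "\<dots> = act (1, j + m) x"
            by (simp add: act_def)
          finally have "act (1, j + m) (act b x) = act (1, j + m) x"
            by (simp add: b_def)
          then show ?thesis
            by (simp del: act_perm)
        qed
        then have "b \<in> K n"
          by (simp add: K_def)
        then have "z \<in> F n"
          unfolding F_def z_eq using i by (intro imageI) auto
        then show False
          using z by blast
      qed
      then show "z \<in> (\<lambda>y. g \<otimes>\<^bsub>Gamma_grp\<^esub> \<phi> y) ` (J \<times> K n)"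
        using ja by (auto simp: J_def)
    qed
    moreover have J: "finite J" "card J \<le> nat \<bar>m\<bar>"
    proof -
      have sub: "J \<subseteq> (if m \<ge> 0 then {int (Suc n) - m..<int (Suc n)} else {0..< - m})"
        by (auto simp: J_def)
      then show "finite J"
        by (rule finite_subset) simp
      have "card J \<le> card (if m \<ge> 0 then {int (Suc n) - m..<int (Suc n)} else {0..< - m})"
        using sub by (rule card_mono[rotated]) simp
      then show "card J \<le> nat \<bar>m\<bar>"
        by (simp split: if_splits)
    qed
    ultimately have "card ((g <#\<^bsub>Gamma_grp\<^esub> F n) - F n) \<le> card (J \<times> K n)"
      using finK by (intro surj_card_le) auto
    also have "\<dots> \<le> nat \<bar>m\<bar> * card (K n)"
      using J by (simp add: card_cartesian_product)
    finally show ?thesis .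
  qed
  show "(\<lambda>n. real (card ((g <#\<^bsub>Gamma_grp\<^esub> F n) - F n)) / card (F n)) \<longlonglongrightarrow> 0"
  proof (rule Lim_null_comparison)
    show "\<forall>\<^sub>F n in sequentially. norm (real (card ((g <#\<^bsub>Gamma_grp\<^esub> F n) - F n)) / card (F n))
        \<le> real (nat \<bar>m\<bar>) * inverse (real (Suc n))"
      using eventually_ge_at_top[of N]
    proof eventually_elim
      case (elim n)
      have "card (K n) > 0"
        using finK oneK by (auto simp: card_gt_0_iff)
      have "real (card ((g <#\<^bsub>Gamma_grp\<^esub> F n) - F n)) / card (F n)
          \<le> real (nat \<bar>m\<bar> * card (K n)) / card (F n)"
        using bound[OF elim] by (intro divide_right_mono of_nat_mono) auto
      also have "\<dots> = real (nat \<bar>m\<bar>) * inverse (real (Suc n))"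
        using \<open>card (K n) > 0\<close> unfolding cardF of_nat_mult by (simp add: divide_inverse del: of_nat_Suc)
      finally show ?case
        by simp
    qed
    show "(\<lambda>n. real (nat \<bar>m\<bar>) * inverse (real (Suc n))) \<longlonglongrightarrow> 0"
      by (intro tendsto_mult_right_zero LIMSEQ_inverse_real_of_nat)
  qed
qed


section \<open>A spreading sequence\<close>

text \<open>Exchanging each point of \<open>A\<close> with its image gives an involution.\<close>

lemma finitary_extension:
  assumes A: "finite A" and f: "inj_on f A" "A \<inter> f ` A = {}"
  shows "\<exists>\<sigma>. \<forall>x\<in>A. apply \<sigma> x = f x"
proof -
  define h where "h x = (if x \<in> A then f x else if x \<in> f ` A then the_inv_into A f x else x)" for x
  have hh: "h (h x) = x" for x
    using f by (auto simp: h_def the_inv_into_f_f)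
  then have "bij h"
    by (intro bij_betw_byWitness[where f' = h]) auto
  moreover have "{x. h x \<noteq> x} \<subseteq> A \<union> f ` A"
    by (auto simp: h_def)
  then have "finite {x. h x \<noteq> x}"
    using A by (auto intro: finite_subset)
  ultimately have "apply (Perm h) = h"
    by (simp add: Perm_inverse)
  then show ?thesis
    by (intro exI[of _ "Perm h"]) (simp add: h_def)
qed

text \<open>Conjugating \<open>y\<close> by permutations that push any two points far apart gives elements with
  displacement tending to infinity at some point, whereas the displacement of each fixed
  element is bounded.\<close>

lemma spreading_exists: "\<exists>s. Gam.spreading s"
proof -
  have "\<exists>\<sigma> :: int perm. \<forall>x\<in>{- int n..int n}. apply \<sigma> x = (int n + 1) * (x + int n + 3)" for n
  proof (rule finitary_extension)
    show "inj_on (\<lambda>x. (int n + 1) * (x + int n + 3)) {- int n..int n}"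
      by (rule inj_onI) simp
    have "(int n + 1) * (x + int n + 3) > int n" if "x \<ge> - int n" for x
    proof -
      have "int n < (int n + 1) * 3"
        by simp
      also have "\<dots> \<le> (int n + 1) * (x + int n + 3)"
        using that by (intro mult_left_mono) auto
      finally show ?thesis .
    qed
    then show "{- int n..int n} \<inter> (\<lambda>x. (int n + 1) * (x + int n + 3)) ` {- int n..int n} = {}"
      by fastforce
  qed simp
  then obtain \<sigma> :: "nat \<Rightarrow> int perm"
    where \<sigma>: "\<And>n x. x \<in> {- int n..int n} \<Longrightarrow> apply (\<sigma> n) x = (int n + 1) * (x + int n + 3)"
    by metis
  have apart: "\<bar>apply (\<sigma> n) x - apply (\<sigma> n) y\<bar> > int n"
    if "\<bar>x\<bar> \<le> int n" "\<bar>y\<bar> \<le> int n" "x \<noteq> y" for n x y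
  proof -
    have "x \<in> {- int n..int n}" "y \<in> {- int n..int n}"
      using that by auto
    then have "apply (\<sigma> n) x - apply (\<sigma> n) y = (int n + 1) * (x - y)"
      by (simp only: \<sigma>) (simp add: algebra_simps)
    then have eq: "\<bar>apply (\<sigma> n) x - apply (\<sigma> n) y\<bar> = (int n + 1) * \<bar>x - y\<bar>"
      by (simp add: abs_mult)
    have "int n < (int n + 1) * 1"
      by simp
    also have "\<dots> \<le> (int n + 1) * \<bar>x - y\<bar>"
      using that by (intro mult_left_mono) auto
    finally show ?thesis
      unfolding eq .
  qed
  have "Gam.spreading (\<lambda>n. (\<sigma> n, 0))"
    unfolding Gam.spreading_def
  proof (intro allI impI)
    fix y z :: "int perm \<times> int"
    assume "y \<noteq> \<one>\<^bsub>Gamma_grp\<^esub>"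
    then obtain x where x: "act y x \<noteq> x"
      using nontrivial_moves by blast
    have "range (\<lambda>w. \<bar>act z w - w\<bar>) \<subseteq>
        insert \<bar>snd z\<bar> ((\<lambda>w. \<bar>act z w - w\<bar>) ` {w. act z w \<noteq> w + snd z})"
      by auto
    then have "finite (range (\<lambda>w. \<bar>act z w - w\<bar>))"
      using act_translation_outside_finite[of z] by (meson finite_imageI finite_insert finite_subset)
    then have "bdd_above (range (\<lambda>w. \<bar>act z w - w\<bar>))"
      by simp
    then obtain C where C: "\<And>w. \<bar>act z w - w\<bar> \<le> C"
      by (auto simp: bdd_above_def)
    have "(\<sigma> n, 0) \<otimes>\<^bsub>Gamma_grp\<^esub> y \<otimes>\<^bsub>Gamma_grp\<^esub> inv\<^bsub>Gamma_grp\<^esub> (\<sigma> n, 0) \<noteq> z"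
      if n: "n \<ge> nat (max C (max \<bar>x\<bar> \<bar>act y x\<bar>))" for n
    proof
      assume "(\<sigma> n, 0) \<otimes>\<^bsub>Gamma_grp\<^esub> y \<otimes>\<^bsub>Gamma_grp\<^esub> inv\<^bsub>Gamma_grp\<^esub> (\<sigma> n, 0) = z"
      then have "act z (act (\<sigma> n, 0) x) = act (\<sigma> n, 0) (act y x)"
        by (auto simp del: act_perm)
      then have "\<bar>apply (\<sigma> n) (act y x) - apply (\<sigma> n) x\<bar> \<le> C"
        using C[of "apply (\<sigma> n) x"] by simp
      moreover have "\<bar>apply (\<sigma> n) (act y x) - apply (\<sigma> n) x\<bar> > int n"
        using n x by (intro apart) auto
      ultimately show False
        using n by simp
    qed
    then show "\<forall>\<^sub>F n in sequentially. (\<sigma> n, 0) \<otimes>\<^bsub>Gamma_grp\<^esub> y \<otimes>\<^bsub>Gamma_grp\<^esub> inv\<^bsub>Gamma_grp\<^esub> (\<sigma> n, 0) \<noteq> z"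
      by (rule eventually_sequentiallyI)
  qed
  then show ?thesis
    by blast
qed


section \<open>The chain of finite symmetric groups\<close>

text \<open>The sizes \<open>4\<^bsup>m+1\<^esup>\<close> grow fast enough to make the norms of \<open>e\<^sub>m \<delta>\<^sub>1\<close> summable, already
  because the \<open>m\<close>-th group contains the transpositions of \<open>0\<close> with the other points.\<close>

definition chain :: "nat \<Rightarrow> (int perm \<times> int) set" where
  "chain m = {g. \<forall>x. x \<notin> {0..<4 ^ Suc m} \<longrightarrow> act g x = x}"

lemma chain_fixes: "g \<in> chain m \<Longrightarrow> x \<notin> {0..<4 ^ Suc m} \<Longrightarrow> act g x = x"
  unfolding chain_def by blast

lemma finite_chain: "finite (chain m)"
  unfolding chain_def by (rule finite_support_in) simp

lemma subgroup_chain: "subgroup (chain m) Gamma_grp"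
proof
  show "inv\<^bsub>Gamma_grp\<^esub> g \<in> chain m" if "g \<in> chain m" for g
    unfolding chain_def
  proof (intro CollectI allI impI)
    fix x :: int assume "x \<notin> {0..<4 ^ Suc m}"
    then show "act (inv\<^bsub>Gamma_grp\<^esub> g) x = x"
      using act_inv(1)[of g x] chain_fixes[OF that] by simp
  qed
qed (auto simp: chain_def)

lemma chain_mono: "k \<le> m \<Longrightarrow> chain k \<subseteq> chain m"
proof -
  assume "k \<le> m"
  then have "(4 :: int) ^ Suc k \<le> 4 ^ Suc m"
    by (intro power_increasing) auto
  then have "{0..<4 ^ Suc k} \<subseteq> {0..<(4 :: int) ^ Suc m}"
    by (rule ivl_subset[THEN iffD2, OF disjI2, OF conjI[OF order_refl]])
  then show ?thesis
    unfolding chain_def by blast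
qed

lemma swap_in_chain: "i \<in> {0..<4 ^ Suc m} \<Longrightarrow> j \<in> {0..<4 ^ Suc m} \<Longrightarrow> (Perm.swap i j, 0) \<in> chain m"
  unfolding chain_def by (auto intro!: apply_swap_same)

lemma card_chain: "4 ^ m \<le> card (chain m)"
proof -
  define f where "f j = (Perm.swap 0 j :: int perm, 0 :: int)" for j
  have "inj f"
    by (rule injI) (metis apply_swap_simp(1) f_def prod.inject)
  moreover have "f ` {0..<4 ^ Suc m} \<subseteq> chain m"
    unfolding f_def by (auto simp del: power_Suc intro!: swap_in_chain)
  ultimately have "card {0..<(4 :: int) ^ Suc m} \<le> card (chain m)"
    using card_inj_on_le[of f "{0..<4 ^ Suc m}" "chain m"] finite_chain by (auto intro: inj_on_subset)
  then show ?thesis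
    by (simp add: nat_power_eq nat_mult_distrib)
qed

interpretation chain: projection_sequence Gamma_grp "\<lambda>m. Gam.avg (chain m)"
proof
  fix m n and \<xi> \<eta> :: "(int perm \<times> int) ell2"
  show "Gam.avg (chain n) \<in> group_vN Gamma_grp"
    by (rule Gam.avg_in_M)
  show "cinner (Gam.avg (chain n) \<xi>) \<eta> = cinner \<xi> (Gam.avg (chain n) \<eta>)"
    by (rule Gam.avg_self_adjoint[OF finite_chain subgroup_chain])
  show "Gam.avg (chain n) (Gam.avg (chain n) \<xi>) = Gam.avg (chain n) \<xi>"
    by (rule Gam.avg_avg(1)[OF finite_chain subgroup_chain subgroup_chain order_refl])
  have comm: "Gam.avg (chain m) (Gam.avg (chain n) \<xi>) = Gam.avg (chain n) (Gam.avg (chain m) \<xi>)"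
    if "m \<le> n" for m n
    using Gam.avg_avg[OF finite_chain subgroup_chain subgroup_chain chain_mono[OF that]] by simp
  show "Gam.avg (chain m) (Gam.avg (chain n) \<xi>) = Gam.avg (chain n) (Gam.avg (chain m) \<xi>)"
    using comm[of m n] comm[of n m] by (cases "m \<le> n") auto
  have "(2 ^ n)\<^sup>2 \<le> real (card (chain n))"
    using of_nat_mono[OF card_chain[of n], where 'a = real] by (simp add: power2_eq_square flip: power_mult_distrib)
  then have "2 ^ n \<le> sqrt (card (chain n))"
    by (rule real_le_rsqrt)
  then have "1 / sqrt (card (chain n)) \<le> 1 / 2 ^ n"
    using less_le_trans[OF _ card_chain[of n], of 0] by (intro divide_left_mono) auto
  moreover have "chain n \<noteq> {}"
    using subgroup.one_closed[OF subgroup_chain] by blast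
  ultimately show "norm (Gam.avg (chain n) (delta \<one>\<^bsub>Gamma_grp\<^esub>)) \<le> (1/2) ^ n"
    by (simp add: Gam.norm_avg_delta_one finite_chain power_one_over)
qed

text \<open>This transposition straddles the boundary of \<open>{0..<4\<^bsup>m+1\<^esup>}\<close> and of no other set of the chain,
  so it normalizes every group of the chain except the \<open>m\<close>-th.\<close>

definition boundary_swap :: "nat \<Rightarrow> int perm \<times> int" where
  "boundary_swap m = (Perm.swap (4 ^ Suc m - 1) (4 ^ Suc m), 0)"

lemma boundary_swap_inv: "inv\<^bsub>Gamma_grp\<^esub> boundary_swap m = boundary_swap m"
proof (rule Gam.inv_equality)
  show "boundary_swap m \<otimes>\<^bsub>Gamma_grp\<^esub> boundary_swap m = \<one>\<^bsub>Gamma_grp\<^esub>"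
    by (rule act_inject) (simp add: boundary_swap_def apply_sequence del: power_Suc)
qed auto

lemma act_boundary_swap:
  "act (boundary_swap m) (4 ^ Suc m - 1) = 4 ^ Suc m"
  "act (boundary_swap m) (4 ^ Suc m) = 4 ^ Suc m - 1"
  "x \<noteq> 4 ^ Suc m - 1 \<Longrightarrow> x \<noteq> 4 ^ Suc m \<Longrightarrow> act (boundary_swap m) x = x"
  by (simp_all add: boundary_swap_def del: power_Suc)

lemma boundary_swap_normalizes:
  assumes "k \<noteq> m" "h \<in> chain k"
  shows "boundary_swap m \<otimes>\<^bsub>Gamma_grp\<^esub> h \<otimes>\<^bsub>Gamma_grp\<^esub> inv\<^bsub>Gamma_grp\<^esub> boundary_swap m \<in> chain k"
proof -
  have mono: "(4 :: int) ^ Suc a + 1 \<le> 4 ^ Suc b" if "a < b" for a b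
  proof -
    have "(4 :: int) ^ Suc a < 4 ^ Suc b"
      using that by (intro power_strict_increasing) auto
    then show ?thesis
      by (rule zless_imp_add1_zle)
  qed
  \<comment> \<open>Both points moved by the transposition lie on the same side of the boundary of \<open>{0..<4\<^bsup>k+1\<^esup>}\<close>.\<close>
  have "act (boundary_swap m) x \<notin> {0..<4 ^ Suc k}" if "x \<notin> {0..<4 ^ Suc k}" for x
  proof -
    consider "x = 4 ^ Suc m - 1" | "x = 4 ^ Suc m" | "x \<noteq> 4 ^ Suc m - 1" "x \<noteq> 4 ^ Suc m" by blast
    then show ?thesis
    proof cases
      case 3
      then show ?thesis
        using that by (simp only: act_boundary_swap not_False_eq_True)
    qed (use that assms(1) mono[of k m] mono[of m k] in
        \<open>auto simp: act_boundary_swap not_less not_le neq_iff simp del: power_Suc\<close>)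
  qed
  then have "act (boundary_swap m) (act h (act (boundary_swap m) x)) = x" if "x \<notin> {0..<4 ^ Suc k}" for x
    using chain_fixes[OF assms(2)] that act_inv(1)[of "boundary_swap m" x]
    by (simp add: boundary_swap_inv)
  then show ?thesis
    unfolding chain_def boundary_swap_inv by simp
qed

text \<open>With \<open>r = 4\<^bsup>m+1\<^esup>\<close>, \<open>K = chain m\<close> and \<open>g\<close> the boundary transposition, the element
  \<open>(0 r-1)(0 r)\<close> of \<open>K gKg\<^sup>-\<^sup>1\<close> sends \<open>r\<close> to \<open>r - 1\<close>; no element of \<open>gKg\<^sup>-\<^sup>1 K\<close> does, because
  \<open>gKg\<^sup>-\<^sup>1\<close> fixes \<open>r - 1\<close> and \<open>K\<close> fixes \<open>r\<close>.\<close>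

lemma boundary_swap_not_commute:
  "\<exists>\<xi>. Gam.conj_op (boundary_swap m) (Gam.avg (chain m)) (Gam.avg (chain m) \<xi>)
    \<noteq> Gam.avg (chain m) (Gam.conj_op (boundary_swap m) (Gam.avg (chain m)) \<xi>)"
proof (rule Gam.avg_not_commute)
  define r :: int where "r = 4 ^ Suc m"
  have r: "r > 1"
    unfolding r_def by (rule one_less_power) auto
  define k where "k = (Perm.swap 0 (r - 1), 0 :: int)"
  show k: "k \<in> chain m"
    unfolding k_def using r by (intro swap_in_chain) (auto simp: r_def simp del: power_Suc)
  show "k \<in> chain m" by fact
  show "finite (chain m)"
    by (rule finite_chain)
  show "inv\<^bsub>Gamma_grp\<^esub> h \<in> chain m" if "h \<in> chain m" for h
    using subgroup_chain that by (rule subgroup.m_inv_closed)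
  fix h assume h: "h \<in> chain m"
  let ?g = "boundary_swap m"
  have "act h r = r"
    using h by (rule chain_fixes) (simp add: r_def del: power_Suc)
  moreover have "act ?g 0 = 0" "act k 0 = r - 1" "act k (r - 1) = 0"
    using r by (simp_all add: act_boundary_swap(3)[of 0 m, folded r_def] k_def)
  ultimately have "act (?g \<otimes>\<^bsub>Gamma_grp\<^esub> h \<otimes>\<^bsub>Gamma_grp\<^esub> inv\<^bsub>Gamma_grp\<^esub> ?g \<otimes>\<^bsub>Gamma_grp\<^esub> k \<otimes>\<^bsub>Gamma_grp\<^esub> ?g
      \<otimes>\<^bsub>Gamma_grp\<^esub> k \<otimes>\<^bsub>Gamma_grp\<^esub> inv\<^bsub>Gamma_grp\<^esub> ?g) r = r - 1"
    by (simp add: boundary_swap_inv act_boundary_swap(1,2)[of m, folded r_def])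
  then show "?g \<otimes>\<^bsub>Gamma_grp\<^esub> h \<otimes>\<^bsub>Gamma_grp\<^esub> inv\<^bsub>Gamma_grp\<^esub> ?g \<otimes>\<^bsub>Gamma_grp\<^esub> k \<otimes>\<^bsub>Gamma_grp\<^esub> ?g
      \<otimes>\<^bsub>Gamma_grp\<^esub> k \<otimes>\<^bsub>Gamma_grp\<^esub> inv\<^bsub>Gamma_grp\<^esub> ?g \<notin> chain m"
    using chain_fixes[of _ m r] by (metis atLeastLessThan_iff order_less_irrefl r_def diff_0_right
        diff_left_imp_eq zero_neq_one)
qed

theorem proposition6p35:
  shows "two_generated Gamma_grp \<and> amenable Gamma_grp \<and> icc Gamma_grp \<and>
    (\<exists>N\<in>Sub (group_vN Gamma_grp).
       pimsner_popa_index (group_vN Gamma_grp) (canonical_trace Gamma_grp) N = 2 \<and>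
       maximal_subalgebra (group_vN Gamma_grp) N \<and>
       \<not> isolated_in_topology (effros_marechal (group_vN Gamma_grp) (canonical_trace Gamma_grp)) N
           (effros_marechal (group_vN Gamma_grp) (canonical_trace Gamma_grp) closure_of
              {conj_subalgebra Gamma_grp g N | g. g \<in> carrier Gamma_grp}))"
proof -
  obtain s where s: "Gam.spreading s"
    using spreading_exists by blast
  have "left_reg Gamma_grp (boundary_swap n) (Gam.avg (chain k) \<xi>)
      = Gam.avg (chain k) (left_reg Gamma_grp (boundary_swap n) \<xi>)" if "k \<noteq> n" for n k \<xi>
    using that by (intro Gam.lam_avg_commute finite_chain boundary_swap_normalizes)
  note props = chain.relcomm_u_properties[OF this boundary_swap_not_commute s]
  show ?thesis
    using two_generated_Gamma amenable_Gamma icc_Gamma props by blast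
qed

end
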